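(* Let $n\geq 4$ be an even integer, let $u\in C^\infty(\mathbb{R}^n)$, and suppose that $g=e^{2u}|dx|^2$ is a complete conformal metric on $\mathbb{R}^n$. Suppose that the scalar curvature $R_g$ is non-negative outside a compact set and that the negative part of the $n$th-order $Q$-curvature is integrable over $(\mathbb{R}^n,g)$, i.e. $\int_{\mathbb{R}^n}(Q^{(n)}_g)^- e^{nu}\,dx<+\infty$. Then $$0\leq \int_{\mathbb{R}^n}Q^{(n)}_g\,d\mu_g\leq \frac{(n-1)!\,|\mathbb{S}^n|}{2}.$$
   Context: $|dx|^2$ is the Euclidean metric on $\mathbb{R}^n$; $\Delta$ is the Euclidean Laplacian; $|\mathbb{S}^n|$ is the volume of the standard unit $n$-sphere; $d\mu_g=e^{nu}dx$; $\varphi^-:=\max\{-\varphi,0\}$. The $n$th-order $Q$-curvature $Q^{(n)}_g$ of $g=e^{2u}|dx|^2$ is defined by $(-\Delta)^{n/2}u=Q^{(n)}_g e^{nu}$. *)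

theory Defs
  imports "HOL-Analysis.Analysis"
begin

definition line_map :: "'n \<Rightarrow> (real^'n::finite \<Rightarrow> real) \<Rightarrow> real^'n \<Rightarrow> real \<Rightarrow> real"
  where "line_map i f x = (\<lambda>t. f (x + t *\<^sub>R axis i 1))"

definition partial_deriv :: "'n \<Rightarrow> (real^'n::finite \<Rightarrow> real) \<Rightarrow> real^'n \<Rightarrow> real"
  where "partial_deriv i f x = deriv (line_map i f x) 0"

text \<open>Class \<open>C\<^sup>k\<close>: all iterated partial derivatives of order at most \<open>k\<close> exist and are continuous.\<close>

primrec Ck :: "nat \<Rightarrow> (real^'n::finite \<Rightarrow> real) \<Rightarrow> bool" where
  "Ck 0 f \<longleftrightarrow> continuous_on UNIV f"
| "Ck (Suc k) f \<longleftrightarrow> continuous_on UNIV f \<and>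
     (\<forall>i. (\<forall>x. line_map i f x differentiable (at 0)) \<and> Ck k (partial_deriv i f))"

definition smooth :: "(real^'n::finite \<Rightarrow> real) \<Rightarrow> bool"
  where "smooth f \<longleftrightarrow> (\<forall>k. Ck k f)"

definition laplacian :: "(real^'n::finite \<Rightarrow> real) \<Rightarrow> real^'n \<Rightarrow> real"
  where "laplacian f x = (\<Sum>i\<in>UNIV. partial_deriv i (partial_deriv i f) x)"

text \<open>A Riemannian metric on \<open>\<real>\<^sup>n\<close> is given by its coefficient matrix
  in the standard global coordinates.\<close>

type_synonym 'n riem_metric = "real^'n \<Rightarrow> real^'n^'n"

text \<open>\<^const>\<open>valid_path\<close> (continuous, and continuously differentiable off a finite set) does not
  bound the derivative near the exceptional points, so such a curve may have infinite length.  Length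
  is therefore an extended nonnegative number; the curves of infinite length do not affect the
  infimum defining the distance.\<close>

definition riem_length :: "'n::finite riem_metric \<Rightarrow> (real \<Rightarrow> real^'n) \<Rightarrow> ennreal"
  where "riem_length g \<gamma> =
    (\<integral>\<^sup>+ t\<in>{0..1}. ennreal (sqrt (vector_derivative \<gamma> (at t) \<bullet>
        (g (\<gamma> t) *v vector_derivative \<gamma> (at t)))) \<partial>lborel)"

definition riem_dist :: "'n::finite riem_metric \<Rightarrow> real^'n \<Rightarrow> real^'n \<Rightarrow> real"
  where "riem_dist g x y = enn2real
    (INF \<gamma>\<in>{\<gamma>. valid_path \<gamma> \<and> pathstart \<gamma> = x \<and> pathfinish \<gamma> = y}. riem_length g \<gamma>)"

definition complete_metric :: "'n::finite riem_metric \<Rightarrow> bool"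
  where "complete_metric g \<longleftrightarrow> Metric_space.mcomplete UNIV (riem_dist g)"

definition christoffel :: "'n::finite riem_metric \<Rightarrow> 'n \<Rightarrow> 'n \<Rightarrow> 'n \<Rightarrow> real^'n \<Rightarrow> real"
  where "christoffel g k i j x = (1/2) * (\<Sum>l\<in>UNIV. matrix_inv (g x) $ k $ l *
    (partial_deriv i (\<lambda>y. g y $ j $ l) x + partial_deriv j (\<lambda>y. g y $ i $ l) x
      - partial_deriv l (\<lambda>y. g y $ i $ j) x))"

definition ricci :: "'n::finite riem_metric \<Rightarrow> 'n \<Rightarrow> 'n \<Rightarrow> real^'n \<Rightarrow> real"
  where "ricci g i j x =
    (\<Sum>k\<in>UNIV. partial_deriv k (christoffel g k i j) x - partial_deriv j (christoffel g k i k) x)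
    + (\<Sum>k\<in>UNIV. \<Sum>l\<in>UNIV. christoffel g k k l x * christoffel g l i j x
        - christoffel g k j l x * christoffel g l i k x)"

definition scalar_curvature :: "'n::finite riem_metric \<Rightarrow> real^'n \<Rightarrow> real"
  where "scalar_curvature g x = (\<Sum>i\<in>UNIV. \<Sum>j\<in>UNIV. matrix_inv (g x) $ i $ j * ricci g i j x)"

definition conformal_metric :: "(real^'n::finite \<Rightarrow> real) \<Rightarrow> 'n riem_metric"
  where "conformal_metric u x = exp (2 * u x) *\<^sub>R mat 1"

definition conformal_volume :: "(real^'n::finite \<Rightarrow> real) \<Rightarrow> (real^'n) measure"
  where "conformal_volume u = density lborel (\<lambda>x. ennreal (exp (real CARD('n) * u x)))"

text \<open>The solution \<open>Q\<close> of \<open>(- \<Delta>)\<^bsup>n/2\<^esup> u = Q e\<^bsup>n u\<^esup>\<close>, for even \<open>n\<close>.\<close>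

definition Q_curvature :: "(real^'n::finite \<Rightarrow> real) \<Rightarrow> real^'n \<Rightarrow> real"
  where "Q_curvature u x =
    (((\<lambda>f y. - laplacian f y) ^^ (CARD('n) div 2)) u) x / exp (real CARD('n) * u x)"

text \<open>Surface measure on the unit sphere in polar coordinates: the dimension times the volume of
  the cone over \<open>A\<close> with apex the origin.\<close>

definition sphere_area :: "'a::euclidean_space set \<Rightarrow> real"
  where "sphere_area A = real DIM('a) *
    measure lebesgue {r *\<^sub>R x | r x. 0 < r \<and> r \<le> 1 \<and> x \<in> A}"

text \<open>The sphere \<open>S\<^sup>n\<close> sits in \<open>\<real>\<^sup>n \<times> \<real>\<close>, a Euclidean space of dimension \<open>n + 1\<close>.\<close>

definition unit_sphere_volume :: "'n::finite itself \<Rightarrow> real"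
  where "unit_sphere_volume _ = sphere_area (sphere (0 :: (real^'n) \<times> real) 1)"

lemma unit_sphere_volume_eq:
  "unit_sphere_volume TYPE('n::finite) =
    2 * pi powr ((real CARD('n) + 1) / 2) / Gamma ((real CARD('n) + 1) / 2)"
proof -
  let ?s = "(real CARD('n) + 1) / 2"
  have cone: "{r *\<^sub>R x | r x. 0 < r \<and> r \<le> 1 \<and> x \<in> sphere (0 :: (real^'n) \<times> real) 1} = cball 0 1 - {0}"
    (is "?A = ?B")
  proof
    show "?A \<subseteq> ?B"
    proof
      fix y assume "y \<in> ?A"
      then obtain r x where "y = r *\<^sub>R x" "0 < r" "r \<le> 1" "norm x = 1" by force
      then have "norm y = r" by simp
      then show "y \<in> ?B" using \<open>0 < r\<close> \<open>r \<le> 1\<close> by force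
    qed
    show "?B \<subseteq> ?A"
    proof
      fix y assume y: "y \<in> ?B"
      then have "y = norm y *\<^sub>R (inverse (norm y) *\<^sub>R y)" "0 < norm y" "norm y \<le> 1"
        "inverse (norm y) *\<^sub>R y \<in> sphere 0 1" by (simp_all del: split_paired_All)
      then show "y \<in> ?A" by blast
    qed
  qed
  have "measure lebesgue (cball (0 :: (real^'n) \<times> real) 1 - {0}) = measure lborel (cball (0 :: (real^'n) \<times> real) 1)"
    by (subst measure_Diff_null_set) auto
  also have "\<dots> = unit_ball_vol (real CARD('n) + 1)"
    by (simp add: content_cball add.commute)
  finally have "unit_sphere_volume TYPE('n) = (real CARD('n) + 1) * unit_ball_vol (real CARD('n) + 1)"
    unfolding unit_sphere_volume_def sphere_area_def cone by simp
  moreover have "unit_ball_vol (real CARD('n) + 1) = pi powr ?s / Gamma (?s + 1)"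
    by (simp only: unit_ball_vol_def)
  moreover have "Gamma (?s + 1) = ?s * Gamma ?s"
  proof (rule Gamma_plus1)
    have "0 < ?s" by (simp add: add_nonneg_pos)
    then show "?s \<notin> \<int>\<^sub>\<le>\<^sub>0" by (metis nonpos_Ints_nonpos not_le)
  qed
  ultimately show ?thesis
    by simp
qed

end

theory Submission
  imports Defs
begin

text \<open>Let \<open>n = 2m\<close>, let \<open>f = (- \<Delta>)\<^sup>m u\<close>, which is \<open>Q e\<^bsup>n u\<^esup>\<close>, and let \<open>F\<close> be the integral of \<open>f\<close>, the
  total curvature.  The number \<open>c = (n - 1)! \<bar>S\<^sup>n\<bar> / 2\<close> is the mass of the point measure
  \<open>(- \<Delta>)\<^sup>m log (1 / \<bar>x\<bar>)\<close>.  The theorem holds because \<open>u\<close> behaves on average like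
  \<open>- (F / c) log \<bar>x\<bar>\<close> on large scales: nonnegative scalar curvature does not let \<open>u\<close> grow, so
  \<open>F \<ge> 0\<close>; and if \<open>F > c\<close> then \<open>e\<^sup>u\<close> decays faster than \<open>1 / \<bar>x\<bar>\<close>, which makes some ray to infinity
  have finite length and contradicts completeness.

  The scalar curvature of \<open>e\<^bsup>2u\<^esup>\<bar>dx\<bar>\<^sup>2\<close> is nonnegative where
  \<open>\<Delta>u + (m - 1) \<bar>\<nabla>u\<bar>\<^sup>2 \<le> 0\<close>, that is, where \<open>w = e\<^bsup>(m - 1) u\<^esup>\<close> is superharmonic.  A positive
  function that is superharmonic near infinity is comparable to one, \<open>W\<close>, that is superharmonic on
  the whole space (\<open>superharmonic_majorant\<close>), and the mean value inequality for \<open>W\<close> bounds its mean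
  over a ball by its infimum there (\<open>superharmonic_weak_harnack\<close>).  In terms of \<open>u\<close> this is
  \<open>log_superharmonic_scale_bound\<close>: there are numbers \<open>l R\<close>, bounded above, such that on the
  unit ball \<open>u (R z) - l R\<close> is nonnegative and has an exponential moment that is bounded
  uniformly in \<open>R\<close>.  So \<open>l R\<close> is the size of \<open>u\<close> at scale \<open>R\<close>, for \<open>u\<close> and for \<open>e\<^sup>u\<close> at once; this
  reverses Jensen's inequality.

  The curvature enters only through pairings with radial test functions.  Let \<open>\<phi>\<close> be
  \<open>(1 - \<bar>z\<bar>\<^sup>2)\<^bsup>2m + 1\<^esup>\<close> on the unit ball and zero outside.  The integral of \<open>(- \<Delta>)\<^sup>m \<phi>\<close> is zero, hence
  \<open>\<integral> f(x) \<phi>(x / R) dx = \<integral> (u (R z) - l R) (- \<Delta>)\<^sup>m \<phi>(z) dz\<close>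
  stays bounded; as the negative part of \<open>f\<close> is integrable, so is \<open>f\<close>, and the left side tends to \<open>F\<close>.
  Since \<open>\<phi>\<close> is radial, the gradient of \<open>(- \<Delta>)\<^bsup>m - 1\<^esup> \<phi>\<close> has the form \<open>\<rho>(z) z\<close>, and
  \<open>U(R) = \<integral> u (R z) \<rho>(z) dz\<close> satisfies \<open>R U'(R) = \<integral> f(x) \<phi>(x / R) dx\<close>, so that
  \<open>U(R) = F log R + o(log R)\<close>.  The total mass of \<open>\<rho>\<close> is \<open>- c\<close> (\<open>radial_kernel_mass\<close>), so
  \<open>U(R) = - c l R + O(1)\<close>.  Together these give \<open>l R = - (F / c) log R + o(log R)\<close>.  If \<open>F < 0\<close>, then
  \<open>l\<close> is unbounded above.  If \<open>F > c\<close>, then the mean of \<open>e\<^bsup>u (R z)\<^esup>\<close> over the unit ball is at most a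
  multiple of \<open>R\<^bsup>- s\<^esup>\<close> with \<open>s > 1\<close>; by Tonelli's theorem some ray \<open>r \<mapsto> r z\<close> has finite length,
  against \<open>complete_imp_ray_length_infinite\<close>.\<close>

section \<open>Functions with continuous partial derivatives\<close>

text \<open>The gradient is carried along as explicit data, so that repeated differentiation of
  products and compositions is a matter of composing rules, without unfolding
  \<^const>\<open>partial_deriv\<close>.\<close>

definition has_gradient :: "(real^'n::finite \<Rightarrow> real) \<Rightarrow> ('n \<Rightarrow> real^'n \<Rightarrow> real) \<Rightarrow> bool"
  where "has_gradient f f' \<longleftrightarrow>
    (\<forall>i x. (line_map i f x has_real_derivative f' i x) (at 0)) \<and> (\<forall>i. continuous_on UNIV (f' i))"

lemma has_gradient_line:
  assumes "has_gradient f f'"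
  shows "((\<lambda>t. f (x + t *\<^sub>R axis i 1)) has_real_derivative f' i (x + t *\<^sub>R axis i 1)) (at t)"
proof -
  have "((\<lambda>s. f ((x + t *\<^sub>R axis i 1) + s *\<^sub>R axis i 1)) has_real_derivative
      f' i (x + t *\<^sub>R axis i 1)) (at 0)"
    using assms unfolding has_gradient_def line_map_def by blast
  then have "((\<lambda>s. f (x + (s + t) *\<^sub>R axis i 1)) has_real_derivative
      f' i (x + t *\<^sub>R axis i 1)) (at 0)"
    by (simp add: algebra_simps)
  then show ?thesis
    using DERIV_shift[of "\<lambda>s. f (x + s *\<^sub>R axis i 1)" _ 0 t] by simp
qed

lemma has_gradient_partial_deriv:
  assumes "has_gradient f f'"
  shows "partial_deriv i f = f' i"
  using assms unfolding has_gradient_def partial_deriv_def by (auto intro!: DERIV_imp_deriv)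

text \<open>Continuous partial derivatives give total differentiability: the increment is split along the
  coordinate directions, and the mean value inequality bounds the error of each piece because the
  partial derivatives are nearly constant around \<open>x\<close>.  The induction is over the set \<open>A\<close> of
  directions already used, with \<open>P A h\<close> the projection of \<open>h\<close> to them.\<close>

lemma has_gradient_has_derivative:
  fixes f :: "real^'n::finite \<Rightarrow> real"
  assumes f: "has_gradient f f'"
  shows "(f has_derivative (\<lambda>h. \<Sum>i\<in>UNIV. h $ i * f' i x)) (at x)"
proof -
  define P :: "'n set \<Rightarrow> real^'n \<Rightarrow> real^'n" where "P A h = (\<chi> i. if i \<in> A then h $ i else 0)" for A h
  have nP: "norm (P A h) \<le> norm h" for A h
    unfolding P_def by (rule norm_le_componentwise_cart) auto
  have "\<exists>d>0. \<forall>h. norm h < d \<longrightarrow>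
      \<bar>f (x + P A h) - f x - (\<Sum>i\<in>A. h $ i * f' i x)\<bar> \<le> e * norm h" if "finite A" "e > 0" for A e
    using that
  proof (induction A arbitrary: e rule: finite_induct)
    case empty
    have "P {} h = 0" for h by (simp add: P_def vec_eq_iff)
    then show ?case using empty by (intro exI[of _ 1]) auto
  next
    case (insert j A)
    obtain d1 where d1: "d1 > 0" "\<And>h. norm h < d1 \<Longrightarrow>
        \<bar>f (x + P A h) - f x - (\<Sum>i\<in>A. h $ i * f' i x)\<bar> \<le> e/2 * norm h"
      using insert.IH[of "e/2"] insert.prems by auto
    have "isCont (f' j) x" using f unfolding has_gradient_def
      by (simp add: continuous_on_eq_continuous_at)
    then obtain d2 where d2: "d2 > 0" "\<And>y. norm (y - x) < d2 \<Longrightarrow> \<bar>f' j y - f' j x\<bar> < e/2"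
      using insert.prems unfolding continuous_at_eps_delta dist_norm
      by (metis half_gt_zero real_norm_def)
    show ?case
    proof (intro exI[of _ "min d1 d2"] conjI allI impI)
      fix h :: "real^'n" assume h: "norm h < min d1 d2"
      define g where "g t = f (x + P A h + t *\<^sub>R axis j 1) - t * f' j x" for t
      have gd: "(g has_real_derivative (f' j (x + P A h + t *\<^sub>R axis j 1) - f' j x)) (at t)" for t
        unfolding g_def by (auto intro!: derivative_eq_intros has_gradient_line[OF f])
      have "norm (g (h $ j) - g 0) \<le> (e/2) * norm (h $ j - 0)"
      proof (rule field_differentiable_bound[where S = "{-\<bar>h $ j\<bar>..\<bar>h $ j\<bar>}"])
        show "(g has_real_derivative (f' j (x + P A h + t *\<^sub>R axis j 1) - f' j x))
            (at t within {-\<bar>h $ j\<bar>..\<bar>h $ j\<bar>})" for t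
          using gd has_field_derivative_at_within by blast
        fix t assume t: "t \<in> {-\<bar>h $ j\<bar>..\<bar>h $ j\<bar>}"
        have "norm (P A h + t *\<^sub>R axis j 1) \<le> norm h"
          using insert.hyps t unfolding P_def
          by (intro norm_le_componentwise_cart) (auto simp: axis_def)
        then show "norm (f' j (x + P A h + t *\<^sub>R axis j 1) - f' j x) \<le> e/2"
          using d2(2)[of "x + P A h + t *\<^sub>R axis j 1"] h by (simp add: add.assoc)
      qed auto
      also have "\<dots> \<le> e/2 * norm h"
        using component_le_norm_cart[of h j] insert.prems by (simp add: mult_left_mono)
      finally have 1: "\<bar>g (h $ j) - g 0\<bar> \<le> e/2 * norm h" by simp
      have "P (insert j A) h = P A h + (h $ j) *\<^sub>R axis j 1"
        using insert.hyps by (auto simp: P_def vec_eq_iff axis_def)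
      then have "f (x + P (insert j A) h) - f x - (\<Sum>i\<in>insert j A. h $ i * f' i x)
        = (f (x + P A h) - f x - (\<Sum>i\<in>A. h $ i * f' i x)) + (g (h $ j) - g 0)"
        using insert.hyps by (simp add: g_def algebra_simps)
      moreover have "\<bar>f (x + P A h) - f x - (\<Sum>i\<in>A. h $ i * f' i x)\<bar> \<le> e/2 * norm h"
        using d1 h by simp
      ultimately show "\<bar>f (x + P (insert j A) h) - f x - (\<Sum>i\<in>insert j A. h $ i * f' i x)\<bar> \<le> e * norm h"
        using 1 by linarith
    qed (use d1 d2 in auto)
  qed
  note * = this[OF finite[of UNIV]]
  have P: "P UNIV h = h" for h by (simp add: P_def vec_eq_iff)
  show ?thesis
    unfolding has_derivative_at_alt
  proof (intro conjI allI impI)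
    show "bounded_linear (\<lambda>h. \<Sum>i\<in>UNIV. h $ i * f' i x)"
      by (intro bounded_linear_sum bounded_linear_compose[OF bounded_linear_mult_left bounded_linear_vec_nth])
  next
    fix e :: real assume "e > 0"
    then obtain d where "d > 0" and d: "\<And>h. norm h < d \<Longrightarrow>
        \<bar>f (x + h) - f x - (\<Sum>i\<in>UNIV. h $ i * f' i x)\<bar> \<le> e * norm h"
      using *[of e] unfolding P by blast
    show "\<exists>d>0. \<forall>y. norm (y - x) < d \<longrightarrow>
      norm (f y - f x - (\<Sum>i\<in>UNIV. (y - x) $ i * f' i x)) \<le> e * norm (y - x)"
    proof (intro exI[of _ d] conjI allI impI)
      fix y assume y: "norm (y - x) < d"
      have "x + (y - x) = y" by simp
      then show "norm (f y - f x - (\<Sum>i\<in>UNIV. (y - x) $ i * f' i x)) \<le> e * norm (y - x)"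
        using d[OF y] by (simp only: real_norm_def)
    qed fact
  qed
qed

lemma has_gradient_continuous:
  assumes "has_gradient f f'" shows "continuous_on S f"
  by (intro continuous_at_imp_continuous_on ballI
      has_derivative_continuous[OF has_gradient_has_derivative[OF assms]])

lemma has_gradientI:
  assumes "\<And>i x. ((\<lambda>t. f (x + t *\<^sub>R axis i 1)) has_real_derivative f' i x) (at 0)"
    and "\<And>i. continuous_on UNIV (f' i)"
  shows "has_gradient f f'"
  using assms unfolding has_gradient_def line_map_def by blast

lemma has_gradientD:
  assumes "has_gradient f f'"
  shows "((\<lambda>t. f (x + t *\<^sub>R axis i 1)) has_real_derivative f' i x) (at 0)"
    and "continuous_on S (f' i)"
  using assms continuous_on_subset unfolding has_gradient_def line_map_def by blast+

lemma has_gradient_mult: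
  assumes "has_gradient f f'" "has_gradient g g'"
  shows "has_gradient (\<lambda>x. f x * g x) (\<lambda>i x. f' i x * g x + f x * g' i x)"
proof (rule has_gradientI)
  fix i x
  show "((\<lambda>t. f (x + t *\<^sub>R axis i 1) * g (x + t *\<^sub>R axis i 1)) has_real_derivative
      f' i x * g x + f x * g' i x) (at 0)"
    using DERIV_mult[OF has_gradientD(1)[OF assms(1), of x i] has_gradientD(1)[OF assms(2), of x i]]
    by (simp add: algebra_simps)
qed (intro continuous_intros has_gradientD[OF assms(1)] has_gradientD[OF assms(2)]
    has_gradient_continuous[OF assms(1)] has_gradient_continuous[OF assms(2)])

lemma has_gradient_add:
  assumes "has_gradient f f'" "has_gradient g g'"
  shows "has_gradient (\<lambda>x. f x + g x) (\<lambda>i x. f' i x + g' i x)"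
proof (rule has_gradientI)
  fix i x
  show "((\<lambda>t. f (x + t *\<^sub>R axis i 1) + g (x + t *\<^sub>R axis i 1)) has_real_derivative
      f' i x + g' i x) (at 0)"
    using DERIV_add[OF has_gradientD(1)[OF assms(1), of x i] has_gradientD(1)[OF assms(2), of x i]]
    by simp
qed (intro continuous_intros has_gradientD[OF assms(1)] has_gradientD[OF assms(2)])

lemma has_gradient_cmult:
  assumes "has_gradient f f'"
  shows "has_gradient (\<lambda>x. c * f x) (\<lambda>i x. c * f' i x)"
proof (rule has_gradientI)
  fix i x
  show "((\<lambda>t. c * f (x + t *\<^sub>R axis i 1)) has_real_derivative c * f' i x) (at 0)"
    using DERIV_cmult[OF has_gradientD(1)[OF assms(1), of x i]] by simp
qed (intro continuous_intros has_gradientD[OF assms(1)])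

lemma has_gradient_comp:
  assumes "has_gradient f f'" and "\<And>x. (h has_real_derivative h' (f x)) (at (f x))"
    and "continuous_on UNIV (\<lambda>x. h' (f x))"
  shows "has_gradient (\<lambda>x. h (f x)) (\<lambda>i x. h' (f x) * f' i x)"
proof (rule has_gradientI)
  fix i x
  show "((\<lambda>t. h (f (x + t *\<^sub>R axis i 1))) has_real_derivative h' (f x) * f' i x) (at 0)"
    using DERIV_chain2[of h "h' (f x)" "\<lambda>t. f (x + t *\<^sub>R axis i 1)" 0]
      has_gradientD(1)[OF assms(1), of x i] assms(2)[of x] by simp
qed (intro continuous_intros has_gradientD[OF assms(1)] assms)

lemma has_gradient_nth: "has_gradient (\<lambda>x. x $ i) (\<lambda>j x. if i = j then 1 else 0)"
proof (rule has_gradientI)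
  fix j :: 'a and x :: "real^'a"
  have "((\<lambda>t. x $ i + t * axis j 1 $ i) has_real_derivative axis j 1 $ i) (at 0)"
    by (auto intro!: derivative_eq_intros)
  then show "((\<lambda>t. (x + t *\<^sub>R axis j 1) $ i) has_real_derivative (if i = j then 1 else 0)) (at 0)"
    by (simp add: axis_def)
qed auto

lemma has_gradient_inner: "has_gradient (\<lambda>x. x \<bullet> x) (\<lambda>j x. 2 * x $ j)"
proof (rule has_gradientI)
  fix j :: 'a and x :: "real^'a"
  have eq: "(x + t *\<^sub>R axis j 1) \<bullet> (x + t *\<^sub>R axis j 1) = x \<bullet> x + 2 * t * x $ j + t * t" for t
    by (simp add: inner_simps inner_axis inner_axis' algebra_simps)
  show "((\<lambda>t. (x + t *\<^sub>R axis j 1) \<bullet> (x + t *\<^sub>R axis j 1)) has_real_derivative 2 * x $ j) (at 0)"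
    unfolding eq by (auto intro!: derivative_eq_intros)
qed (intro continuous_intros)

lemma has_gradient_dilate:
  assumes "has_gradient f f'"
  shows "has_gradient (\<lambda>x. f (y + r *\<^sub>R x)) (\<lambda>i x. r * f' i (y + r *\<^sub>R x))"
proof (rule has_gradientI)
  fix i x
  have "((\<lambda>t. r * t) has_real_derivative r) (at 0)" by (auto intro!: derivative_eq_intros)
  then have "((\<lambda>t. f ((y + r *\<^sub>R x) + (r * t) *\<^sub>R axis i 1)) has_real_derivative r * f' i (y + r *\<^sub>R x)) (at 0)"
    using DERIV_chain2[of "\<lambda>t. f ((y + r *\<^sub>R x) + t *\<^sub>R axis i 1)" "f' i (y + r *\<^sub>R x)" "\<lambda>t. r * t" 0 r]
      has_gradientD(1)[OF assms(1), of "y + r *\<^sub>R x" i] by (simp add: mult.commute)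
  then show "((\<lambda>t. f (y + r *\<^sub>R (x + t *\<^sub>R axis i 1))) has_real_derivative r * f' i (y + r *\<^sub>R x)) (at 0)"
    by (simp add: algebra_simps)
qed (intro continuous_intros continuous_on_compose2[OF has_gradientD(2)[OF assms(1)]], auto)

section \<open>Integration of compactly supported functions\<close>

lemma compact_support_integral:
  fixes g :: "real^'n::finite \<Rightarrow> real"
  assumes "continuous_on UNIV g" and 0: "\<And>x. norm x > r \<Longrightarrow> g x = 0"
  shows "integrable lborel g"
    and "g integrable_on cbox (vec (- r)) (vec r)"
    and "integral\<^sup>L lborel g = integral (cbox (vec (- r)) (vec r)) g"
proof -
  let ?B = "cbox (vec (- r)) (vec r) :: (real^'n) set"
  have "g x = 0" if "x \<notin> ?B" for x
  proof -
    have "\<not> (\<forall>i. \<bar>x $ i\<bar> \<le> r)"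
      using that unfolding mem_box_cart by (auto simp: abs_le_iff minus_le_iff)
    then obtain i where "\<bar>x $ i\<bar> > r" by (auto simp: not_le)
    then show ?thesis using 0 component_le_norm_cart[of x i] by force
  qed
  then have eq: "(\<lambda>x. indicator ?B x *\<^sub>R g x) = g" by (intro ext) (auto simp: indicator_def)
  have "integrable lborel (\<lambda>x. indicator ?B x *\<^sub>R g x)"
    by (rule borel_integrable_compact) (auto intro: continuous_on_subset[OF assms(1)])
  then have si: "set_integrable lborel ?B g" unfolding set_integrable_def .
  then show "integrable lborel g" unfolding set_integrable_def eq .
  show "g integrable_on ?B" using set_borel_integral_eq_integral(1)[OF si] .
  show "integral\<^sup>L lborel g = integral ?B g"
    using set_borel_integral_eq_integral(2)[OF si] unfolding set_lebesgue_integral_def eq .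
qed

text \<open>The integral of a translate of \<open>g\<close> does not depend on the translation; its derivative with
  respect to the translation is the integral of the partial derivative.\<close>

lemma integral_derivative_zero:
  fixes g :: "real^'n::finite \<Rightarrow> real"
  assumes g: "has_gradient g g'" and 0: "\<And>x. norm x > r \<Longrightarrow> g x = 0"
  shows "integrable lborel (g' i)" "integral\<^sup>L lborel (g' i) = 0"
proof -
  have g'0: "g' i x = 0" if "norm x > r" for x
  proof -
    have "((\<lambda>t. norm (x + t *\<^sub>R axis i 1)) \<longlongrightarrow> norm (x + 0 *\<^sub>R axis i 1)) (at (0::real))"
      by (intro tendsto_intros)
    then have "eventually (\<lambda>t. norm (x + t *\<^sub>R axis i 1) > r) (at (0::real))"
      using that by (auto dest: order_tendstoD)
    then have "eventually (\<lambda>t. norm (x + t *\<^sub>R axis i 1) > r) (nhds (0::real))"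
      using that by (simp add: eventually_nhds_conv_at)
    then have "eventually (\<lambda>t. g (x + t *\<^sub>R axis i 1) = 0) (nhds (0::real))"
      by (rule eventually_mono) (use 0 in auto)
    then have "((\<lambda>t. g (x + t *\<^sub>R axis i 1)) has_real_derivative 0) (at 0)"
      by (subst DERIV_cong_ev[OF refl _ refl, where g = "\<lambda>_. 0"]) auto
    then show ?thesis using has_gradientD(1)[OF g] DERIV_unique by blast
  qed
  show "integrable lborel (g' i)"
    using compact_support_integral(1)[OF has_gradientD(2)[OF g] g'0] .
  let ?B = "cbox (vec (- (r + 1))) (vec (r + 1)) :: (real^'n) set"
  have z: "g (x + s *\<^sub>R axis i 1) = 0" if "norm x > r + 1" "s \<in> {-1..1}" for s x
  proof (rule 0)
    have "norm x \<le> norm (x + s *\<^sub>R axis i 1) + norm (s *\<^sub>R axis i (1::real))"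
      by (metis add_diff_cancel_right' norm_triangle_ineq4)
    then show "norm (x + s *\<^sub>R axis i 1) > r" using that by (auto simp: norm_axis_1)
  qed
  have cg: "continuous_on UNIV (\<lambda>x. g (x + s *\<^sub>R axis i 1))" for s
    by (intro continuous_on_compose2[OF has_gradient_continuous[OF g]] continuous_intros) auto
  have D: "((\<lambda>s. integral ?B (\<lambda>x. g (x + s *\<^sub>R axis i 1))) has_real_derivative
      integral ?B (\<lambda>x. g' i (x + 0 *\<^sub>R axis i 1))) (at 0 within {-1..1})"
  proof (rule leibniz_rule_field_derivative)
    show "((\<lambda>s. g (x + s *\<^sub>R axis i 1)) has_real_derivative g' i (x + s *\<^sub>R axis i 1))
        (at s within {-1..1})" for x s
      using has_gradient_line[OF g] has_field_derivative_at_within by blast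
    show "(\<lambda>x. g (x + s *\<^sub>R axis i 1)) integrable_on ?B" if "s \<in> {-1..1}" for s
      using compact_support_integral(2)[OF cg, of "r+1" s] z that by blast
    show "continuous_on ({- 1..1} \<times> ?B) (\<lambda>(s, x). g' i (x + s *\<^sub>R axis i 1))"
      unfolding case_prod_beta
      by (intro continuous_on_compose2[OF has_gradientD(2)[OF g, where S=UNIV]] continuous_intros) auto
  qed auto
  have const: "integral ?B (\<lambda>x. g (x + s *\<^sub>R axis i 1)) = integral\<^sup>L lborel g" if "s \<in> {-1..1}" for s
  proof -
    have "integral ?B (\<lambda>x. g (x + s *\<^sub>R axis i 1)) = integral\<^sup>L lborel (\<lambda>x. g (x + s *\<^sub>R axis i 1))"
      using compact_support_integral(3)[OF cg, of "r+1" s] z that by metis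
    also have "\<dots> = integral\<^sup>L lborel g"
    proof -
      have "integral\<^sup>L (distr lborel borel ((+) (s *\<^sub>R axis i 1))) g
          = integral\<^sup>L lborel (\<lambda>x. g (s *\<^sub>R axis i 1 + x))"
        using has_gradient_continuous[OF g, of UNIV] borel_measurable_continuous_onI
        by (intro integral_distr) auto
      then show ?thesis unfolding lborel_distr_plus by (simp add: add.commute)
    qed
    finally show ?thesis .
  qed
  have "((\<lambda>s. integral\<^sup>L lborel g) has_real_derivative
      integral ?B (\<lambda>x. g' i (x + 0 *\<^sub>R axis i 1))) (at 0 within {-1..1})"
    by (rule has_field_derivative_transform_within[OF D zero_less_one]) (simp, rule const)
  moreover have "at 0 within {-1..1} = at (0::real)"
    by (rule at_within_interior) (simp add: interior_atLeastAtMost_real)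
  ultimately have "((\<lambda>s. integral\<^sup>L lborel g) has_real_derivative integral ?B (g' i)) (at 0)"
    by (simp only: scaleR_zero_left add_0_right)
  from DERIV_unique[OF this DERIV_const] have 0: "integral ?B (g' i) = 0" .
  have "integral\<^sup>L lborel (g' i) = integral ?B (g' i)"
    by (rule compact_support_integral(3)[OF has_gradientD(2)[OF g]]) (simp add: g'0)
  then show "integral\<^sup>L lborel (g' i) = 0" using 0 by simp
qed

lemma integral_by_parts_compact_support:
  fixes f q :: "real^'n::finite \<Rightarrow> real"
  assumes f: "has_gradient f f'" and q: "has_gradient q q'" and 0: "\<And>x. norm x > r \<Longrightarrow> q x = 0"
  shows "integral\<^sup>L lborel (\<lambda>x. f' i x * q x) = - integral\<^sup>L lborel (\<lambda>x. f x * q' i x)"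
    and "integrable lborel (\<lambda>x. f' i x * q x)" and "integrable lborel (\<lambda>x. f x * q' i x)"
proof -
  note cf = has_gradient_continuous[OF f] and cq = has_gradient_continuous[OF q]
  have c: "continuous_on UNIV (\<lambda>x. f' i x * q x)"
    by (intro continuous_intros has_gradientD[OF f] cq)
  show 1: "integrable lborel (\<lambda>x. f' i x * q x)"
    by (rule compact_support_integral(1)[OF c, of r]) (simp add: 0)
  note p = integral_derivative_zero[OF has_gradient_mult[OF f q], of r i]
  have 2: "integrable lborel (\<lambda>x. f' i x * q x + f x * q' i x)" using p 0 by simp
  show 3: "integrable lborel (\<lambda>x. f x * q' i x)"
    using Bochner_Integration.integrable_diff[OF 2 1] by simp
  show "integral\<^sup>L lborel (\<lambda>x. f' i x * q x) = - integral\<^sup>L lborel (\<lambda>x. f x * q' i x)"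
    using p(2) 0 Bochner_Integration.integral_add[OF 1 3] by simp
qed

text \<open>Weighted means over balls \<open>x + R B\<close>, with the weight rescaled to the unit ball, are
  differentiated in \<open>R\<close> under the integral sign.  This replaces surface integrals throughout.\<close>

lemma dilation_integral_DERIV:
  fixes F :: "real^'n::finite \<Rightarrow> real"
  assumes F: "has_gradient F F'" and rho: "continuous_on UNIV rho" and 0: "\<And>x. norm x > 1 \<Longrightarrow> rho x = 0"
  shows "((\<lambda>R. \<integral>z. F (x + R *\<^sub>R z) * rho z \<partial>lborel) has_real_derivative
    (\<integral>z. (\<Sum>i\<in>UNIV. z $ i * F' i (x + R *\<^sub>R z)) * rho z \<partial>lborel)) (at R)"
proof -
  let ?B = "cbox (vec (- 1)) (vec 1) :: (real^'n) set"
  have cF: "continuous_on UNIV F" by (rule has_gradient_continuous[OF F])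
  have cF': "continuous_on UNIV (F' i)" for i by (rule has_gradientD(2)[OF F])
  have c1: "continuous_on UNIV (\<lambda>z. F (x + R *\<^sub>R z) * rho z)" for R
    by (rule continuous_on_mult[OF continuous_on_compose2[OF cF] rho]) (auto intro!: continuous_intros)
  have c2: "continuous_on UNIV (\<lambda>z. (\<Sum>i\<in>UNIV. z $ i * F' i (x + R *\<^sub>R z)) * rho z)" for R
    by (rule continuous_on_mult[OF continuous_on_sum[OF continuous_on_mult[OF _ continuous_on_compose2[OF cF']]] rho])
      (auto intro!: continuous_intros)
  have d: "((\<lambda>R. F (x + R *\<^sub>R z)) has_real_derivative (\<Sum>i\<in>UNIV. z $ i * F' i (x + R *\<^sub>R z))) (at R)" for z R
  proof -
    have "((\<lambda>R. x + R *\<^sub>R z) has_derivative (\<lambda>t. t *\<^sub>R z)) (at R)"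
      by (auto intro!: derivative_eq_intros)
    from has_derivative_compose[OF this has_gradient_has_derivative[OF F]]
    moreover have "(\<lambda>t. \<Sum>i\<in>UNIV. (t *\<^sub>R z) $ i * F' i (x + R *\<^sub>R z))
        = (*) (\<Sum>i\<in>UNIV. z $ i * F' i (x + R *\<^sub>R z))"
      by (intro ext) (simp add: sum_distrib_left sum_distrib_right mult_ac)
    ultimately show ?thesis unfolding has_field_derivative_def by simp
  qed
  have "((\<lambda>R. integral ?B (\<lambda>z. F (x + R *\<^sub>R z) * rho z)) has_real_derivative
    integral ?B (\<lambda>z. (\<Sum>i\<in>UNIV. z $ i * F' i (x + R *\<^sub>R z)) * rho z)) (at R within UNIV)"
  proof (rule leibniz_rule_field_derivative)
    show "((\<lambda>R. F (x + R *\<^sub>R z) * rho z) has_real_derivative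
        (\<Sum>i\<in>UNIV. z $ i * F' i (x + R *\<^sub>R z)) * rho z) (at R within UNIV)" for z R
      using DERIV_mult[OF d[of z R] DERIV_const[of "rho z"]] by simp
    show "(\<lambda>z. F (x + R *\<^sub>R z) * rho z) integrable_on ?B" for R
      using compact_support_integral(2)[OF c1, of 1 R] 0 by simp
    show "continuous_on (UNIV \<times> ?B) (\<lambda>(R, z). (\<Sum>i\<in>UNIV. z $ i * F' i (x + R *\<^sub>R z)) * rho z)"
      unfolding case_prod_beta
      by (rule continuous_on_mult[OF continuous_on_sum[OF continuous_on_mult[OF _ continuous_on_compose2[OF cF']]]
            continuous_on_compose2[OF rho]]) (auto intro!: continuous_intros)
  qed auto
  then show ?thesis
    using compact_support_integral(3)[OF c1, of 1] compact_support_integral(3)[OF c2, of 1 R] 0 by simp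
qed

section \<open>Smooth functions and iterated Laplacians\<close>

lemma Ck_continuous: "Ck k f \<Longrightarrow> continuous_on UNIV f"
  by (cases k) auto

lemma Ck_Suc_has_gradient:
  assumes "Ck (Suc k) f" shows "has_gradient f (\<lambda>i. partial_deriv i f)"
proof -
  have "line_map i f x differentiable (at 0)" for i x using assms by simp
  then have "(line_map i f x has_real_derivative partial_deriv i f x) (at 0)" for i x
    unfolding partial_deriv_def by (metis DERIV_deriv_iff_real_differentiable)
  moreover have "continuous_on UNIV (partial_deriv i f)" for i
    using assms Ck_continuous by auto
  ultimately show ?thesis unfolding has_gradient_def by blast
qed

lemma Ck_SucI:
  assumes f: "has_gradient f f'" and "\<And>i. Ck k (f' i)"
  shows "Ck (Suc k) f"
proof -
  have "line_map i f x differentiable (at 0)" for i x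
    using f unfolding has_gradient_def real_differentiable_def by blast
  then show ?thesis
    using assms(2) has_gradient_continuous[OF f] has_gradient_partial_deriv[OF f] by simp
qed

lemma Ck_add: "Ck k f \<Longrightarrow> Ck k g \<Longrightarrow> Ck k (\<lambda>x. f x + g x)"
proof (induction k arbitrary: f g)
  case 0 then show ?case by (auto intro!: continuous_intros)
next
  case (Suc k)
  show ?case
    by (rule Ck_SucI[OF has_gradient_add[OF Ck_Suc_has_gradient[OF Suc.prems(1)] Ck_Suc_has_gradient[OF Suc.prems(2)]]])
      (use Suc in auto)
qed

lemma Ck_cmult: "Ck k f \<Longrightarrow> Ck k (\<lambda>x. c * f x)"
proof (induction k arbitrary: f)
  case 0 then show ?case by (auto intro!: continuous_intros)
next
  case (Suc k)
  show ?case
    by (rule Ck_SucI[OF has_gradient_cmult[OF Ck_Suc_has_gradient[OF Suc.prems(1)]]])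
      (use Suc in auto)
qed

lemma Ck_const: "Ck k (\<lambda>x. c)"
proof (induction k arbitrary: c)
  case (Suc k)
  have "has_gradient (\<lambda>x. c) (\<lambda>i x. 0)" by (rule has_gradientI) auto
  from Ck_SucI[OF this] show ?case using Suc by blast
qed auto

lemma Ck_dilate: "Ck k f \<Longrightarrow> Ck k (\<lambda>x. f (r *\<^sub>R x))"
proof (induction k arbitrary: f)
  case 0 then show ?case
    by (auto intro!: continuous_intros elim!: continuous_on_compose2)
next
  case (Suc k)
  have "has_gradient (\<lambda>x. f (r *\<^sub>R x)) (\<lambda>i x. r * partial_deriv i f (r *\<^sub>R x))"
    using has_gradient_dilate[OF Ck_Suc_has_gradient[OF Suc.prems], of 0 r] by simp
  then show ?case
    by (rule Ck_SucI) (use Suc in \<open>auto intro!: Ck_cmult\<close>)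
qed

lemma smooth_has_gradient: "smooth f \<Longrightarrow> has_gradient f (\<lambda>i. partial_deriv i f)"
  using Ck_Suc_has_gradient smooth_def by blast

lemma smooth_partial_deriv: "smooth f \<Longrightarrow> smooth (partial_deriv i f)"
  unfolding smooth_def by (metis Ck.simps(2))

lemma smooth_dilate: "smooth f \<Longrightarrow> smooth (\<lambda>x. f (r *\<^sub>R x))"
  unfolding smooth_def using Ck_dilate by blast

lemma smooth_sum: "finite A \<Longrightarrow> (\<And>i. i \<in> A \<Longrightarrow> smooth (f i)) \<Longrightarrow> smooth (\<lambda>x. \<Sum>i\<in>A. f i x)"
  by (induction A rule: finite_induct) (auto simp: smooth_def Ck_const intro!: Ck_add)

lemma smooth_neg_laplacian:
  assumes "smooth f" shows "smooth (\<lambda>x. - laplacian f x)"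
proof -
  have "smooth (\<lambda>x. \<Sum>i\<in>UNIV. partial_deriv i (partial_deriv i f) x)"
    using assms by (intro smooth_sum) (auto intro: smooth_partial_deriv)
  then have "smooth (\<lambda>x. - 1 * (\<Sum>i\<in>UNIV. partial_deriv i (partial_deriv i f) x))"
    unfolding smooth_def using Ck_cmult by blast
  then show ?thesis unfolding laplacian_def[abs_def] by simp
qed

definition polylaplacian :: "nat \<Rightarrow> (real^'n::finite \<Rightarrow> real) \<Rightarrow> real^'n \<Rightarrow> real"
  where "polylaplacian k u = ((\<lambda>f y. - laplacian f y) ^^ k) u"

lemma polylaplacian_simps [simp]:
  "polylaplacian 0 u = u"
  "polylaplacian (Suc k) u = (\<lambda>y. - laplacian (polylaplacian k u) y)"
  by (auto simp: polylaplacian_def)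

lemma smooth_polylaplacian: "smooth u \<Longrightarrow> smooth (polylaplacian k u)"
  by (induction k) (auto intro: smooth_neg_laplacian)

text \<open>The factor \<open>c\<close> allows the rule to be applied twice in a row.\<close>

lemma partial_deriv_dilate:
  assumes "smooth f"
  shows "partial_deriv i (\<lambda>x. c * f (r *\<^sub>R x)) = (\<lambda>x. c * r * partial_deriv i f (r *\<^sub>R x))"
  using has_gradient_partial_deriv[OF has_gradient_cmult[OF has_gradient_dilate[OF smooth_has_gradient[OF assms], of 0 r]], of i c]
  by (simp add: mult.assoc)

lemma polylaplacian_dilate:
  assumes "smooth u"
  shows "polylaplacian k (\<lambda>x. u (r *\<^sub>R x)) = (\<lambda>x. r ^ (2 * k) * polylaplacian k u (r *\<^sub>R x))"
proof (induction k)
  case (Suc k)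
  note s = smooth_polylaplacian[OF assms, of k]
  show ?case
    unfolding polylaplacian_simps Suc laplacian_def partial_deriv_dilate[OF s]
      partial_deriv_dilate[OF smooth_partial_deriv[OF s]]
    by (simp add: sum_distrib_left power2_eq_square mult_ac)
qed auto

section \<open>Truncated radial polynomials as test functions\<close>

text \<open>Test functions: polynomials in \<open>\<bar>x\<bar>\<^sup>2\<close>, cut off at the unit sphere.  They have as many
  continuous derivatives as the polynomial has zeros at \<open>1\<close>, and the Laplacian acts on them as an
  ordinary differential operator on polynomials.\<close>

definition radial_cutoff :: "real poly \<Rightarrow> real^'n::finite \<Rightarrow> real"
  where "radial_cutoff p x = (if x \<bullet> x < 1 then poly p (x \<bullet> x) else 0)"

lemma cutoff_continuous:
  assumes "poly p 1 = 0"
  shows "continuous_on UNIV (\<lambda>t. if t < 1 then poly p t else (0::real))"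
proof -
  have eq: "(\<lambda>t. if t < 1 then poly p t else 0) = (\<lambda>t. poly p (min t 1))"
    using assms by (auto simp: min_def)
  show ?thesis unfolding eq by (intro continuous_intros)
qed

lemma cutoff_has_derivative:
  assumes p: "poly p 1 = 0" "poly (pderiv p) 1 = 0"
  shows "((\<lambda>t. if t < 1 then poly p t else 0) has_real_derivative
    (if t < 1 then poly (pderiv p) t else 0)) (at t)"
proof -
  let ?h = "\<lambda>t. if t < 1 then poly p t else 0"
  consider "t < 1" | "t > 1" | "t = 1" by linarith
  then show ?thesis
  proof cases
    case 1
    have "(?h has_real_derivative poly (pderiv p) t) (at t)"
      by (rule has_field_derivative_transform_within_open[of "poly p" _ _ "{..<1}"])
        (use 1 in \<open>auto intro: poly_DERIV\<close>)
    then show ?thesis using 1 by simp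
  next
    case 2
    have "(?h has_real_derivative 0) (at t)"
      by (rule has_field_derivative_transform_within_open[of "\<lambda>_. 0" _ _ "{1<..}"])
        (use 2 in auto)
    then show ?thesis using 2 by simp
  next
    case 3
    have "((\<lambda>y. (poly p y - poly p 1) / (y - 1)) \<longlongrightarrow> 0) (at_left 1)"
      using poly_DERIV[of p 1] p has_field_derivative_at_within
      unfolding has_field_derivative_iff by fastforce
    then have l: "((\<lambda>y. (?h y - ?h 1) / (y - 1)) \<longlongrightarrow> 0) (at_left 1)"
      by (rule Lim_transform_eventually) (auto simp: eventually_at_filter p)
    have r: "((\<lambda>y. (?h y - ?h 1) / (y - 1)) \<longlongrightarrow> 0) (at_right 1)"
      by (rule Lim_transform_eventually[of "\<lambda>_. 0"]) (auto simp: eventually_at_filter)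
    from filterlim_split_at[OF l r] show ?thesis
      using 3 unfolding has_field_derivative_iff by simp
  qed
qed

lemma radial_cutoff_continuous: "poly p 1 = 0 \<Longrightarrow> continuous_on S (radial_cutoff p)"
  unfolding radial_cutoff_def[abs_def]
  by (rule continuous_on_compose2[OF cutoff_continuous]) (auto intro!: continuous_intros)

lemma radial_cutoff_zero: "norm x > 1 \<Longrightarrow> radial_cutoff p x = 0"
  by (auto simp: radial_cutoff_def dot_square_norm power_less_one_iff)

lemma radial_cutoff_has_gradient:
  assumes p: "poly p 1 = 0" "poly (pderiv p) 1 = 0"
  shows "has_gradient (radial_cutoff p :: real^'n::finite \<Rightarrow> real) (\<lambda>i x. radial_cutoff (pderiv p) x * (2 * x $ i))"
proof -
  have "has_gradient (\<lambda>x::real^'n. (\<lambda>t. if t < 1 then poly p t else 0) (x \<bullet> x))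
      (\<lambda>i x. (\<lambda>t. if t < 1 then poly (pderiv p) t else 0) (x \<bullet> x) * (2 * x $ i))"
    by (rule has_gradient_comp[OF has_gradient_inner cutoff_has_derivative[OF p]])
      (rule continuous_on_compose2[OF cutoff_continuous[OF p(2)]], auto intro!: continuous_intros)
  then show ?thesis unfolding radial_cutoff_def[abs_def] by simp
qed

text \<open>The operator \<open>- \<Delta>\<close> on functions of \<open>t = \<bar>x\<bar>\<^sup>2\<close> in dimension \<open>2m\<close>: there \<open>\<Delta> = 4 (t \<partial>\<^sup>2 + m \<partial>)\<close>.\<close>

definition radial_neg_laplacian :: "real \<Rightarrow> real poly \<Rightarrow> real poly"
  where "radial_neg_laplacian m p = smult (- 4) (pCons 0 (pderiv (pderiv p)) + smult m (pderiv p))"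

text \<open>Since \<open>\<nabla>\<close> of the test function for \<open>p\<close> is \<open>x\<close> times the test function for \<open>2 p'\<close>, the integral
  on the left is the Dirichlet pairing of \<open>f\<close> with the test function.  Here one derivative is moved
  onto \<open>f\<close>; in \<open>radial_green_second\<close> it is moved onto the test function.  The weight \<open>2 p'\<close> is what
  comes out when means of dilates are differentiated (\<open>dilation_integral_DERIV\<close>).\<close>

lemma radial_green_first:
  fixes f' :: "'n::finite \<Rightarrow> real^'n \<Rightarrow> real"
  assumes f: "\<And>i. has_gradient (f' i) (f'' i)" and p: "poly p 1 = 0" "poly (pderiv p) 1 = 0"
  shows "(\<integral>x. (\<Sum>i\<in>UNIV. x $ i * f' i x) * radial_cutoff (smult 2 (pderiv p)) x \<partial>lborel)
    = - (\<integral>x. (\<Sum>i\<in>UNIV. f'' i i x) * radial_cutoff p x \<partial>lborel)"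
proof -
  note g = radial_cutoff_has_gradient[OF p, where 'n='n]
  have q0: "radial_cutoff p x = 0" if "norm x > 1" for x :: "real^'n"
    using that by (rule radial_cutoff_zero)
  note b = integral_by_parts_compact_support[OF f g q0]
  have "(\<integral>x. (\<Sum>i\<in>UNIV. x $ i * f' i x) * radial_cutoff (smult 2 (pderiv p)) x \<partial>lborel)
    = (\<integral>x. (\<Sum>i\<in>UNIV. f' i x * (radial_cutoff (pderiv p) x * (2 * x $ i))) \<partial>lborel)"
    by (rule Bochner_Integration.integral_cong[OF refl])
      (simp add: sum_distrib_left sum_distrib_right radial_cutoff_def mult_ac)
  also have "\<dots> = (\<Sum>i\<in>UNIV. \<integral>x. f' i x * (radial_cutoff (pderiv p) x * (2 * x $ i)) \<partial>lborel)"
    by (rule Bochner_Integration.integral_sum) (rule b(3))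
  also have "\<dots> = (\<Sum>i\<in>UNIV. - (\<integral>x. f'' i i x * radial_cutoff p x \<partial>lborel))"
    by (subst b(1)) auto
  also have "\<dots> = - (\<Sum>i\<in>UNIV. \<integral>x. f'' i i x * radial_cutoff p x \<partial>lborel)"
    by (simp add: sum_negf)
  also have "(\<Sum>i\<in>UNIV. \<integral>x. f'' i i x * radial_cutoff p x \<partial>lborel)
     = (\<integral>x. (\<Sum>i\<in>UNIV. f'' i i x * radial_cutoff p x) \<partial>lborel)"
    by (rule Bochner_Integration.integral_sum[symmetric]) (rule b(2))
  finally show ?thesis by (simp add: sum_distrib_right)
qed

lemma radial_green_second:
  fixes f :: "real^'n::finite \<Rightarrow> real"
  assumes f: "has_gradient f f'" and p: "poly (pderiv p) 1 = 0" "poly (pderiv (pderiv p)) 1 = 0"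
  shows "(\<integral>x. (\<Sum>i\<in>UNIV. x $ i * f' i x) * radial_cutoff (smult 2 (pderiv p)) x \<partial>lborel)
    = (\<integral>x. f x * radial_cutoff (radial_neg_laplacian (real CARD('n) / 2) p) x \<partial>lborel)"
proof -
  have g: "has_gradient (\<lambda>x::real^'n. radial_cutoff (pderiv p) x * (2 * x $ i))
     (\<lambda>j x. radial_cutoff (pderiv (pderiv p)) x * (2 * x $ j) * (2 * x $ i) +
        radial_cutoff (pderiv p) x * (2 * (if i = j then 1 else 0)))" (is "has_gradient (?q i) (?q' i)") for i
    by (rule has_gradient_mult[OF radial_cutoff_has_gradient[OF p] has_gradient_cmult[OF has_gradient_nth]])
  have q0: "norm x > 1 \<Longrightarrow> ?q i x = 0" for x i by (simp add: radial_cutoff_zero)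
  note b = integral_by_parts_compact_support[OF f g q0]
  have "(\<integral>x. (\<Sum>i\<in>UNIV. x $ i * f' i x) * radial_cutoff (smult 2 (pderiv p)) x \<partial>lborel)
    = (\<integral>x. (\<Sum>i\<in>UNIV. f' i x * ?q i x) \<partial>lborel)"
    by (rule Bochner_Integration.integral_cong[OF refl])
      (simp add: sum_distrib_left sum_distrib_right radial_cutoff_def mult_ac)
  also have "\<dots> = (\<Sum>i\<in>UNIV. \<integral>x. f' i x * ?q i x \<partial>lborel)"
    by (rule Bochner_Integration.integral_sum) (rule b(2))
  also have "\<dots> = (\<Sum>i\<in>UNIV. - (\<integral>x. f x * ?q' i i x \<partial>lborel))"
    by (subst b(1)) auto
  also have "\<dots> = - (\<Sum>i\<in>UNIV. \<integral>x. f x * ?q' i i x \<partial>lborel)"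
    by (simp only: sum_negf)
  also have "(\<Sum>i\<in>UNIV. \<integral>x. f x * ?q' i i x \<partial>lborel) = (\<integral>x. (\<Sum>i\<in>UNIV. f x * ?q' i i x) \<partial>lborel)"
    by (rule Bochner_Integration.integral_sum[symmetric]) (rule b(3))
  also have "- \<dots> = (\<integral>x. - (\<Sum>i\<in>UNIV. f x * ?q' i i x) \<partial>lborel)"
    by simp
  also have "\<dots> = (\<integral>x. f x * radial_cutoff (radial_neg_laplacian (real CARD('n) / 2) p) x \<partial>lborel)"
  proof (rule Bochner_Integration.integral_cong[OF refl])
    fix x :: "real^'n"
    have "(\<Sum>i\<in>UNIV. ?q' i i x) = radial_cutoff (pderiv (pderiv p)) x * 4 * (\<Sum>i\<in>UNIV. x $ i * x $ i)
        + 2 * real CARD('n) * radial_cutoff (pderiv p) x"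
      by (simp add: sum.distrib sum_distrib_left mult_ac)
    also have "\<dots> = - radial_cutoff (radial_neg_laplacian (real CARD('n) / 2) p) x"
      by (simp add: radial_cutoff_def radial_neg_laplacian_def inner_vec_def algebra_simps)
    finally show "- (\<Sum>i\<in>UNIV. f x * ?q' i i x) = f x * radial_cutoff (radial_neg_laplacian (real CARD('n) / 2) p) x"
      by (simp add: sum_distrib_left[symmetric])
  qed
  finally show ?thesis .
qed

lemma dvd_pderiv:
  assumes "[:1, - 1::real:] ^ Suc k dvd p" shows "[:1, - 1:] ^ k dvd pderiv p"
proof -
  obtain q where "p = [:1, - 1:] ^ Suc k * q" using assms by auto
  then have "pderiv p = [:1, - 1:] ^ k * ([:1, - 1:] * pderiv q - smult (real (Suc k)) q)"
    by (simp only: pderiv_mult pderiv_power_Suc) (simp add: pderiv_pCons algebra_simps)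
  then show ?thesis by simp
qed

lemma dvd_poly_1: "[:1, - 1::real:] ^ Suc k dvd p \<Longrightarrow> poly p 1 = 0"
  by (auto elim!: dvdE)

text \<open>Each Laplacian costs two orders of vanishing at the unit sphere; counting these orders is how
  the boundary terms are seen to vanish.\<close>

lemma dvd_radial_neg_laplacian:
  assumes "[:1, - 1::real:] ^ (k + 2) dvd p"
  shows "[:1, - 1:] ^ k dvd radial_neg_laplacian m p"
proof -
  have 1: "[:1, - 1:] ^ Suc k dvd pderiv p" using dvd_pderiv[of "Suc k" p] assms by simp
  then have 2: "[:1, - 1:] ^ k dvd pderiv (pderiv p)" by (rule dvd_pderiv)
  have 3: "[:1, - 1:] ^ k dvd pderiv p" using 1 by (metis dvd_mult_right power_Suc)
  have "pCons 0 (pderiv (pderiv p)) = [:0, 1:] * pderiv (pderiv p)" by simp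
  then show ?thesis unfolding radial_neg_laplacian_def using 2 3
    by (metis dvd_add dvd_mult dvd_smult)
qed

lemma dvd_radial_neg_laplacian_pow:
  assumes "[:1, - 1::real:] ^ (k + 2 * j) dvd p"
  shows "[:1, - 1:] ^ k dvd (radial_neg_laplacian m ^^ j) p"
  using assms
proof (induction j arbitrary: k)
  case (Suc j)
  have "[:1, - 1:] ^ (k + 2) dvd (radial_neg_laplacian m ^^ j) p"
    using Suc.IH[of "k+2"] Suc.prems by (simp add: add_ac)
  then show ?case using dvd_radial_neg_laplacian by simp
qed auto

lemma dvd_vanishes:
  assumes "[:1, - 1::real:] ^ 3 dvd p"
  shows "poly p 1 = 0" "poly (pderiv p) 1 = 0" "poly (pderiv (pderiv p)) 1 = 0"
proof -
  have 2: "[:1, - 1:] ^ Suc (Suc 0) dvd pderiv p"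
    using dvd_pderiv[of "Suc (Suc 0)" p] assms by (simp add: numeral_3_eq_3)
  have 3: "[:1, - 1:] ^ Suc 0 dvd pderiv (pderiv p)" using dvd_pderiv[OF 2] .
  show "poly p 1 = 0" using dvd_poly_1[of 2 p] assms by simp
  show "poly (pderiv p) 1 = 0" using dvd_poly_1[OF 2] .
  show "poly (pderiv (pderiv p)) 1 = 0" using dvd_poly_1[OF 3] .
qed

text \<open>Each integration by parts needs three zeros at the unit sphere and removes two, so \<open>2 k + 1\<close>
  zeros last for \<open>k\<close> of them.\<close>

lemma polylaplacian_radial_green:
  fixes f :: "real^'n::finite \<Rightarrow> real"
  assumes "smooth f" and "[:1, - 1::real:] ^ (2 * k + 1) dvd p"
  shows "(\<integral>x. polylaplacian k f x * radial_cutoff p x \<partial>lborel)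
    = (\<integral>x. f x * radial_cutoff ((radial_neg_laplacian (real CARD('n) / 2) ^^ k) p) x \<partial>lborel)"
  using assms(2)
proof (induction k arbitrary: p)
  case (Suc k)
  let ?g = "polylaplacian k f"
  have s: "smooth ?g" using assms(1) by (rule smooth_polylaplacian)
  have "[:1, - 1:] ^ 3 dvd p" 
    using Suc.prems by (rule dvd_trans[rotated]) (rule le_imp_power_dvd, simp)
  note v = dvd_vanishes[OF this]
  have "(\<integral>x. polylaplacian (Suc k) f x * radial_cutoff p x \<partial>lborel)
    = - (\<integral>x. (\<Sum>i\<in>UNIV. partial_deriv i (partial_deriv i ?g) x) * radial_cutoff p x \<partial>lborel)"
    by (simp add: laplacian_def)
  also have "\<dots> = (\<integral>x. (\<Sum>i\<in>UNIV. x $ i * partial_deriv i ?g x) * radial_cutoff (smult 2 (pderiv p)) x \<partial>lborel)"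
    by (rule radial_green_first[symmetric, OF smooth_has_gradient[OF smooth_partial_deriv[OF s]] v(1,2)])
  also have "\<dots> = (\<integral>x. ?g x * radial_cutoff (radial_neg_laplacian (real CARD('n) / 2) p) x \<partial>lborel)"
    by (rule radial_green_second[OF smooth_has_gradient[OF s] v(2,3)])
  also have "\<dots> = (\<integral>x. f x * radial_cutoff ((radial_neg_laplacian (real CARD('n) / 2) ^^ k)
      (radial_neg_laplacian (real CARD('n) / 2) p)) x \<partial>lborel)"
    by (rule Suc.IH, rule dvd_radial_neg_laplacian) (use Suc.prems in simp)
  finally show ?case by (simp add: funpow_swap1)
qed auto

section \<open>The mass of the radial kernel\<close>

text \<open>In dimension \<open>2m\<close> the integral of a radial function \<open>q(\<bar>x\<bar>\<^sup>2)\<close> over the unit ball is a multiple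
  of the integral of \<open>t\<^bsup>m - 1\<^esup> q(t)\<close> over \<open>[0, 1]\<close>, so the mass of the kernel is computed there.\<close>

definition unit_integral :: "real poly \<Rightarrow> real"
  where "unit_integral q = (\<integral>s. poly q s * indicator {0..1} s \<partial>lborel)"

lemma unit_integral_integrable:
  fixes q :: "real poly" shows "integrable lborel (\<lambda>s. poly q s * indicator {0..1} s)"
  using borel_integrable_compact[of "{0..1::real}" "poly q"] 
  by (simp add: mult.commute continuous_on_poly)

lemma unit_integral_pderiv: "unit_integral (pderiv q) = poly q 1 - poly q 0"
  unfolding unit_integral_def
  by (rule integral_FTC_Icc_real) (auto intro: poly_DERIV)

lemma unit_integral_add: "unit_integral (p + q) = unit_integral p + unit_integral q"
  unfolding unit_integral_def using unit_integral_integrable[of p] unit_integral_integrable[of q]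
  by (simp add: distrib_right)

lemma unit_integral_smult: "unit_integral (smult c p) = c * unit_integral p"
  unfolding unit_integral_def by (simp add: mult.assoc)

lemma pderiv_X_power_mult:
  "pderiv ([:0, 1::real:] ^ j * p) = [:0, 1:] ^ j * pderiv p + smult (real j) ([:0, 1:] ^ (j - 1) * p)"
  by (simp add: pderiv_mult pderiv_power pderiv_pCons algebra_simps)

lemma unit_integral_X_pderiv:
  assumes "poly p 1 = 0" "j > 0"
  shows "unit_integral ([:0, 1:] ^ j * pderiv p) = - real j * unit_integral ([:0, 1:] ^ (j - 1) * p)"
  using unit_integral_pderiv[of "[:0, 1:] ^ j * p"] assms
  by (simp add: zero_power pderiv_X_power_mult unit_integral_add unit_integral_smult)

text \<open>The one-dimensional form of \<open>- \<Delta> \<bar>x\<bar>\<^bsup>- 2i\<^esup> = 4 i (m - 1 - i) \<bar>x\<bar>\<^bsup>- 2i - 2\<^esup>\<close>, with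
  \<open>j = m - 1 - i\<close>; the value \<open>j = 0\<close> corresponds to the fundamental solution \<open>\<bar>x\<bar>\<^bsup>2 - 2m\<^esup>\<close>, which
  evaluates \<open>p\<close> at the origin.\<close>

lemma unit_integral_radial_neg_laplacian:
  assumes p: "poly p 1 = 0" "poly (pderiv p) 1 = 0"
  shows "unit_integral ([:0, 1:] ^ j * radial_neg_laplacian m p) =
    (if j = 0 then 4 * (m - 1) * poly p 0
     else 4 * real j * (m - 1 - real j) * unit_integral ([:0, 1:] ^ (j - 1) * p))"
proof -
  have eq: "[:0, 1:] ^ j * radial_neg_laplacian m p =
      smult (- 4) ([:0, 1:] ^ Suc j * pderiv (pderiv p) + smult m ([:0, 1:] ^ j * pderiv p))"
    unfolding radial_neg_laplacian_def by (simp add: algebra_simps)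
  have 1: "unit_integral ([:0, 1:] ^ Suc j * pderiv (pderiv p)) = - real (Suc j) * unit_integral ([:0, 1:] ^ j * pderiv p)"
    using unit_integral_X_pderiv[OF p(2), of "Suc j"] by simp
  have 2: "unit_integral ([:0, 1:] ^ j * radial_neg_laplacian m p)
      = - 4 * (m - 1 - real j) * unit_integral ([:0, 1:] ^ j * pderiv p)"
    unfolding eq unit_integral_smult unit_integral_add 1 by (simp add: algebra_simps)
  show ?thesis
  proof (cases "j = 0")
    case True
    have "unit_integral (pderiv p) = - poly p 0" using unit_integral_pderiv[of p] p by simp
    then show ?thesis using 2 True by (simp add: algebra_simps)
  next
    case False
    then show ?thesis using 2 unit_integral_X_pderiv[OF p(1), of j] by (simp add: algebra_simps)
  qed
qed

lemma dvd_vanishes2: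
  assumes "[:1, - 1::real:] ^ 2 dvd p"
  shows "poly p 1 = 0" "poly (pderiv p) 1 = 0"
  using dvd_poly_1[of "Suc 0" p] dvd_poly_1[OF dvd_pderiv[of "Suc 0" p]] assms
  by (simp_all add: numeral_2_eq_2)

text \<open>The recursion contributes the product of \<open>4 i (m - 1 - i)\<close> over \<open>1 \<le> i \<le> j\<close>, and its start the
  factor \<open>4 (m - 1)\<close>; the factorial on the left makes that product a quotient-free expression.\<close>

lemma unit_integral_radial_neg_laplacian_pow:
  assumes "[:1, - 1:] ^ (2 * j + 2) dvd p" and "j + 2 \<le> m"
  shows "unit_integral ([:0, 1:] ^ j * (radial_neg_laplacian (real m) ^^ Suc j) p) * fact (m - 2 - j) =
    4 ^ Suc j * (real m - 1) * fact j * fact (m - 2) * poly p 0"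
  using assms
proof (induction j)
  case 0
  then have "poly p 1 = 0" "poly (pderiv p) 1 = 0" using dvd_vanishes2[of p]
    by (simp_all only: mult_0_right add_0)
  from unit_integral_radial_neg_laplacian[OF this, of 0 "real m"] show ?case by simp
next
  case (Suc j)
  let ?q = "(radial_neg_laplacian (real m) ^^ Suc j) p"
  have "[:1, - 1:] ^ 2 dvd ?q"
    by (rule dvd_radial_neg_laplacian_pow) (use Suc.prems in \<open>simp add: add.commute\<close>)
  then have v: "poly ?q 1 = 0" "poly (pderiv ?q) 1 = 0"
    by (rule dvd_vanishes2)+
  have "[:1, - 1:] ^ (2 * j + 2) dvd p"
    using Suc.prems(1) by (rule dvd_trans[rotated]) (rule le_imp_power_dvd, simp)
  then have IH: "unit_integral ([:0, 1:] ^ j * ?q) * fact (m - 2 - j) = 4 ^ Suc j * (real m - 1) * fact j * fact (m - 2) * poly p 0"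
    using Suc.IH Suc.prems by simp
  have e: "m - 2 - j = Suc (m - 2 - Suc j)" using Suc.prems by simp
  have r: "real m - 1 - real (Suc j) = real (m - 2 - j)" using Suc.prems by (simp add: of_nat_diff)
  have "unit_integral ([:0, 1:] ^ Suc j * (radial_neg_laplacian (real m) ^^ Suc (Suc j)) p)
      = 4 * real (Suc j) * (real m - 1 - real (Suc j)) * unit_integral ([:0, 1:] ^ j * ?q)"
    using unit_integral_radial_neg_laplacian[OF v, of "Suc j" "real m"] by simp
  then have "unit_integral ([:0, 1:] ^ Suc j * (radial_neg_laplacian (real m) ^^ Suc (Suc j)) p) * fact (m - 2 - Suc j)
      = 4 * real (Suc j) * (unit_integral ([:0, 1:] ^ j * ?q) * (real (m - 2 - j) * fact (m - 2 - Suc j)))"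
    unfolding r by (simp only: mult_ac)
  also have "real (m - 2 - j) * fact (m - 2 - Suc j) = fact (m - 2 - j)"
    unfolding e by simp
  also note IH
  finally show ?case by (simp add: mult_ac)
qed

text \<open>Layer-cake: \<open>p(\<bar>x\<bar>\<^sup>2)\<close> is minus the integral of \<open>p'\<close> from \<open>\<bar>x\<bar>\<^sup>2\<close> to \<open>1\<close>.  After exchanging the
  integrals, the inner one is the volume of the ball of radius \<open>\<surd>s\<close>, a multiple of \<open>s\<^sup>m\<close>.\<close>

lemma radial_cutoff_integral:
  assumes n: "CARD('n::finite) = 2 * m" and p: "poly p 1 = 0"
  shows "integral\<^sup>L lborel (radial_cutoff p :: real^'n \<Rightarrow> real) =
    - unit_ball_vol (real CARD('n)) * unit_integral ([:0, 1:] ^ m * pderiv p)"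
proof -
  define F :: "real^'n \<Rightarrow> real \<Rightarrow> real"
    where "F x s = (if x \<bullet> x \<le> s \<and> s \<le> 1 then poly (pderiv p) s else 0)" for x s
  have x: "(\<integral>s. F x s \<partial>lborel) = - radial_cutoff p x" for x
  proof (cases "x \<bullet> x \<le> 1")
    case True
    have "(\<integral>s. F x s \<partial>lborel) = (\<integral>s. poly (pderiv p) s * indicator {x \<bullet> x..1} s \<partial>lborel)"
      by (rule Bochner_Integration.integral_cong) (auto simp: F_def indicator_def)
    also have "\<dots> = poly p 1 - poly p (x \<bullet> x)"
      by (rule integral_FTC_Icc_real) (auto intro: poly_DERIV True)
    finally show ?thesis using True p by (cases "x \<bullet> x = 1") (auto simp: radial_cutoff_def)
  next
    case False
    then have "F x s = 0" for s by (auto simp: F_def)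
    then show ?thesis using False by (simp add: radial_cutoff_def)
  qed
  have s: "(\<integral>x. F x s \<partial>lborel) = unit_ball_vol (real CARD('n)) * (poly ([:0, 1:] ^ m * pderiv p) s * indicator {0..1} s)" for s
  proof (cases "s \<in> {0..1}")
    case True
    have le: "x \<bullet> x \<le> s \<longleftrightarrow> norm x \<le> sqrt s" for x :: "real^'n"
      using True by (simp add: norm_eq_sqrt_inner)
    have "(\<integral>x. F x s \<partial>lborel) = (\<integral>x. poly (pderiv p) s * indicator (cball (0 :: real^'n) (sqrt s)) x \<partial>lborel)"
      using True by (intro Bochner_Integration.integral_cong) (auto simp: F_def indicator_def le)
    also have "\<dots> = poly (pderiv p) s * measure lborel (cball (0 :: real^'n) (sqrt s))"
      by simp
    also have "measure lborel (cball (0 :: real^'n) (sqrt s)) = unit_ball_vol (real CARD('n)) * sqrt s ^ (2 * m)"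
      using True n by (subst content_cball) auto
    also have "sqrt s ^ (2 * m) = s ^ m" using True by (simp add: power_mult)
    finally show ?thesis using True by (simp add: poly_power)
  next
    case False
    have "F x s = 0" for x using False inner_ge_zero[of x] unfolding F_def
      by (metis atLeastAtMost_iff order_trans)
    then show ?thesis using False by simp
  qed
  have int: "integrable (lborel \<Otimes>\<^sub>M lborel) (\<lambda>(x, s). F x s)"
  proof -
    obtain B where B: "\<And>s. s \<in> {0..1} \<Longrightarrow> norm (poly (pderiv p) s) \<le> B"
      using compact_imp_bounded[OF compact_continuous_image[OF continuous_on_poly[OF continuous_on_id] compact_Icc]]
      unfolding bounded_iff by (metis imageI)
    have "emeasure lborel (cball (0::real^'n) 1 \<times> {0..1::real}) < \<infinity>"
      by (intro emeasure_compact_finite compact_Times) auto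
    then have fin: "emeasure (lborel \<Otimes>\<^sub>M lborel) (cball (0::real^'n) 1 \<times> {0..1::real}) < \<infinity>"
      by (simp add: lborel_prod)
    have zero: "(case z of (x, s) \<Rightarrow> F x s) = 0" if z: "z \<notin> cball 0 1 \<times> {0..1}" for z
    proof (rule ccontr)
      obtain x s where xs: "z = (x, s)" by force
      assume "(case z of (x, s) \<Rightarrow> F x s) \<noteq> 0"
      then have *: "x \<bullet> x \<le> s" "s \<le> 1" using xs by (auto simp: F_def split: if_splits)
      have "0 \<le> x \<bullet> x" by simp
      then have "0 \<le> s" "x \<bullet> x \<le> 1" using * by linarith+
      then show False using z xs * by (simp add: norm_eq_sqrt_inner)
    qed
    have bound: "norm (case z of (x, s) \<Rightarrow> F x s) \<le> B" if z: "z \<in> cball 0 1 \<times> {0..1}" for z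
    proof -
      obtain x s where xs: "z = (x, s)" by force
      then have "norm (poly (pderiv p) s) \<le> B" using z B by auto
      moreover then have "0 \<le> B" using norm_ge_zero order_trans by blast
      ultimately show ?thesis using xs by (auto simp: F_def)
    qed
    show ?thesis
    proof (rule integrableI_bounded_set[where A = "cball 0 1 \<times> {0..1}" and B = B])
      show "AE z in lborel \<Otimes>\<^sub>M lborel. z \<notin> cball 0 1 \<times> {0..1} \<longrightarrow> (case z of (x, s) \<Rightarrow> F x s) = 0"
        using zero by (intro AE_I2) blast
      show "AE z in lborel \<Otimes>\<^sub>M lborel. z \<in> cball 0 1 \<times> {0..1} \<longrightarrow> norm (case z of (x, s) \<Rightarrow> F x s) \<le> B"
        using bound by (intro AE_I2) blast
      show "(\<lambda>(x, s). F x s) \<in> borel_measurable (lborel \<Otimes>\<^sub>M lborel)"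
      proof -
        let ?C = "{z :: (real^'n) \<times> real. fst z \<bullet> fst z \<le> snd z \<and> snd z \<le> 1}"
        have "closed ?C" by (intro closed_Collect_conj closed_Collect_le continuous_intros)
        moreover have "(\<lambda>z :: (real^'n) \<times> real. poly (pderiv p) (snd z)) \<in> borel_measurable borel"
          by (intro borel_measurable_continuous_onI continuous_intros)
        ultimately have "(\<lambda>z. if z \<in> ?C then poly (pderiv p) (snd z) else 0) \<in> borel_measurable borel"
          by (intro measurable_If_set) auto
        moreover have "(\<lambda>(x, s). F x s) = (\<lambda>z. if z \<in> ?C then poly (pderiv p) (snd z) else 0)"
          by (auto simp: F_def)
        ultimately show ?thesis by (simp add: lborel_prod)
      qed
    qed (use fin in auto)
  qed
  have "- integral\<^sup>L lborel (radial_cutoff p :: real^'n \<Rightarrow> real) = (\<integral>x. (\<integral>s. F x s \<partial>lborel) \<partial>lborel)"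
    unfolding x by simp
  also have "\<dots> = (\<integral>s. (\<integral>x. F x s \<partial>lborel) \<partial>lborel)"
    by (rule lborel_pair.Fubini_integral[symmetric, OF int])
  also have "\<dots> = unit_ball_vol (real CARD('n)) * unit_integral ([:0, 1:] ^ m * pderiv p)"
    unfolding s unit_integral_def by simp
  finally show ?thesis by simp
qed

text \<open>This computes the constant of the theorem.  If \<open>\<psi> = (- \<Delta>)\<^bsup>m - 1\<^esup> \<phi>\<close> has gradient \<open>\<rho>(z) z\<close>, then
  \<open>\<integral> \<rho> = \<integral> log \<bar>z\<bar> (- \<Delta>)\<^sup>m \<phi>(z) dz\<close>, that is, \<open>- c \<phi>(0)\<close> with \<open>c\<close> the mass of
  \<open>(- \<Delta>)\<^sup>m log (1 / \<bar>z\<bar>)\<close>.  The radial computation gives \<open>c = 2 \<cdot> 4\<^bsup>m - 1\<^esup> \<pi>\<^sup>m (m - 1)!\<close>, and Legendre's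
  duplication formula for the Gamma function turns this into half of \<open>(n - 1)! \<bar>S\<^sup>n\<bar>\<close>.\<close>

lemma radial_kernel_mass:
  assumes n: "CARD('n::finite) = 2 * m" and m: "2 \<le> m"
    and p: "[:1, - 1:] ^ (2 * m + 1) dvd p" "poly p 0 = 1"
  shows "integral\<^sup>L lborel (radial_cutoff (smult 2 (pderiv ((radial_neg_laplacian (real m) ^^ (m - 1)) p))) :: real^'n \<Rightarrow> real)
    = - (fact (CARD('n) - 1) * unit_sphere_volume TYPE('n) / 2)"
proof -
  let ?psi = "(radial_neg_laplacian (real m) ^^ (m - 1)) p"
  let ?V = "unit_ball_vol (real CARD('n))"
  have d: "[:1, - 1:] ^ 3 dvd ?psi"
  proof (rule dvd_radial_neg_laplacian_pow)
    have "3 + 2 * (m - 1) = 2 * m + 1" using m by simp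
    then show "[:1, - 1:] ^ (3 + 2 * (m - 1)) dvd p" using p(1) by (simp only:)
  qed
  note v = dvd_vanishes[OF d]
  have J: "unit_integral ([:0, 1:] ^ (m - 2) * ?psi) = 4 ^ (m - 1) * (real m - 1) * fact (m - 2) * fact (m - 2)"
  proof -
    have "[:1, - 1:] ^ (2 * (m - 2) + 2) dvd p"
      using p(1) by (rule dvd_trans[rotated]) (rule le_imp_power_dvd, use m in simp)
    moreover have "Suc (m - 2) = m - 1" using m by simp
    ultimately show ?thesis
      using unit_integral_radial_neg_laplacian_pow[of "m - 2" p m] p(2) m by simp
  qed
  have "unit_integral ([:0, 1:] ^ m * pderiv (smult 2 (pderiv ?psi))) = - real m * (2 * unit_integral ([:0, 1:] ^ (m - 1) * pderiv ?psi))"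
    using unit_integral_X_pderiv[of "smult 2 (pderiv ?psi)" m] v m by (simp add: unit_integral_smult)
  also have "unit_integral ([:0, 1:] ^ (m - 1) * pderiv ?psi) = - real (m - 1) * unit_integral ([:0, 1:] ^ (m - 2) * ?psi)"
    using unit_integral_X_pderiv[of ?psi "m - 1"] v m by (simp add: numeral_2_eq_2)
  finally have "integral\<^sup>L lborel (radial_cutoff (smult 2 (pderiv ?psi)) :: real^'n \<Rightarrow> real)
      = - (?V * (2 * real m * real (m - 1) * unit_integral ([:0, 1:] ^ (m - 2) * ?psi)))"
    by (subst radial_cutoff_integral[OF n]) (use v in auto)
  also have "\<dots> = - (2 * 4 ^ (m - 1) * pi ^ m * fact (m - 1))"
  proof -
    have f1: "fact m = real m * fact (m - 1)" and f2: "(fact (m - 1) :: real) = real (m - 1) * fact (m - 2)"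
      using m fact_reduce[of m, where 'a = real] fact_reduce[of "m - 1", where 'a = real]
      by (simp_all add: numeral_2_eq_2)
    have A: "P / (M * (N * f)) * (2 * M * N * (c * N * f * f)) = 2 * c * P * (N * f)"
      if "M \<noteq> 0" "N \<noteq> 0" "f \<noteq> 0" for P M N f c :: real
      using that by (simp add: field_simps)
    have N: "real m - 1 = real (m - 1)" "real m \<noteq> 0" "real (m - 1) \<noteq> 0" using m by (simp_all add: of_nat_diff)
    have "?V = pi ^ m / fact m"
      using m by (simp add: unit_ball_vol_def n Gamma_fact powr_realpow add.commute)
    then show ?thesis unfolding J f1 f2 N(1) using A[OF N(2,3) fact_nonzero] by simp
  qed
  also have "2 * 4 ^ (m - 1) * pi ^ m * fact (m - 1) = fact (CARD('n) - 1) * unit_sphere_volume TYPE('n) / 2"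
  proof -
    have G: "Gamma (real m) * Gamma (real m + 1/2) = exp ((1 - 2 * real m) * ln 2) * sqrt pi * Gamma (2 * real m)"
    proof -
      have ni: "complex_of_nat m \<notin> \<int>\<^sub>\<le>\<^sub>0" "complex_of_nat m + 1/2 \<notin> \<int>\<^sub>\<le>\<^sub>0"
        using m by (auto elim!: nonpos_Ints_cases simp: complex_eq_iff)
      have "complex_of_real (Gamma (real m) * Gamma (real m + 1/2)) = Gamma (complex_of_nat m) * Gamma (complex_of_nat m + 1/2)"
        using Gamma_complex_of_real[of "real m"] Gamma_complex_of_real[of "real m + 1/2"] by simp
      also have "\<dots> = exp ((1 - 2 * complex_of_nat m) * complex_of_real (ln 2)) * complex_of_real (sqrt pi) * Gamma (2 * complex_of_nat m)"
        using Gamma_legendre_duplication[OF ni] by simp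
      also have "\<dots> = complex_of_real (exp ((1 - 2 * real m) * ln 2) * sqrt pi * Gamma (2 * real m))"
        using Gamma_complex_of_real[of "2 * real m"] exp_of_real[of "(1 - 2 * real m) * ln 2", where 'a = complex] by simp
      finally show ?thesis by (simp only: of_real_eq_iff)
    qed
    have e: "exp ((1 - 2 * real m) * ln 2) = 1 / (2 * 4 ^ (m - 1))"
    proof -
      have "exp ((1 - 2 * real m) * ln 2) = 2 powr (1 - 2 * real m)" by (simp add: powr_def)
      also have "\<dots> = 2 powr (- (real (2 * (m - 1) + 1)))" using m by (simp add: of_nat_diff)
      also have "\<dots> = 1 / 2 ^ (2 * (m - 1) + 1)" by (simp only: powr_minus powr_realpow zero_less_numeral inverse_eq_divide)
      finally show ?thesis by (simp add: power_mult)
    qed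
    have G1: "Gamma (real m) = fact (m - 1)" using m Gamma_fact[of "m - 1"] by (simp add: of_nat_diff)
    have G2: "Gamma (2 * real m) = fact (2 * m - 1)" using m Gamma_fact[of "2 * m - 1"] by (simp add: of_nat_diff)
    have G3: "Gamma (real m + 1/2) > 0" by (rule Gamma_real_pos) simp
    have "pi powr (real m + 1/2) = pi ^ m * sqrt pi"
      by (simp add: powr_add powr_realpow powr_half_sqrt)
    moreover have "(real CARD('n) + 1) / 2 = real m + 1/2" using n by simp
    ultimately have S: "unit_sphere_volume TYPE('n) = 2 * (pi ^ m * sqrt pi) / Gamma (real m + 1/2)"
      unfolding unit_sphere_volume_eq by (simp only:)
    define g where "g = Gamma (real m + 1/2)"
    have "fact (m - 1) * g * (2 * 4 ^ (m - 1)) = sqrt pi * fact (2 * m - 1)" "g > 0"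
      using G G3 unfolding e G1 G2 g_def[symmetric] by (simp_all add: field_simps)
    then show ?thesis
      unfolding S n g_def[symmetric] by (simp add: field_simps)
  qed
  finally show ?thesis .
qed

section \<open>Positive functions superharmonic near infinity\<close>

lemma second_derivative_nonneg_at_local_min:
  fixes g :: "real \<Rightarrow> real"
  assumes d: "d > 0" and g: "\<And>t. \<bar>t\<bar> < d \<Longrightarrow> (g has_real_derivative g' t) (at t)"
    and g': "(g' has_real_derivative D) (at 0)" and min: "\<And>t. \<bar>t\<bar> < d \<Longrightarrow> g 0 \<le> g t"
  shows "0 \<le> D"
proof (rule ccontr)
  assume "\<not> 0 \<le> D"
  have 0: "g' 0 = 0"
    by (rule DERIV_local_min[OF g[of 0] d]) (use d min in auto)
  obtain e where e: "e > 0" "\<And>h. 0 < h \<Longrightarrow> h < e \<Longrightarrow> g' h < 0"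
    using DERIV_neg_dec_right[OF g'] \<open>\<not> 0 \<le> D\<close> 0 by (auto simp: not_le)
  define t where "t = min d e / 2"
  have t: "0 < t" "t < d" "t < e" using d e(1) by (auto simp: t_def min_def)
  obtain s where s: "0 < s" "s < t" "g t - g 0 = (t - 0) * g' s"
    using MVT2[of 0 t g g'] t g by auto
  then have "g t - g 0 < 0" using t e(2)[of s] by (simp add: mult_pos_neg)
  then show False using min[of t] t by simp
qed

lemma inverse_power_DERIV:
  fixes t :: real assumes "t \<noteq> 0"
  shows "((\<lambda>t. 1 / t ^ k) has_real_derivative - real k / t ^ Suc k) (at t)"
proof (cases k)
  case (Suc j)
  show ?thesis unfolding Suc
    by (rule derivative_eq_intros refl | use assms in \<open>simp add: field_simps power2_eq_square\<close>)+
qed auto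

text \<open>Minimum principle.  The function \<open>h = t\<^bsup>1 - m\<^esup> + t\<^bsup>- m\<^esup>\<close> of \<open>t = \<bar>x\<bar>\<^sup>2\<close> decays like the
  fundamental solution and is strictly subharmonic away from the origin, thanks to its second
  term.  For small \<open>c\<close> the difference \<open>w - c h\<close> is nonnegative on a sphere and not negative in
  the limit at infinity, so a negative value outside the sphere would produce an interior minimum,
  where the Laplacian cannot be negative.\<close>

lemma positive_superharmonic_lower_bound:
  fixes w :: "real^'n::finite \<Rightarrow> real"
  assumes n: "CARD('n) = 2 * m" and m: "2 \<le> m"
    and w: "has_gradient w w'" "\<And>i. has_gradient (w' i) (w'' i)"
    and pos: "\<And>x. w x > 0" and sup: "\<And>x. norm x > R0 \<Longrightarrow> (\<Sum>i\<in>UNIV. w'' i i x) \<le> 0"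
  shows "\<exists>c>0. \<forall>x. c / (1 + x \<bullet> x) ^ (m - 1) \<le> w x"
proof -
  define R1 where "R1 = max 1 R0"
  have R1: "R1 \<ge> 1" "R1 \<ge> R0" by (auto simp: R1_def)
  define H where "H t = 1 / t ^ (m - 1) + 1 / t ^ m" for t :: real
  define H1 where "H1 t = - real (m - 1) / t ^ m + - real m / t ^ Suc m" for t :: real
  define H2 where "H2 t = real (m - 1) * real m / t ^ Suc m + real m * real (Suc m) / t ^ Suc (Suc m)" for t :: real
  have m1: "Suc (m - 1) = m" using m by simp
  have DH: "(H has_real_derivative H1 t) (at t)" if "t \<noteq> 0" for t
    unfolding H_def H1_def
    using DERIV_add[OF inverse_power_DERIV[OF that, of "m - 1"] inverse_power_DERIV[OF that, of m]]
    unfolding m1 .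
  have DH1: "(H1 has_real_derivative H2 t) (at t)" if "t \<noteq> 0" for t
  proof -
    have "((\<lambda>t. - real (m - 1) * (1 / t ^ m) + - real m * (1 / t ^ Suc m)) has_real_derivative
       - real (m - 1) * (- real m / t ^ Suc m) + - real m * (- real (Suc m) / t ^ Suc (Suc m))) (at t)"
      by (intro DERIV_add DERIV_cmult inverse_power_DERIV that)
    then show ?thesis unfolding H1_def H2_def by (simp del: power_Suc of_nat_Suc)
  qed
  have H_lap: "4 * t * H2 t + 4 * real m * H1 t = 4 * real m / t ^ Suc m" if "t > 0" for t
    using that m unfolding H1_def H2_def by (simp add: field_simps of_nat_diff)
  have H2b: "H t \<le> 2 / t" if "t \<ge> 1" for t
  proof -
    have "t \<le> t ^ (m - 1)" "t \<le> t ^ m" using that m by (auto intro!: self_le_power)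
    then have "1 / t ^ (m - 1) \<le> 1 / t" "1 / t ^ m \<le> 1 / t" using that by (auto intro!: divide_left_mono mult_pos_pos)
    then show ?thesis unfolding H_def by simp
  qed
  have cw: "continuous_on UNIV w" by (rule has_gradient_continuous[OF w(1)])
  have "cball 0 R1 \<noteq> ({} :: (real^'n) set)" using R1 by simp
  then obtain x0 where "\<And>x. x \<in> cball 0 R1 \<Longrightarrow> w x0 \<le> w x"
    using continuous_attains_inf[OF compact_cball[of 0 R1] _ continuous_on_subset[OF cw subset_UNIV]] by blast
  then obtain mu where mu: "mu > 0" "\<And>x. norm x \<le> R1 \<Longrightarrow> mu \<le> w x"
    using pos[of x0] by auto
  define c where "c = mu / 2"
  have c: "c > 0" using mu by (simp add: c_def)
  define phi where "phi x = w x - c * H (x \<bullet> x)" for x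
  have xx: "x \<bullet> x = (norm x)\<^sup>2" for x :: "real^'n" by (simp add: dot_square_norm)
  have phi_inner: "phi x \<ge> 0" if "norm x = R1" for x
  proof -
    have "1 \<le> x \<bullet> x" using that R1 by (simp add: xx)
    then have "2 / (x \<bullet> x) \<le> 2" by (subst pos_divide_le_eq) linarith+
    then have "H (x \<bullet> x) \<le> 2" using H2b[OF \<open>1 \<le> x \<bullet> x\<close>] by linarith
    then have "c * H (x \<bullet> x) \<le> c * 2" using c by (intro mult_left_mono) auto
    then show ?thesis using mu(2)[of x] that unfolding phi_def c_def by simp
  qed
  have phi_pos: "phi x \<ge> 0" if "norm x \<ge> R1" for x
  proof (rule ccontr)
    assume neg: "\<not> phi x \<ge> 0"
    \<comment> \<open>beyond this radius \<open>c h\<close> is smaller than \<open>- phi x\<close>, so the minimum is not attained there\<close>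
    define R2 where "R2 = max (norm x + 1) (2 * c / (- phi x) + 1)"
    have R2: "R2 > norm x" "R2 > 2 * c / (- phi x)" by (auto simp: R2_def)
    have outer: "phi y > phi x" if "norm y \<ge> R2" for y
    proof -
      have y1: "norm y \<ge> 1" using that R2 \<open>norm x \<ge> R1\<close> R1 by linarith
      then have "norm y \<le> y \<bullet> y" unfolding xx by (simp add: self_le_power)
      then have "2 / (y \<bullet> y) \<le> 2 / norm y" using y1 by (intro divide_left_mono) (auto intro!: mult_pos_pos)
      then have "H (y \<bullet> y) \<le> 2 / norm y" using H2b[of "y \<bullet> y"] y1 \<open>norm y \<le> y \<bullet> y\<close> by linarith
      then have "c * H (y \<bullet> y) \<le> c * (2 / norm y)" using c by (intro mult_left_mono) auto
      moreover have "2 * c / (- phi x) < norm y" using R2 that by linarith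
      then have "2 * c < norm y * (- phi x)" using neg by (subst (asm) pos_divide_less_eq) auto
      then have "2 * c / norm y < - phi x" using y1 by (subst pos_divide_less_eq) (auto simp: mult.commute)
      then have "c * (2 / norm y) < - phi x" by (simp add: mult.commute)
      ultimately show ?thesis using pos[of y] unfolding phi_def by linarith
    qed
    let ?A = "cball 0 R2 - ball 0 R1 :: (real^'n) set"
    have cA: "compact ?A" by (intro compact_diff) auto
    have xA: "x \<in> ?A" using that R2 by auto
    have cphi: "continuous_on ?A phi"
    proof -
      have "y \<bullet> y \<noteq> 0" if "y \<in> ?A" for y using that R1 by auto
      then show ?thesis unfolding phi_def H_def
        by (intro continuous_intros continuous_on_subset[OF cw subset_UNIV]) auto
    qed
    obtain y where y: "y \<in> ?A" "\<And>z. z \<in> ?A \<Longrightarrow> phi y \<le> phi z"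
      using continuous_attains_inf[OF cA _ cphi] xA by blast
    have py: "phi y \<le> phi x" using y xA by blast
    have "norm y \<noteq> R1" using py neg phi_inner by force
    moreover have "norm y < R2" using outer[of y] py by force
    ultimately have yn: "R1 < norm y" "norm y < R2" using y(1) by auto
    define d where "d = min (norm y - R1) (R2 - norm y)"
    have d: "d > 0" using yn by (simp add: d_def)
    have near: "R1 < norm (y + t *\<^sub>R axis i 1)" "norm (y + t *\<^sub>R axis i 1) < R2" if "\<bar>t\<bar> < d" for t i
    proof -
      have *: "norm (t *\<^sub>R axis i (1::real) :: real^'n) < d" using that by (simp add: norm_axis_1)
      have "norm (y + t *\<^sub>R axis i 1) \<le> norm y + norm (t *\<^sub>R axis i (1::real) :: real^'n)"
        by (rule norm_triangle_ineq)
      moreover have "norm y \<le> norm (y + t *\<^sub>R axis i 1) + norm (t *\<^sub>R axis i (1::real) :: real^'n)"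
        by (metis add_diff_cancel_right' norm_triangle_ineq4)
      ultimately show "R1 < norm (y + t *\<^sub>R axis i 1)" "norm (y + t *\<^sub>R axis i 1) < R2"
        using * unfolding d_def by linarith+
    qed
    have ty: "y \<bullet> y > 0" using yn R1 by auto
    have D2: "0 \<le> w'' i i y - c * (H2 (y \<bullet> y) * (2 * y $ i) * (2 * y $ i) + H1 (y \<bullet> y) * 2)" for i
    proof -
      let ?l = "\<lambda>t. y + t *\<^sub>R axis i 1"
      define tau where "tau t = ?l t \<bullet> ?l t" for t
      have tau0: "tau t \<noteq> 0" if "\<bar>t\<bar> < d" for t using near(1)[OF that, of i] R1 unfolding tau_def by auto
      have Dtau: "(tau has_real_derivative 2 * ?l t $ i) (at t)" for t
        unfolding tau_def by (rule has_gradient_line[OF has_gradient_inner])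
      show ?thesis
      proof (rule second_derivative_nonneg_at_local_min[OF d])
        show "((\<lambda>t. phi (?l t)) has_real_derivative w' i (?l t) - c * (H1 (tau t) * (2 * ?l t $ i))) (at t)"
          if "\<bar>t\<bar> < d" for t
          unfolding phi_def tau_def[symmetric]
          by (intro DERIV_diff DERIV_cmult has_gradient_line[OF w(1)] DERIV_chain2[OF DH[OF tau0[OF that]] Dtau])
        have "((\<lambda>t. 2 * ?l t $ i) has_real_derivative 2 * 1) (at 0)"
          by (auto intro!: derivative_eq_intros simp: axis_def)
        from DERIV_mult[OF DERIV_chain2[OF DH1[OF tau0[of 0]] Dtau] this]
        have "((\<lambda>t. H1 (tau t) * (2 * ?l t $ i)) has_real_derivative
            H2 (y \<bullet> y) * (2 * y $ i) * (2 * y $ i) + H1 (y \<bullet> y) * 2) (at 0)"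
          using d by (simp add: tau_def mult_ac)
        then show "((\<lambda>t. w' i (?l t) - c * (H1 (tau t) * (2 * ?l t $ i))) has_real_derivative
            w'' i i y - c * (H2 (y \<bullet> y) * (2 * y $ i) * (2 * y $ i) + H1 (y \<bullet> y) * 2)) (at 0)"
          by (intro DERIV_diff DERIV_cmult has_gradientD(1)[OF w(2)])
        show "phi (?l 0) \<le> phi (?l t)" if "\<bar>t\<bar> < d" for t
          using y(2)[of "?l t"] near[OF that, of i] by auto
      qed
    qed
    have "0 \<le> (\<Sum>i\<in>UNIV. w'' i i y - c * (H2 (y \<bullet> y) * (2 * y $ i) * (2 * y $ i) + H1 (y \<bullet> y) * 2))"
      by (intro sum_nonneg D2)
    also have "\<dots> = (\<Sum>i\<in>UNIV. w'' i i y) - c * (4 * (y \<bullet> y) * H2 (y \<bullet> y) + 4 * real m * H1 (y \<bullet> y))"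
    proof -
      have "(\<Sum>i\<in>UNIV. H2 (y \<bullet> y) * (2 * y $ i) * (2 * y $ i) + H1 (y \<bullet> y) * 2)
          = 4 * H2 (y \<bullet> y) * (\<Sum>i\<in>UNIV. y $ i * y $ i) + real CARD('n) * (H1 (y \<bullet> y) * 2)"
        by (simp add: sum.distrib sum_distrib_left mult_ac)
      also have "(\<Sum>i\<in>UNIV. y $ i * y $ i) = y \<bullet> y" by (simp add: inner_vec_def)
      finally have eq: "(\<Sum>i\<in>UNIV. H2 (y \<bullet> y) * (2 * y $ i) * (2 * y $ i) + H1 (y \<bullet> y) * 2)
          = 4 * (y \<bullet> y) * H2 (y \<bullet> y) + 4 * real m * H1 (y \<bullet> y)" using n by simp
      show ?thesis unfolding sum_subtractf sum_distrib_left[symmetric] eq ..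
    qed
    also have "\<dots> \<le> 0 - c * (4 * real m / (y \<bullet> y) ^ Suc m)"
      unfolding H_lap[OF ty] using sup[of y] yn R1 by simp
    also have "\<dots> < 0" using c m ty by simp
    finally show False by simp
  qed
  show ?thesis
  proof (intro exI[of _ c] conjI allI c)
    fix x :: "real^'n"
    have p1: "1 \<le> (1 + x \<bullet> x) ^ (m - 1)" by (rule one_le_power) simp
    show "c / (1 + x \<bullet> x) ^ (m - 1) \<le> w x"
    proof (cases "norm x \<ge> R1")
      case True
      then have t: "x \<bullet> x > 0" using R1 by auto
      have "c / (1 + x \<bullet> x) ^ (m - 1) \<le> c / (x \<bullet> x) ^ (m - 1)"
        using c t by (intro divide_left_mono power_mono mult_pos_pos zero_less_power; linarith)
      also have "\<dots> \<le> c * H (x \<bullet> x)" using c t unfolding H_def by (simp add: field_simps)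
      also have "\<dots> \<le> w x" using phi_pos[OF True] by (simp add: phi_def)
      finally show ?thesis .
    next
      case False
      have "c / (1 + x \<bullet> x) ^ (m - 1) \<le> c / 1" using c p1 by (intro divide_left_mono; linarith)
      also have "\<dots> \<le> w x" using mu(2)[of x] False mu(1) unfolding c_def by simp
      finally show ?thesis .
    qed
  qed
qed

text \<open>The function \<open>(1 + \<bar>x\<bar>\<^sup>2)\<^bsup>1 - m\<^esup>\<close> has a strictly negative Laplacian everywhere.  A multiple of
  it makes up for the failure of superharmonicity of \<open>w\<close> on a bounded set, and by the minimum
  principle it is at most a multiple of \<open>w\<close>.\<close>

lemma superharmonic_majorant:
  fixes w :: "real^'n::finite \<Rightarrow> real"
  assumes n: "CARD('n) = 2 * m" and m: "2 \<le> m"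
    and w: "has_gradient w w'" "\<And>i. has_gradient (w' i) (w'' i)"
    and pos: "\<And>x. w x > 0" and sup: "\<And>x. norm x > R0 \<Longrightarrow> (\<Sum>i\<in>UNIV. w'' i i x) \<le> 0"
  obtains W W' W'' C where "has_gradient W W'" "\<And>i. has_gradient (W' i) (W'' i)"
    "\<And>x. (\<Sum>i\<in>UNIV. W'' i i x) \<le> 0" "\<And>x. w x \<le> W x" "\<And>x. W x \<le> C * w x" "C > 0"
proof -
  obtain c where c: "c > 0" "\<And>x. c / (1 + x \<bullet> x) ^ (m - 1) \<le> w x"
    using positive_superharmonic_lower_bound[OF assms] by blast
  have m1: "Suc (m - 1) = m" using m by simp
  define B where "B t = 1 / (1 + t) ^ (m - 1)" for t :: real
  define B1 where "B1 t = - real (m - 1) / (1 + t) ^ m" for t :: real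
  define B2 where "B2 t = real (m - 1) * real m / (1 + t) ^ Suc m" for t :: real
  have s: "((\<lambda>t. 1 + t) has_real_derivative 1) (at t)" for t :: real
    by (auto intro!: derivative_eq_intros)
  have DB: "(B has_real_derivative B1 t) (at t)" if "t \<ge> 0" for t
    unfolding B_def B1_def
    using DERIV_chain2[OF inverse_power_DERIV[of "1 + t" "m - 1"] s] that unfolding m1 by simp
  have DB1: "(B1 has_real_derivative B2 t) (at t)" if "t \<ge> 0" for t
    unfolding B1_def B2_def
    using DERIV_cmult[OF DERIV_chain2[OF inverse_power_DERIV[of "1 + t" m] s], of "- real (m - 1)"] that by simp
  have cB: "continuous_on UNIV (\<lambda>x::real^'n. B1 (x \<bullet> x))" "continuous_on UNIV (\<lambda>x::real^'n. B2 (x \<bullet> x))"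
  proof -
    have "1 + x \<bullet> x \<noteq> 0" for x :: "real^'n" using inner_ge_zero[of x] by linarith
    then show "continuous_on UNIV (\<lambda>x::real^'n. B1 (x \<bullet> x))" "continuous_on UNIV (\<lambda>x::real^'n. B2 (x \<bullet> x))"
      unfolding B1_def B2_def by (intro continuous_intros; simp)+
  qed
  have gb: "has_gradient (\<lambda>x::real^'n. B (x \<bullet> x)) (\<lambda>i x. B1 (x \<bullet> x) * (2 * x $ i))"
    by (rule has_gradient_comp[OF has_gradient_inner DB cB(1)]) simp
  have gb1: "has_gradient (\<lambda>x::real^'n. B1 (x \<bullet> x)) (\<lambda>i x. B2 (x \<bullet> x) * (2 * x $ i))"
    by (rule has_gradient_comp[OF has_gradient_inner DB1 cB(2)]) simp
  note gb2 = has_gradient_mult[OF gb1 has_gradient_cmult[OF has_gradient_nth]]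
  have clap: "continuous_on (cball 0 R0) (\<lambda>x. \<Sum>i\<in>UNIV. w'' i i x)"
    by (intro continuous_intros has_gradientD(2)[OF w(2)])
  obtain M where M: "\<And>x. norm x \<le> R0 \<Longrightarrow> (\<Sum>i\<in>UNIV. w'' i i x) \<le> M"
  proof -
    have "bounded ((\<lambda>x. \<Sum>i\<in>UNIV. w'' i i x) ` cball 0 R0)"
      by (intro compact_imp_bounded compact_continuous_image clap compact_cball)
    then obtain M where "\<And>y. y \<in> (\<lambda>x. \<Sum>i\<in>UNIV. w'' i i x) ` cball 0 R0 \<Longrightarrow> norm y \<le> M"
      unfolding bounded_iff by blast
    then have "(\<Sum>i\<in>UNIV. w'' i i x) \<le> M" if "norm x \<le> R0" for x
      using that by (force intro: order_trans[OF abs_ge_self])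
    then show ?thesis using that by blast
  qed
  define K where "K = 4 * real m * real (m - 1)"
  have K: "K > 0" using m by (simp add: K_def)
  \<comment> \<open>the Laplacian of \<open>(1 + t)\<^bsup>1 - m\<^esup>\<close> is \<open>- K (1 + t)\<^bsup>- m - 1\<^esup>\<close>, largest on the ball at its boundary\<close>
  define lam where "lam = max 0 M * (1 + R0\<^sup>2) ^ Suc m / K"
  have lam: "lam \<ge> 0" using K by (simp add: lam_def)
  define W where "W x = w x + lam * B (x \<bullet> x)" for x
  define W' where "W' i x = w' i x + lam * (B1 (x \<bullet> x) * (2 * x $ i))" for i x
  define W'' where "W'' i j x = w'' i j x + lam * (B2 (x \<bullet> x) * (2 * x $ j) * (2 * x $ i) + B1 (x \<bullet> x) * (2 * (if i = j then 1 else 0)))" for i j x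
  have 1: "has_gradient W W'" unfolding W_def W'_def
    by (intro has_gradient_add has_gradient_cmult w gb)
  have 2: "has_gradient (W' i) (W'' i)" for i unfolding W'_def W''_def
    by (intro has_gradient_add has_gradient_cmult w gb2)
  have lap: "(\<Sum>i\<in>UNIV. W'' i i x) = (\<Sum>i\<in>UNIV. w'' i i x) - lam * (K / (1 + x \<bullet> x) ^ Suc m)" for x
  proof -
    have "(\<Sum>i\<in>UNIV. B2 (x \<bullet> x) * (2 * x $ i) * (2 * x $ i) + B1 (x \<bullet> x) * 2)
          = 4 * B2 (x \<bullet> x) * (\<Sum>i\<in>UNIV. x $ i * x $ i) + real CARD('n) * (B1 (x \<bullet> x) * 2)"
      by (simp add: sum.distrib sum_distrib_left mult_ac)
    also have "(\<Sum>i\<in>UNIV. x $ i * x $ i) = x \<bullet> x" by (simp add: inner_vec_def)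
    also have "4 * B2 (x \<bullet> x) * (x \<bullet> x) + real CARD('n) * (B1 (x \<bullet> x) * 2) = - (K / (1 + x \<bullet> x) ^ Suc m)"
    proof -
      have B1: "B1 t = - real (m - 1) * (1 + t) / (1 + t) ^ Suc m" if "t \<ge> 0" for t
        using that unfolding B1_def by simp
      have "B1 (x \<bullet> x) = - real (m - 1) * (1 + x \<bullet> x) / (1 + x \<bullet> x) ^ Suc m"
        by (rule B1[OF inner_ge_zero])
      then have "4 * B2 (x \<bullet> x) * (x \<bullet> x) + real CARD('n) * (B1 (x \<bullet> x) * 2) =
        (4 * (real (m - 1) * real m) * (x \<bullet> x) + real CARD('n) * (- real (m - 1) * (1 + x \<bullet> x) * 2)) / (1 + x \<bullet> x) ^ Suc m"
        unfolding B2_def by (simp only: add_divide_distrib times_divide_eq_left times_divide_eq_right)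
      also have "4 * (real (m - 1) * real m) * (x \<bullet> x) + real CARD('n) * (- real (m - 1) * (1 + x \<bullet> x) * 2) = - K"
        unfolding n K_def by (simp add: algebra_simps)
      finally show ?thesis by simp
    qed
    finally show ?thesis unfolding W''_def by (simp add: sum.distrib sum_distrib_left[symmetric])
  qed
  have 3: "(\<Sum>i\<in>UNIV. W'' i i x) \<le> 0" for x
  proof (cases "norm x \<le> R0")
    case False
    then show ?thesis unfolding lap using sup[of x] lam K
      by (smt (verit) divide_nonneg_nonneg inner_ge_zero mult_nonneg_nonneg zero_le_power)
  next
    case True
    have "0 < (1 + x \<bullet> x) ^ Suc m" using inner_ge_zero[of x] by (intro zero_less_power) linarith
    moreover have "(1 + x \<bullet> x) ^ Suc m \<le> (1 + R0\<^sup>2) ^ Suc m"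
      using True by (intro power_mono) (auto simp: dot_square_norm power_mono)
    ultimately have "max 0 M * 1 \<le> max 0 M * ((1 + R0\<^sup>2) ^ Suc m / (1 + x \<bullet> x) ^ Suc m)"
      by (intro mult_left_mono) (simp_all only: le_divide_eq_1_pos max.cobounded1)
    also have "\<dots> = lam * (K / (1 + x \<bullet> x) ^ Suc m)"
      unfolding lam_def using K by simp
    finally show ?thesis unfolding lap using M[OF True] by simp
  qed
  have 4: "w x \<le> W x" for x
    unfolding W_def B_def using lam inner_ge_zero[of x] by (simp add: add_nonneg_nonneg)
  have 5: "W x \<le> (1 + lam / c) * w x" for x
  proof -
    have "lam * B (x \<bullet> x) = (lam / c) * (c / (1 + x \<bullet> x) ^ (m - 1))" using c by (simp add: B_def)
    also have "\<dots> \<le> (lam / c) * w x" using lam c by (intro mult_left_mono) auto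
    finally show ?thesis unfolding W_def by (simp add: algebra_simps)
  qed
  have "1 + lam / c > 0" using lam c by (simp add: add_pos_nonneg)
  from that[OF 1 2 3 4 5 this] show ?thesis .
qed

lemma lborel_integral_affine:
  fixes g :: "'a::euclidean_space \<Rightarrow> real"
  assumes c: "c \<noteq> 0" and g: "g \<in> borel_measurable borel"
  shows "integral\<^sup>L lborel g = \<bar>c\<bar> ^ DIM('a) * (\<integral>z. g (a + c *\<^sub>R z) \<partial>lborel)"
proof -
  have "integral\<^sup>L lborel g = integral\<^sup>L (density (distr lborel borel (\<lambda>x. a + c *\<^sub>R x)) (\<lambda>_. ennreal (\<bar>c\<bar> ^ DIM('a)))) g"
    using lborel_affine[OF c, of a] by simp
  also have "\<dots> = (\<integral>x. \<bar>c\<bar> ^ DIM('a) *\<^sub>R g x \<partial>distr lborel borel (\<lambda>x. a + c *\<^sub>R x))"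
    by (rule integral_density) (use g in auto)
  also have "\<dots> = (\<integral>z. \<bar>c\<bar> ^ DIM('a) *\<^sub>R g (a + c *\<^sub>R z) \<partial>lborel)"
    by (rule integral_distr) (use g in auto)
  finally show ?thesis by simp
qed

lemma integrable_cball_continuous:
  fixes g :: "real^'n::finite \<Rightarrow> real"
  assumes "continuous_on UNIV g"
  shows "integrable lborel (\<lambda>z. indicator (cball 0 1) z * g z)"
  using borel_integrable_compact[OF compact_cball continuous_on_subset[OF assms subset_UNIV], of 0 1] by simp

text \<open>The weighted mean is nonincreasing in \<open>R\<close>: by Green's identity its derivative is \<open>R\<close> times an
  integral of the Laplacian of \<open>W\<close> against a nonnegative weight.\<close>

lemma superharmonic_mean_decreasing:
  fixes W :: "real^'n::finite \<Rightarrow> real"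
  assumes W: "has_gradient W W'" "\<And>i. has_gradient (W' i) (W'' i)"
    and sup: "\<And>x. (\<Sum>i\<in>UNIV. W'' i i x) \<le> 0" and R: "0 \<le> R"
  shows "(\<integral>z. W (x + R *\<^sub>R z) * radial_cutoff ([:1, - 1:] ^ 2) z \<partial>lborel)
    \<le> W x * integral\<^sup>L lborel (radial_cutoff ([:1, - 1:] ^ 2) :: real^'n \<Rightarrow> real)"
proof -
  \<comment> \<open>normalized so that the weight \<open>2 P'\<close> is minus the weight of the mean\<close>
  define P :: "real poly" where "P = smult (1/6) ([:1, - 1:] ^ 3)"
  have dP: "smult 2 (pderiv P) = smult (- 1) ([:1, - 1:] ^ 2)"
    unfolding P_def by (simp add: pderiv_smult pderiv_power pderiv_pCons)
  have P0: "poly P t \<ge> 0" if "t \<le> 1" for t using that by (simp add: P_def poly_power)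
  have "[:1, - 1::real:] ^ 3 dvd P" unfolding P_def by (rule dvd_smult) simp
  note v = dvd_vanishes[OF this]
  let ?rho = "radial_cutoff (smult 2 (pderiv P)) :: real^'n \<Rightarrow> real"
  let ?T = "\<lambda>R. \<integral>z. W (x + R *\<^sub>R z) * ?rho z \<partial>lborel"
  let ?T' = "\<lambda>R. \<integral>z. (\<Sum>i\<in>UNIV. z $ i * W' i (x + R *\<^sub>R z)) * ?rho z \<partial>lborel"
  have crho: "continuous_on UNIV ?rho" by (rule radial_cutoff_continuous) (simp add: v)
  have D: "(?T has_real_derivative ?T' R) (at R)" for R
    by (rule dilation_integral_DERIV[OF W(1) crho radial_cutoff_zero])
  have "?T' R \<ge> 0" if "R \<ge> 0" for R
  proof -
    have "has_gradient (\<lambda>z. W' i (x + R *\<^sub>R z)) (\<lambda>j z. R * W'' i j (x + R *\<^sub>R z))" for i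
      by (rule has_gradient_dilate[OF W(2)])
    from radial_green_first[OF this v(1,2)]
    have "?T' R = - (\<integral>z. (\<Sum>i\<in>UNIV. R * W'' i i (x + R *\<^sub>R z)) * radial_cutoff P z \<partial>lborel)" .
    also have "\<dots> = (\<integral>z. - ((\<Sum>i\<in>UNIV. R * W'' i i (x + R *\<^sub>R z)) * radial_cutoff P z) \<partial>lborel)" by simp
    also have "\<dots> \<ge> 0"
    proof (rule Bochner_Integration.integral_nonneg)
      fix z :: "real^'n"
      have "(\<Sum>i\<in>UNIV. R * W'' i i (x + R *\<^sub>R z)) \<le> 0"
        unfolding sum_distrib_left[symmetric] by (rule mult_nonneg_nonpos[OF that sup])
      moreover have "radial_cutoff P z \<ge> 0" using P0 by (simp add: radial_cutoff_def)
      ultimately show "0 \<le> - ((\<Sum>i\<in>UNIV. R * W'' i i (x + R *\<^sub>R z)) * radial_cutoff P z)"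
        by (simp add: mult_nonpos_nonneg)
    qed
    finally show ?thesis .
  qed
  then have "?T 0 \<le> ?T R"
    using DERIV_nonneg_imp_nondecreasing[OF R, of ?T] D by blast
  moreover have "?rho z = - radial_cutoff ([:1, - 1:] ^ 2) z" for z
    unfolding dP by (simp add: radial_cutoff_def)
  ultimately show ?thesis by simp
qed

text \<open>For \<open>\<bar>x\<bar> \<le> R\<close> the ball of radius \<open>R\<close> around the origin lies in the ball of radius \<open>2R\<close> around
  \<open>x\<close>, where the weight of the mean over radius \<open>4R\<close> is bounded below.\<close>

lemma superharmonic_weak_harnack:
  fixes W :: "real^'n::finite \<Rightarrow> real"
  assumes W: "has_gradient W W'" "\<And>i. has_gradient (W' i) (W'' i)"
    and sup: "\<And>x. (\<Sum>i\<in>UNIV. W'' i i x) \<le> 0" and pos: "\<And>x. 0 \<le> W x"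
  obtains c where "c > 0"
    "\<And>R x. 0 < R \<Longrightarrow> norm x \<le> R \<Longrightarrow> c * (\<integral>z. indicator (cball 0 1) z * W (R *\<^sub>R z) \<partial>lborel) \<le> W x"
proof -
  let ?Phi = "radial_cutoff ([:1, - 1:] ^ 2) :: real^'n \<Rightarrow> real"
  define A where "A = integral\<^sup>L lborel ?Phi"
  define k where "k = (1/4::real) ^ DIM(real^'n) / 2"
  have k: "k > 0" by (simp add: k_def)
  have Phi0: "?Phi z \<ge> 0" for z by (simp add: radial_cutoff_def poly_power)
  have A: "A \<ge> 0" unfolding A_def by (rule Bochner_Integration.integral_nonneg) (rule Phi0)
  have cPhi: "continuous_on UNIV ?Phi" by (rule radial_cutoff_continuous) (simp add: poly_power)
  have cW: "continuous_on UNIV W" by (rule has_gradient_continuous[OF W(1)])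
  have main: "k * (\<integral>z. indicator (cball 0 1) z * W (R *\<^sub>R z) \<partial>lborel) \<le> W x * A"
    if R: "0 < R" and x: "norm x \<le> R" for R and x :: "real^'n"
  proof -
    \<comment> \<open>the substitution \<open>z \<mapsto> a + z / 4\<close> turns \<open>x + 4 R z\<close> into \<open>R z\<close>\<close>
    define a where "a = (- (1 / (4 * R))) *\<^sub>R x"
    have arg: "x + (4 * R) *\<^sub>R (a + (1/4) *\<^sub>R z) = R *\<^sub>R z" for z
      using R by (simp add: a_def algebra_simps)
    have na: "norm a \<le> 1/4" using R x by (simp add: a_def field_simps)
    have cWR: "continuous_on UNIV (\<lambda>z. W (R *\<^sub>R z))" for R
      by (intro continuous_on_compose2[OF cW] continuous_intros) auto
    have cg: "continuous_on UNIV (\<lambda>z. W (x + (4 * R) *\<^sub>R z) * ?Phi z)"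
      by (intro continuous_on_mult[OF _ cPhi] continuous_on_compose2[OF cW] continuous_intros) auto
    have cg': "continuous_on UNIV (\<lambda>z. W (R *\<^sub>R z) * ?Phi (a + (1/4) *\<^sub>R z))"
      by (intro continuous_on_mult[OF cWR] continuous_on_compose2[OF cPhi] continuous_intros) auto
    have i2: "integrable lborel (\<lambda>z. W (R *\<^sub>R z) * ?Phi (a + (1/4) *\<^sub>R z))"
    proof (rule compact_support_integral(1)[OF cg', of 5])
      fix z :: "real^'n" assume "norm z > 5"
      have "norm ((1/4) *\<^sub>R z) \<le> norm (a + (1/4) *\<^sub>R z) + norm a"
        by (metis add.commute add_diff_cancel_left' norm_triangle_ineq4)
      then have "norm (a + (1/4) *\<^sub>R z) > 1" using na \<open>norm z > 5\<close> by simp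
      then show "W (R *\<^sub>R z) * ?Phi (a + (1/4) *\<^sub>R z) = 0" by (simp add: radial_cutoff_zero)
    qed
    have "(1/2) * (\<integral>z. indicator (cball 0 1) z * W (R *\<^sub>R z) \<partial>lborel)
        = (\<integral>z. (1/2) * (indicator (cball 0 1) z * W (R *\<^sub>R z)) \<partial>lborel)" by simp
    also have "\<dots> \<le> (\<integral>z. W (R *\<^sub>R z) * ?Phi (a + (1/4) *\<^sub>R z) \<partial>lborel)"
    proof (rule integral_mono)
      show "integrable lborel (\<lambda>z. (1/2) * (indicator (cball 0 1) z * W (R *\<^sub>R z)))"
        by (intro integrable_mult_right integrable_cball_continuous cWR)
      fix z :: "real^'n"
      show "(1/2) * (indicator (cball 0 1) z * W (R *\<^sub>R z)) \<le> W (R *\<^sub>R z) * ?Phi (a + (1/4) *\<^sub>R z)"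
      proof (cases "norm z \<le> 1")
        case True
        let ?y = "a + (1/4) *\<^sub>R z"
        have "norm ?y \<le> norm a + norm ((1/4) *\<^sub>R z)" by (rule norm_triangle_ineq)
        also have "\<dots> \<le> 1/2" using na True by simp
        finally have "?y \<bullet> ?y \<le> (1/2)\<^sup>2" unfolding dot_square_norm by (intro power_mono) auto
        then have y: "?y \<bullet> ?y \<le> 1/4" by (simp add: power2_eq_square)
        then have "(3/4)\<^sup>2 \<le> (1 - ?y \<bullet> ?y)\<^sup>2" by (intro power_mono) auto
        moreover have "?Phi ?y = (1 - ?y \<bullet> ?y)\<^sup>2" using y unfolding radial_cutoff_def
          by (simp add: poly_power del: power2_eq_square)
        ultimately have "1/2 \<le> ?Phi ?y" by (simp add: power2_eq_square[of "3/4"])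
        then have "W (R *\<^sub>R z) * (1/2) \<le> W (R *\<^sub>R z) * ?Phi ?y" by (intro mult_left_mono pos)
        then show ?thesis using True by simp
      qed (use pos Phi0 in simp)
    qed (rule i2)
    also have "(\<integral>z. W (R *\<^sub>R z) * ?Phi (a + (1/4) *\<^sub>R z) \<partial>lborel) =
      (\<integral>z. W (x + (4 * R) *\<^sub>R (a + (1/4) *\<^sub>R z)) * ?Phi (a + (1/4) *\<^sub>R z) \<partial>lborel)"
      unfolding arg ..
    finally have "(1/4) ^ DIM(real^'n) * ((1/2) * (\<integral>z. indicator (cball 0 1) z * W (R *\<^sub>R z) \<partial>lborel))
      \<le> (1/4) ^ DIM(real^'n) * (\<integral>z. W (x + (4 * R) *\<^sub>R (a + (1/4) *\<^sub>R z)) * ?Phi (a + (1/4) *\<^sub>R z) \<partial>lborel)"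
      by (intro mult_left_mono) auto
    also have "\<dots> = (\<integral>z. W (x + (4 * R) *\<^sub>R z) * ?Phi z \<partial>lborel)"
      using lborel_integral_affine[of "1/4" "\<lambda>z. W (x + (4 * R) *\<^sub>R z) * ?Phi z" a] borel_measurable_continuous_onI[OF cg]
      by simp
    also have "\<dots> \<le> W x * A"
      unfolding A_def using superharmonic_mean_decreasing[OF W sup, of "4 * R" x] R by simp
    finally show ?thesis unfolding k_def by (simp add: mult_ac)
  qed
  show ?thesis
  proof (rule that[of "k / (A + 1)"])
    show "k / (A + 1) > 0" using k A by simp
    fix R and x :: "real^'n" assume "0 < R" "norm x \<le> R"
    from main[OF this] have "k * (\<integral>z. indicator (cball 0 1) z * W (R *\<^sub>R z) \<partial>lborel) \<le> W x * (A + 1)"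
      using pos[of x] by (simp add: algebra_simps)
    then show "k / (A + 1) * (\<integral>z. indicator (cball 0 1) z * W (R *\<^sub>R z) \<partial>lborel) \<le> W x"
      using A by (simp add: field_simps)
  qed
qed

text \<open>Here \<open>e\<^bsup>(m - 1) l(R)\<^esup>\<close> is a small multiple of the mean of \<open>e\<^bsup>(m - 1) u\<^esup>\<close> over the ball of radius
  \<open>R\<close>.  By the weak Harnack inequality this is a lower bound for \<open>e\<^bsup>(m - 1) u\<^esup>\<close> on that ball,
  in particular at the origin, which bounds \<open>l\<close> from above.\<close>

lemma log_superharmonic_scale_bound:
  fixes u :: "real^'n::finite \<Rightarrow> real"
  assumes n: "CARD('n) = 2 * m" and m: "2 \<le> m" and u: "smooth u"
    and sup: "\<And>x. norm x > R0 \<Longrightarrow>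
      laplacian u x + (real m - 1) * (\<Sum>i\<in>UNIV. (partial_deriv i u x)\<^sup>2) \<le> 0"
  obtains C l where "\<And>R. 0 < R \<Longrightarrow> l R \<le> C"
    "\<And>R z. 0 < R \<Longrightarrow> norm z \<le> 1 \<Longrightarrow> l R \<le> u (R *\<^sub>R z)"
    "\<And>R. 0 < R \<Longrightarrow> (\<integral>z. indicator (cball 0 1) z * exp ((real m - 1) * (u (R *\<^sub>R z) - l R)) \<partial>lborel) \<le> C"
proof -
  define q where "q = real m - 1"
  have q: "q > 0" using m by (simp add: q_def)
  define w where "w x = exp (q * u x)" for x
  let ?u = "\<lambda>i. partial_deriv i u"
  have gu: "has_gradient u ?u" and gu': "has_gradient (?u i) (\<lambda>j. partial_deriv j (?u i))" for i
    using smooth_has_gradient[OF u] smooth_has_gradient[OF smooth_partial_deriv[OF u]] by auto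
  have cu: "continuous_on UNIV u" by (rule has_gradient_continuous[OF gu])
  have gw: "has_gradient w (\<lambda>i x. q * w x * ?u i x)"
    unfolding w_def
    by (rule has_gradient_comp[OF gu, where h' = "\<lambda>t. q * exp (q * t)"])
      (auto intro!: derivative_eq_intros continuous_intros cu)
  note gw2 = has_gradient_mult[OF has_gradient_cmult[OF gw] gu']
  have wpos: "w x > 0" for x by (simp add: w_def)
  have wsup: "(\<Sum>i\<in>UNIV. q * (q * w x * ?u i x) * ?u i x + q * w x * partial_deriv i (?u i) x) \<le> 0"
    if "norm x > R0" for x
  proof -
    have "(\<Sum>i\<in>UNIV. q * (q * w x * ?u i x) * ?u i x + q * w x * partial_deriv i (?u i) x)
      = (q * w x) * (laplacian u x + q * (\<Sum>i\<in>UNIV. (?u i x)\<^sup>2))"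
      unfolding laplacian_def by (simp add: sum.distrib sum_distrib_left algebra_simps power2_eq_square)
    also have "\<dots> \<le> 0"
      by (rule mult_nonneg_nonpos) (use q wpos[of x] sup[OF that] in \<open>simp_all add: q_def\<close>)
    finally show ?thesis .
  qed
  obtain W W' W'' C0 where W: "has_gradient W W'" "\<And>i. has_gradient (W' i) (W'' i)"
    "\<And>x. (\<Sum>i\<in>UNIV. W'' i i x) \<le> 0" "\<And>x. w x \<le> W x" "\<And>x. W x \<le> C0 * w x" "C0 > 0"
    by (rule superharmonic_majorant[OF n m gw gw2 wpos wsup]) auto
  have Wpos: "W x > 0" for x using wpos[of x] W(4)[of x] by linarith
  obtain c where c: "c > 0"
    "\<And>R x. 0 < R \<Longrightarrow> norm x \<le> R \<Longrightarrow> c * (\<integral>z. indicator (cball 0 1) z * W (R *\<^sub>R z) \<partial>lborel) \<le> W x"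
    by (rule superharmonic_weak_harnack[OF W(1-3) less_imp_le[OF Wpos]]) auto
  define M where "M R = (\<integral>z. indicator (cball 0 1) z * W (R *\<^sub>R z) \<partial>lborel)" for R
  define N where "N R = (\<integral>z. indicator (cball 0 1) z * w (R *\<^sub>R z) \<partial>lborel)" for R
  have cW: "continuous_on UNIV (\<lambda>z. W (R *\<^sub>R z))" for R
    by (intro continuous_on_compose2[OF has_gradient_continuous[OF W(1), of UNIV]] continuous_intros) auto
  have cw: "continuous_on UNIV (\<lambda>z. w (R *\<^sub>R z))" for R
    by (intro continuous_on_compose2[OF has_gradient_continuous[OF gw, of UNIV]] continuous_intros) auto
  have NM: "N R \<le> M R" for R
    unfolding N_def M_def
    by (intro integral_mono integrable_cball_continuous cw cW mult_left_mono W(4)) auto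
  have Npos: "N R > 0" for R
  proof -
    obtain z0 :: "real^'n" where z0: "\<And>z. z \<in> cball 0 1 \<Longrightarrow> w (R *\<^sub>R z0) \<le> w (R *\<^sub>R z)"
      using continuous_attains_inf[OF compact_cball[of 0 1] _ continuous_on_subset[OF cw[of R] subset_UNIV]]
      by (metis cball_eq_empty not_one_less_zero)
    have "0 < w (R *\<^sub>R z0) * measure lborel (cball (0::real^'n) 1)"
      by (intro mult_pos_pos wpos content_cball_pos) simp
    also have "\<dots> = (\<integral>z. indicator (cball (0::real^'n) 1) z * w (R *\<^sub>R z0) \<partial>lborel)"
      by simp
    also have "\<dots> \<le> N R" unfolding N_def
      by (intro integral_mono integrable_cball_continuous cw) (auto simp: indicator_def intro: z0)
    finally show ?thesis .
  qed
  have Mpos: "M R > 0" for R using NM[of R] Npos[of R] by linarith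
  define l where "l R = ln (c * M R / C0) / q" for R
  have el: "exp (q * l R) = c * M R / C0" for R
    unfolding l_def using q c Mpos[of R] W(6) by simp
  have lu: "l R \<le> u (R *\<^sub>R z)" if "0 < R" "norm z \<le> 1" for R z
  proof -
    have "c * M R \<le> W (R *\<^sub>R z)" unfolding M_def
      using that by (intro c(2)) (auto simp: mult_left_le)
    also have "\<dots> \<le> C0 * w (R *\<^sub>R z)" by (rule W(5))
    finally have "exp (q * l R) \<le> exp (q * u (R *\<^sub>R z))"
      unfolding el w_def using W(6) by (simp add: field_simps)
    then show ?thesis using q by simp
  qed
  have lC: "l R \<le> u 0" if "0 < R" for R using lu[OF that, of 0] by simp
  have int: "(\<integral>z. indicator (cball 0 1) z * exp (q * (u (R *\<^sub>R z) - l R)) \<partial>lborel) \<le> C0 / c" for R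
  proof -
    have "(\<integral>z. indicator (cball 0 1) z * exp (q * (u (R *\<^sub>R z) - l R)) \<partial>lborel)
      = (\<integral>z. (1 / exp (q * l R)) * (indicator (cball 0 1) z * w (R *\<^sub>R z)) \<partial>lborel)"
      by (rule Bochner_Integration.integral_cong) (simp_all add: w_def right_diff_distrib exp_diff)
    also have "\<dots> = N R / exp (q * l R)" unfolding N_def by simp
    also have "\<dots> \<le> M R / exp (q * l R)" using NM by (intro divide_right_mono) auto
    also have "\<dots> = C0 / c" unfolding el using Mpos[of R] c W(6) by simp
    finally show ?thesis .
  qed
  show ?thesis
  proof (rule that[where l = l and C = "max (C0 / c) (\<bar>u 0\<bar>)"])
    show "l R \<le> max (C0 / c) \<bar>u 0\<bar>" if "0 < R" for R using lC[OF that] by linarith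
    show "(\<integral>z. indicator (cball 0 1) z * exp ((real m - 1) * (u (R *\<^sub>R z) - l R)) \<partial>lborel) \<le> max (C0 / c) \<bar>u 0\<bar>" for R
      using int[of R] unfolding q_def by linarith
  qed (rule lu)
qed

section \<open>Scalar curvature of a conformally flat metric\<close>

lemma matrix_inv_conformal_metric:
  "matrix_inv (conformal_metric u x :: real^'n::finite^'n) = exp (- 2 * u x) *\<^sub>R mat 1"
proof -
  let ?A = "conformal_metric u x :: real^'n^'n" and ?B = "exp (- 2 * u x) *\<^sub>R mat 1 :: real^'n^'n"
  have e: "exp (2 * u x) * exp (- (2 * u x)) = 1" by (simp flip: exp_add)
  have 1: "?A ** ?B = mat 1" "?B ** ?A = mat 1"
    using e by (simp_all add: conformal_metric_def scalar_matrix_assoc[symmetric] matrix_scalar_ac mult.commute)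
  then have "\<exists>A'. ?A ** A' = mat 1 \<and> A' ** ?A = mat 1" by blast
  then have "?A ** matrix_inv ?A = mat 1" unfolding matrix_inv_def by (rule someI2_ex) blast
  then show ?thesis using 1(2) by (metis matrix_mul_assoc matrix_mul_lid matrix_mul_rid)
qed

lemma christoffel_conformal_metric:
  fixes u :: "real^'n::finite \<Rightarrow> real"
  assumes u: "smooth u"
  shows "christoffel (conformal_metric u) k i j = (\<lambda>x.
    (if j = k then partial_deriv i u x else 0) + (if i = k then partial_deriv j u x else 0)
      - (if i = j then partial_deriv k u x else 0))"
proof
  fix x
  have g: "has_gradient (\<lambda>y. (if j = l then 1 else 0) * exp (2 * u y))
      (\<lambda>i y. (if j = l then 1 else 0) * (2 * exp (2 * u y) * partial_deriv i u y))" for j l :: 'n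
    by (intro has_gradient_cmult has_gradient_comp[OF smooth_has_gradient[OF u], where h' = "\<lambda>t. 2 * exp (2 * t)"])
      (auto intro!: derivative_eq_intros continuous_intros has_gradient_continuous[OF smooth_has_gradient[OF u]])
  have "(\<lambda>y. conformal_metric u y $ j $ l) = (\<lambda>y. (if j = l then 1 else 0) * exp (2 * u y))" for j l
    by (auto simp: conformal_metric_def mat_def)
  then have p: "partial_deriv i (\<lambda>y. conformal_metric u y $ j $ l) x
      = (if j = l then 2 * exp (2 * u x) * partial_deriv i u x else 0)" for i j l
    using has_gradient_partial_deriv[OF g] by simp
  have e: "exp (- (2 * u x)) * exp (2 * u x) = 1" by (simp flip: exp_add)
  have "christoffel (conformal_metric u) k i j x = 1/2 * (\<Sum>l\<in>UNIV. (if k = l then exp (- (2 * u x)) *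
      ((if j = l then 2 * exp (2 * u x) * partial_deriv i u x else 0) +
       (if i = l then 2 * exp (2 * u x) * partial_deriv j u x else 0) -
       (if i = j then 2 * exp (2 * u x) * partial_deriv l u x else 0)) else 0))"
    unfolding christoffel_def p matrix_inv_conformal_metric
    by (intro arg_cong[where f = "\<lambda>s. 1/2 * s"] sum.cong) (auto simp: mat_def)
  also have "\<dots> = (exp (- (2 * u x)) * exp (2 * u x)) * ((if j = k then partial_deriv i u x else 0) + (if i = k then partial_deriv j u x else 0)
      - (if i = j then partial_deriv k u x else 0))"
    by (simp add: algebra_simps)
  finally show "christoffel (conformal_metric u) k i j x = (if j = k then partial_deriv i u x else 0)
      + (if i = k then partial_deriv j u x else 0) - (if i = j then partial_deriv k u x else 0)"
    unfolding e by simp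
qed

text \<open>The classical formula
  \<open>R = - e\<^bsup>- 2u\<^esup> (2 (n - 1) \<Delta>u + (n - 1) (n - 2) \<bar>\<nabla>u\<bar>\<^sup>2)\<close>.  Only the diagonal of the Ricci tensor
  is traced, so no mixed second derivatives have to be exchanged.\<close>

lemma scalar_curvature_conformal_metric:
  fixes u :: "real^'n::finite \<Rightarrow> real"
  assumes u: "smooth u"
  shows "scalar_curvature (conformal_metric u) x = - exp (- 2 * u x) *
    (2 * (real CARD('n) - 1) * laplacian u x
      + (real CARD('n) - 1) * (real CARD('n) - 2) * (\<Sum>i\<in>UNIV. (partial_deriv i u x)\<^sup>2))"
proof -
  let ?n = "real CARD('n)" and ?v = "\<lambda>i. partial_deriv i u x"
  let ?h = "\<lambda>i j. partial_deriv j (partial_deriv i u) x"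
  define G where "G = (\<Sum>i\<in>UNIV. (?v i)\<^sup>2)"
  define L where "L = laplacian u x"
  have gu: "has_gradient (partial_deriv i u) (\<lambda>j. partial_deriv j (partial_deriv i u))" for i
    by (rule smooth_has_gradient[OF smooth_partial_deriv[OF u]])
  have HG: "has_gradient (\<lambda>x. (if j = k then 1 else 0) * partial_deriv i u x + (if i = k then 1 else 0) * partial_deriv j u x
      + (if i = j then -1 else 0) * partial_deriv k u x)
     (\<lambda>l x. (if j = k then 1 else 0) * partial_deriv l (partial_deriv i u) x + (if i = k then 1 else 0) * partial_deriv l (partial_deriv j u) x
      + (if i = j then -1 else 0) * partial_deriv l (partial_deriv k u) x)" for i j k
    by (intro has_gradient_add has_gradient_cmult gu)
  have eq: "(\<lambda>x. (if j = k then 1 else 0) * partial_deriv i u x + (if i = k then 1 else 0) * partial_deriv j u x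
      + (if i = j then -1 else 0) * partial_deriv k u x) = christoffel (conformal_metric u) k i j" for i j k
    unfolding christoffel_conformal_metric[OF u] by auto
  have dc: "partial_deriv l (christoffel (conformal_metric u) k i j) x =
      (if j = k then ?h i l else 0) + (if i = k then ?h j l else 0) - (if i = j then ?h k l else 0)" for i j k l
    by (simp add: has_gradient_partial_deriv[OF HG, of l, unfolded eq])
  have first: "(\<Sum>k\<in>UNIV. partial_deriv k (christoffel (conformal_metric u) k i i) x
      - partial_deriv i (christoffel (conformal_metric u) k i k) x) = 2 * ?h i i - L - ?n * ?h i i" for i
    unfolding dc L_def laplacian_def by (simp add: sum.distrib sum_subtractf sum_distrib_left[symmetric])
  have q1: "(\<Sum>k\<in>UNIV. \<Sum>l\<in>UNIV. christoffel (conformal_metric u) k k l x * christoffel (conformal_metric u) l i i x)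
      = ?n * (2 * (?v i)\<^sup>2 - G)" for i
  proof -
    have "christoffel (conformal_metric u) k k l x * christoffel (conformal_metric u) l i i x
        = (if i = l then 2 * (?v i)\<^sup>2 else 0) - (?v l)\<^sup>2" for k l
      unfolding christoffel_conformal_metric[OF u] by (auto simp: algebra_simps power2_eq_square)
    then show ?thesis by (simp add: sum_subtractf G_def)
  qed
  have q2: "(\<Sum>k\<in>UNIV. \<Sum>l\<in>UNIV. christoffel (conformal_metric u) k i l x * christoffel (conformal_metric u) l i k x)
      = ?n * (?v i)\<^sup>2 - 2 * G + 2 * (?v i)\<^sup>2" for i
  proof -
    have "christoffel (conformal_metric u) k i l x * christoffel (conformal_metric u) l i k x
        = (if k = l then (?v i)\<^sup>2 else 0) - (if i = k then (?v l)\<^sup>2 else 0) - (if i = l then (?v k)\<^sup>2 else 0)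
          + (if i = k then if i = l then 2 * (?v i)\<^sup>2 else 0 else 0)" for k l
      unfolding christoffel_conformal_metric[OF u] by (auto simp: algebra_simps power2_eq_square)
    moreover have "(\<Sum>k\<in>UNIV. \<Sum>l\<in>UNIV. (if i = k then (?v l)\<^sup>2 else 0)) = G"
    proof -
      have "(\<Sum>l\<in>UNIV. (if i = k then (?v l)\<^sup>2 else 0)) = (if i = k then G else 0)" for k
        by (simp add: G_def)
      then show ?thesis by simp
    qed
    moreover have "(\<Sum>k\<in>UNIV. \<Sum>l\<in>UNIV. (if i = k then if i = l then 2 * (?v i)\<^sup>2 else 0 else 0)) = 2 * (?v i)\<^sup>2"
    proof -
      have "(\<Sum>l\<in>UNIV. (if i = k then if i = l then 2 * (?v i)\<^sup>2 else 0 else 0)) = (if i = k then 2 * (?v i)\<^sup>2 else 0)" for k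
        by simp
      then show ?thesis by simp
    qed
    ultimately show ?thesis by (simp add: sum_subtractf sum.distrib G_def)
  qed
  have "scalar_curvature (conformal_metric u) x = (\<Sum>i\<in>UNIV. \<Sum>j\<in>UNIV. (if i = j then exp (- 2 * u x) * ricci (conformal_metric u) i j x else 0))"
    unfolding scalar_curvature_def matrix_inv_conformal_metric
    by (intro sum.cong) (auto simp: mat_def)
  also have "\<dots> = exp (- 2 * u x) * (\<Sum>i\<in>UNIV. ricci (conformal_metric u) i i x)"
    by (simp add: sum_distrib_left)
  also have "(\<Sum>i\<in>UNIV. ricci (conformal_metric u) i i x)
      = (\<Sum>i\<in>UNIV. (2 * ?h i i - L - ?n * ?h i i) + (?n * (2 * (?v i)\<^sup>2 - G) - (?n * (?v i)\<^sup>2 - 2 * G + 2 * (?v i)\<^sup>2)))"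
    unfolding ricci_def sum_subtractf[where f = "\<lambda>l. _ * _"] first[unfolded sum_subtractf] q1 q2 sum_subtractf ..
  also have "\<dots> = (2 * L - ?n * L - ?n * L) + (?n * (2 * G - ?n * G) - (?n * G - 2 * ?n * G + 2 * G))"
    unfolding L_def laplacian_def G_def
    by (simp add: sum.distrib sum_subtractf sum_distrib_left[symmetric] right_diff_distrib)
  finally show ?thesis unfolding L_def G_def by (simp add: algebra_simps)
qed

section \<open>Lengths and distances of a conformally flat metric\<close>

text \<open>A piecewise continuously differentiable curve with its velocity.  The velocity may be prescribed,
  so that the length of reversed and concatenated curves can be computed with a convenient one.\<close>

definition speed_data :: "real set \<Rightarrow> (real \<Rightarrow> 'a::real_normed_vector) \<Rightarrow> (real \<Rightarrow> 'a) \<Rightarrow> bool"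
  where "speed_data S D \<gamma> \<longleftrightarrow> finite S \<and> continuous_on {0..1} \<gamma> \<and> continuous_on ({0<..<1} - S) D \<and>
    (\<forall>t\<in>{0<..<1} - S. (\<gamma> has_vector_derivative D t) (at t))"

lemma valid_path_speed_data:
  assumes "valid_path \<gamma>" obtains S where "speed_data S (\<lambda>t. vector_derivative \<gamma> (at t)) \<gamma>"
proof -
  obtain S where "finite S" "continuous_on {0..1} \<gamma>" "\<gamma> C1_differentiable_on ({0..1} - S)"
    using assms unfolding valid_path_def piecewise_C1_differentiable_on_def by blast
  then have "speed_data S (\<lambda>t. vector_derivative \<gamma> (at t)) \<gamma>"
    unfolding speed_data_def C1_differentiable_on_eq vector_derivative_works[symmetric]
    by (auto intro: continuous_on_subset)
  then show ?thesis by (rule that)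
qed

text \<open>The integrand of the length, cut off to a Borel set on which it is continuous; unlike the integrand
  in \<^const>\<open>riem_length\<close> it is visibly measurable, as changes of variables require.\<close>

definition conformal_speed :: "(real^'n::finite \<Rightarrow> real) \<Rightarrow> real set \<Rightarrow> (real \<Rightarrow> real^'n) \<Rightarrow> (real \<Rightarrow> real^'n) \<Rightarrow> real \<Rightarrow> ennreal"
  where "conformal_speed u S D \<gamma> t = ennreal (indicator ({0<..<1} - S) t * (exp (u (\<gamma> t)) * norm (D t)))"

lemma riem_length_conformal_metric:
  fixes u :: "real^'n::finite \<Rightarrow> real"
  assumes "speed_data S D \<gamma>"
  shows "riem_length (conformal_metric u) \<gamma> = (\<integral>\<^sup>+ t. conformal_speed u S D \<gamma> t \<partial>lborel)"
proof -
  have sq: "sqrt (v \<bullet> (conformal_metric u x *v v)) = exp (u x) * norm v" for x v :: "real^'n"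
  proof -
    have "v \<bullet> (conformal_metric u x *v v) = (exp (u x) * norm v)\<^sup>2"
      by (simp add: conformal_metric_def scaleR_matrix_vector_assoc[symmetric] power_mult_distrib
          dot_square_norm exp_double)
    then show ?thesis by simp
  qed
  have vd: "vector_derivative \<gamma> (at t) = D t" if "t \<in> {0<..<1} - S" for t
    using assms that unfolding speed_data_def by (intro vector_derivative_at) blast
  have "finite (S \<union> {0, 1})" using assms by (simp add: speed_data_def)
  then have "AE t in lborel. t \<notin> S \<union> {0, 1}"
    by (intro AE_not_in finite_imp_null_set_lborel)
  then have "AE t in lborel. ennreal (exp (u (\<gamma> t)) * norm (vector_derivative \<gamma> (at t))) * indicator {0..1} t
      = conformal_speed u S D \<gamma> t"
    by (rule eventually_mono) (auto simp: conformal_speed_def vd indicator_def)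
  then show ?thesis
    unfolding riem_length_def sq by (rule nn_integral_cong_AE)
qed

lemma conformal_speed_measurable:
  assumes "speed_data S D \<gamma>" and u: "continuous_on UNIV u"
  shows "conformal_speed u S D \<gamma> \<in> borel_measurable borel"
proof -
  have S: "{0<..<1} - S \<in> sets borel" using assms(1) by (simp add: speed_data_def finite_imp_closed sets.Diff)
  have "continuous_on ({0<..<1} - S) (\<lambda>t. exp (u (\<gamma> t)) * norm (D t))"
    using assms(1) unfolding speed_data_def
    by (intro continuous_intros continuous_on_compose2[OF u]) (auto intro: continuous_on_subset)
  from borel_measurable_continuous_on_indicator[OF S this]
  show ?thesis unfolding conformal_speed_def by simp
qed

lemma riem_length_reversepath:
  assumes u: "continuous_on UNIV u" and g: "valid_path \<gamma>"
  shows "riem_length (conformal_metric u) (reversepath \<gamma>) = riem_length (conformal_metric u) \<gamma>"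
proof -
  obtain S where S: "speed_data S (\<lambda>t. vector_derivative \<gamma> (at t)) \<gamma>" (is "speed_data S ?D \<gamma>")
    using valid_path_speed_data[OF g] .
  let ?S' = "(\<lambda>t. 1 - t) ` S"
  have mem: "t \<in> {0<..<1} - ?S' \<longleftrightarrow> 1 - t \<in> {0<..<1} - S" for t
    by (auto simp: image_iff)
  have "speed_data ?S' (\<lambda>t. - ?D (1 - t)) (reversepath \<gamma>)"
    unfolding speed_data_def
  proof (intro conjI ballI)
    show "finite ?S'" using S by (simp add: speed_data_def)
    show "continuous_on {0..1} (reversepath \<gamma>)"
      using S unfolding speed_data_def reversepath_def
      by (auto intro!: continuous_on_compose2[of "{0..1}" \<gamma>] continuous_intros)
    show "continuous_on ({0<..<1} - ?S') (\<lambda>t. - ?D (1 - t))"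
    proof (rule continuous_on_minus, rule continuous_on_compose2[of "{0<..<1} - S" ?D])
      show "continuous_on ({0<..<1} - S) ?D" using S by (simp add: speed_data_def)
      show "(\<lambda>t. 1 - t) ` ({0<..<1} - ?S') \<subseteq> {0<..<1} - S" using mem by blast
    qed (intro continuous_intros)
    fix t assume "t \<in> {0<..<1} - ?S'"
    then have "(\<gamma> has_vector_derivative ?D (1 - t)) (at (1 - t))"
      using S mem unfolding speed_data_def by blast
    moreover have "((\<lambda>t. 1 - t) has_real_derivative - 1) (at t)"
      by (auto intro!: derivative_eq_intros)
    ultimately show "(reversepath \<gamma> has_vector_derivative - ?D (1 - t)) (at t)"
      using vector_diff_chain_at[of "\<lambda>t. 1 - t" "- 1" t \<gamma>]
      by (simp add: reversepath_def[abs_def] o_def has_real_derivative_iff_has_vector_derivative)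
  qed
  note r = riem_length_conformal_metric[OF this]
  have "(\<integral>\<^sup>+ t. conformal_speed u S ?D \<gamma> t \<partial>lborel) = ennreal \<bar>- 1\<bar> * (\<integral>\<^sup>+ t. conformal_speed u S ?D \<gamma> (1 + (- 1) * t) \<partial>lborel)"
    by (rule nn_integral_real_affine[OF conformal_speed_measurable[OF S u]]) simp
  also have "\<dots> = (\<integral>\<^sup>+ t. conformal_speed u ?S' (\<lambda>t. - ?D (1 - t)) (reversepath \<gamma>) t \<partial>lborel)"
  proof -
    have "indicator ({0<..<1} - S) (1 - t) = (indicator ({0<..<1} - ?S') t :: real)" for t
      unfolding indicator_def using mem by simp
    then show ?thesis by (simp add: conformal_speed_def reversepath_def)
  qed
  finally show ?thesis unfolding r riem_length_conformal_metric[OF S] by simp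
qed

lemma riem_length_join:
  assumes u: "continuous_on UNIV u" and g: "valid_path \<gamma>" and h: "valid_path \<eta>" and gh: "pathfinish \<gamma> = pathstart \<eta>"
  shows "riem_length (conformal_metric u) (\<gamma> +++ \<eta>) = riem_length (conformal_metric u) \<gamma> + riem_length (conformal_metric u) \<eta>"
proof -
  obtain S where S: "speed_data S (\<lambda>t. vector_derivative \<gamma> (at t)) \<gamma>" (is "speed_data S ?D \<gamma>")
    using valid_path_speed_data[OF g] .
  obtain T where T: "speed_data T (\<lambda>t. vector_derivative \<eta> (at t)) \<eta>" (is "speed_data T ?E \<eta>")
    using valid_path_speed_data[OF h] .
  obtain U where U: "speed_data U (\<lambda>t. vector_derivative (\<gamma> +++ \<eta>) (at t)) (\<gamma> +++ \<eta>)" (is "speed_data U ?F _")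
    using valid_path_speed_data[OF valid_path_join[OF g h gh]] .
  have left: "?F t = 2 *\<^sub>R ?D (2 * t)" if "2 * t \<in> {0<..<1} - S" for t
  proof (rule vector_derivative_at)
    have 1: "(\<gamma> has_vector_derivative ?D (2 * t)) (at (2 * t))"
      using that S unfolding speed_data_def by blast
    have 2: "((\<lambda>t. 2 * t) has_vector_derivative 2) (at t)"
      unfolding has_real_derivative_iff_has_vector_derivative[symmetric] by (auto intro!: derivative_eq_intros)
    show "(\<gamma> +++ \<eta> has_vector_derivative 2 *\<^sub>R ?D (2 * t)) (at t)"
      by (rule has_vector_derivative_transform_within_open[OF vector_diff_chain_at[OF 2 1], of "{..<1/2}"])
        (use that in \<open>auto simp: joinpaths_def\<close>)
  qed
  have right: "?F t = 2 *\<^sub>R ?E (2 * t - 1)" if "2 * t - 1 \<in> {0<..<1} - T" for t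
  proof (rule vector_derivative_at)
    have 1: "(\<eta> has_vector_derivative ?E (2 * t - 1)) (at (2 * t - 1))"
      using that T unfolding speed_data_def by blast
    have 2: "((\<lambda>t. 2 * t - 1) has_vector_derivative 2) (at t)"
      unfolding has_real_derivative_iff_has_vector_derivative[symmetric] by (auto intro!: derivative_eq_intros)
    show "(\<gamma> +++ \<eta> has_vector_derivative 2 *\<^sub>R ?E (2 * t - 1)) (at t)"
      by (rule has_vector_derivative_transform_within_open[OF vector_diff_chain_at[OF 2 1], of "{1/2<..}"])
        (use that in \<open>auto simp: joinpaths_def\<close>)
  qed
  have m1: "(\<lambda>t. 2 * conformal_speed u S ?D \<gamma> (0 + 2 * t)) \<in> borel_measurable lborel"
    and m2: "(\<lambda>t. 2 * conformal_speed u T ?E \<eta> (- 1 + 2 * t)) \<in> borel_measurable lborel"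
    using conformal_speed_measurable[OF S u] conformal_speed_measurable[OF T u] by measurable
  have "finite (U \<union> (\<lambda>t. t / 2) ` S \<union> (\<lambda>t. (t + 1) / 2) ` T \<union> {0, 1/2, 1})" (is "finite ?X")
    using S T U by (simp add: speed_data_def)
  then have "AE t in lborel. t \<notin> ?X"
    by (intro AE_not_in finite_imp_null_set_lborel)
  then have "(\<integral>\<^sup>+ t. conformal_speed u U ?F (\<gamma> +++ \<eta>) t \<partial>lborel)
    = (\<integral>\<^sup>+ t. 2 * conformal_speed u S ?D \<gamma> (0 + 2 * t) + 2 * conformal_speed u T ?E \<eta> (- 1 + 2 * t) \<partial>lborel)"
  proof (intro nn_integral_cong_AE, elim eventually_mono)
    fix t assume t: "t \<notin> ?X"
    have tS: "2 * t \<notin> S"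
    proof
      assume "2 * t \<in> S"
      then have "(2 * t) / 2 \<in> (\<lambda>t. t / 2) ` S" by blast
      then show False using t by simp
    qed
    have tT: "2 * t - 1 \<notin> T"
    proof
      assume "2 * t - 1 \<in> T"
      then have "((2 * t - 1) + 1) / 2 \<in> (\<lambda>t. (t + 1) / 2) ` T" by blast
      then show False using t by simp
    qed
    have two: "ennreal (2 * a) = 2 * ennreal a" for a
      by (metis ennreal_mult' ennreal_numeral zero_le_numeral)
    consider "t < 0" | "0 < t" "t < 1/2" | "1/2 < t" "t < 1" | "1 < t" using t by force
    then show "conformal_speed u U ?F (\<gamma> +++ \<eta>) t
      = 2 * conformal_speed u S ?D \<gamma> (0 + 2 * t) + 2 * conformal_speed u T ?E \<eta> (- 1 + 2 * t)"
    proof cases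
      case 2
      then show ?thesis using t tS left[of t]
        by (auto simp: conformal_speed_def joinpaths_def two[symmetric] mult_ac)
    next
      case 3
      then show ?thesis using t tT right[of t]
        by (auto simp: conformal_speed_def joinpaths_def two[symmetric] mult_ac)
    qed (auto simp: conformal_speed_def)
  qed
  also have "\<dots> = (\<integral>\<^sup>+ t. 2 * conformal_speed u S ?D \<gamma> (0 + 2 * t) \<partial>lborel) + (\<integral>\<^sup>+ t. 2 * conformal_speed u T ?E \<eta> (- 1 + 2 * t) \<partial>lborel)"
    by (rule nn_integral_add[OF m1 m2])
  also have "(\<integral>\<^sup>+ t. 2 * conformal_speed u S ?D \<gamma> (0 + 2 * t) \<partial>lborel) = (\<integral>\<^sup>+ t. conformal_speed u S ?D \<gamma> t \<partial>lborel)"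
    using nn_integral_real_affine[OF conformal_speed_measurable[OF S u], of 2 0] conformal_speed_measurable[OF S u]
    by (subst nn_integral_cmult) auto
  also have "(\<integral>\<^sup>+ t. 2 * conformal_speed u T ?E \<eta> (- 1 + 2 * t) \<partial>lborel) = (\<integral>\<^sup>+ t. conformal_speed u T ?E \<eta> t \<partial>lborel)"
    using nn_integral_real_affine[OF conformal_speed_measurable[OF T u], of 2 "- 1"] conformal_speed_measurable[OF T u]
    by (subst nn_integral_cmult) auto
  finally show ?thesis
    unfolding riem_length_conformal_metric[OF S] riem_length_conformal_metric[OF T] riem_length_conformal_metric[OF U] .
qed

lemma riem_length_linepath:
  "riem_length (conformal_metric u) (linepath a b)
    = (\<integral>\<^sup>+ t. indicator {0..1} t * ennreal (exp (u (linepath a b t)) * norm (b - a)) \<partial>lborel)"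
proof -
  have sd: "speed_data {} (\<lambda>t. b - a) (linepath a b)"
    unfolding speed_data_def by (auto intro: has_vector_derivative_linepath_within continuous_on_linepath)
  have "AE t in lborel. t \<notin> {0, 1::real}"
    by (intro AE_not_in finite_imp_null_set_lborel) auto
  then have "AE t in lborel. conformal_speed u {} (\<lambda>t. b - a) (linepath a b) t
      = indicator {0..1} t * ennreal (exp (u (linepath a b t)) * norm (b - a))"
    by (rule eventually_mono) (auto simp: conformal_speed_def indicator_def)
  then show ?thesis
    unfolding riem_length_conformal_metric[OF sd] by (rule nn_integral_cong_AE)
qed

lemma riem_length_linepath_finite:
  assumes u: "continuous_on UNIV u"
  shows "riem_length (conformal_metric u) (linepath a b) < \<infinity>"
proof -
  let ?f = "\<lambda>t. exp (u (linepath a b t)) * norm (b - a)"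
  have "continuous_on {0..1} ?f"
    by (intro continuous_intros continuous_on_compose2[OF u continuous_on_linepath]) simp
  then have "\<exists>s\<in>{0..1}. \<forall>t\<in>{0..1}. ?f t \<le> ?f s"
    by (intro continuous_attains_sup) auto
  then obtain B where B: "\<And>t. t \<in> {0..1} \<Longrightarrow> ?f t \<le> B" by blast
  have "riem_length (conformal_metric u) (linepath a b) \<le> (\<integral>\<^sup>+ t. ennreal B * indicator {0..1::real} t \<partial>lborel)"
    unfolding riem_length_linepath by (intro nn_integral_mono) (auto simp: indicator_def intro!: ennreal_leI B)
  also have "\<dots> = ennreal B" by (simp add: nn_integral_cmult_indicator)
  finally show ?thesis by (simp add: le_less_trans)
qed

text \<open>If the length is finite, the velocity is Lebesgue integrable and its integral is the increment by
  the fundamental theorem of calculus, which holds for the gauge integral without any bound on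
  the velocity.\<close>

lemma path_increment_le_length:
  fixes \<gamma> :: "real \<Rightarrow> real^'n::finite"
  assumes S: "speed_data S D \<gamma>" and \<tau>: "0 \<le> \<tau>" "\<tau> \<le> 1"
  shows "ennreal (norm (\<gamma> \<tau> - \<gamma> 0)) \<le> (\<integral>\<^sup>+ t. ennreal (norm (indicator ({0<..<\<tau>} - S) t *\<^sub>R D t)) \<partial>lborel)"
proof -
  let ?f = "\<lambda>t. indicator ({0<..<\<tau>} - S) t *\<^sub>R D t"
  have fin: "finite S" using S by (simp add: speed_data_def)
  have "{0<..<\<tau>} - S \<in> sets borel" using fin by (simp add: finite_imp_closed sets.Diff)
  moreover have "continuous_on ({0<..<\<tau>} - S) D"
    using S \<tau> unfolding speed_data_def by (auto intro: continuous_on_subset)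
  ultimately have m: "?f \<in> borel_measurable borel" by (rule borel_measurable_continuous_on_indicator)
  show ?thesis
  proof (cases "(\<integral>\<^sup>+ t. ennreal (norm (?f t)) \<partial>lborel) = \<infinity>")
    case False
    then have int: "integrable lborel ?f" using m by (intro integrableI_bounded) (auto simp: less_top)
    have "(D has_integral \<gamma> \<tau> - \<gamma> 0) {0..\<tau>}"
      using S \<tau> unfolding speed_data_def
      by (intro fundamental_theorem_of_calculus_interior_strong[of S]) (auto intro: continuous_on_subset)
    then have "((\<lambda>t. if t \<in> {0..\<tau>} then D t else 0) has_integral \<gamma> \<tau> - \<gamma> 0) UNIV"
      by (simp only: has_integral_restrict_UNIV)
    then have "(?f has_integral \<gamma> \<tau> - \<gamma> 0) UNIV"
      by (rule has_integral_spike_finite[of "S \<union> {0, \<tau>}", rotated 2]) (use fin in \<open>auto simp: indicator_def\<close>)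
    then have eq: "integral\<^sup>L lborel ?f = \<gamma> \<tau> - \<gamma> 0"
      using has_integral_integral_lborel[OF int] has_integral_unique by blast
    have "ennreal (norm (\<gamma> \<tau> - \<gamma> 0)) \<le> ennreal (\<integral>t. norm (?f t) \<partial>lborel)"
      unfolding eq[symmetric] by (intro ennreal_leI integral_norm_bound)
    also have "\<dots> = (\<integral>\<^sup>+ t. ennreal (norm (?f t)) \<partial>lborel)"
      by (rule nn_integral_eq_integral[symmetric, OF integrable_norm[OF int]]) simp
    finally show ?thesis .
  qed auto
qed

text \<open>Up to the first time \<open>\<tau>\<close> at distance \<open>r\<close> from \<open>y\<close> the curve stays where the conformal factor is
  at least \<open>\<delta>\<close>, and by then it has covered a Euclidean distance \<open>r\<close>.\<close>

lemma riem_length_lower_bound: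
  fixes u :: "real^'n::finite \<Rightarrow> real"
  assumes g: "valid_path \<gamma>" and y: "pathstart \<gamma> = y" and far: "r \<le> norm (pathfinish \<gamma> - y)"
    and d: "0 \<le> \<delta>" "\<And>x. norm (x - y) \<le> r \<Longrightarrow> \<delta> \<le> exp (u x)"
  shows "ennreal (\<delta> * r) \<le> riem_length (conformal_metric u) \<gamma>"
proof -
  obtain S where S: "speed_data S (\<lambda>t. vector_derivative \<gamma> (at t)) \<gamma>" (is "speed_data S ?D \<gamma>")
    using valid_path_speed_data[OF g] .
  have c: "continuous_on {0..1} \<gamma>" using S by (simp add: speed_data_def)
  let ?T = "{t \<in> {0..1}. r \<le> norm (\<gamma> t - y)}"
  have "continuous_on {0..1} (\<lambda>t. norm (\<gamma> t - y))" by (intro continuous_intros c)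
  then have "closed ({0..1} \<inter> (\<lambda>t. norm (\<gamma> t - y)) -` {r..})"
    by (rule continuous_closed_preimage) auto
  moreover have "{0..1} \<inter> (\<lambda>t. norm (\<gamma> t - y)) -` {r..} = ?T" by auto
  ultimately have "closed ?T" by simp
  then have "compact ?T" using compact_Int_closed[of "{0..1::real}" ?T] by (simp add: Int_def conj_ac)
  moreover have "1 \<in> ?T" using far by (simp add: pathfinish_def)
  ultimately obtain \<tau> where \<tau>: "\<tau> \<in> ?T" "\<And>t. t \<in> ?T \<Longrightarrow> \<tau> \<le> t"
    using compact_attains_inf[of ?T] by blast
  have near: "\<delta> \<le> exp (u (\<gamma> t))" if "t \<in> {0<..<\<tau>}" for t
  proof (rule d(2))
    have "t \<notin> ?T" using \<tau>(2)[of t] that by auto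
    then show "norm (\<gamma> t - y) \<le> r" using \<tau>(1) that by auto
  qed
  have "ennreal (\<delta> * r) \<le> ennreal \<delta> * ennreal (norm (\<gamma> \<tau> - \<gamma> 0))"
    using \<tau>(1) y d(1) unfolding pathstart_def by (auto simp: ennreal_mult[symmetric] intro!: ennreal_leI mult_left_mono)
  also have "\<dots> \<le> ennreal \<delta> * (\<integral>\<^sup>+ t. ennreal (norm (indicator ({0<..<\<tau>} - S) t *\<^sub>R ?D t)) \<partial>lborel)"
    using path_increment_le_length[OF S] \<tau>(1) by (intro mult_left_mono) auto
  also have "\<dots> = (\<integral>\<^sup>+ t. ennreal \<delta> * ennreal (norm (indicator ({0<..<\<tau>} - S) t *\<^sub>R ?D t)) \<partial>lborel)"
  proof (rule nn_integral_cmult[symmetric])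
    have "{0<..<\<tau>} - S \<in> sets borel" using S by (simp add: speed_data_def finite_imp_closed sets.Diff)
    moreover have "continuous_on ({0<..<\<tau>} - S) ?D"
      using S \<tau>(1) unfolding speed_data_def by (auto intro: continuous_on_subset)
    ultimately have "(\<lambda>t. indicator ({0<..<\<tau>} - S) t *\<^sub>R ?D t) \<in> borel_measurable borel"
      by (rule borel_measurable_continuous_on_indicator)
    from measurable_compose[OF measurable_compose[OF this borel_measurable_norm] measurable_ennreal]
    show "(\<lambda>t. ennreal (norm (indicator ({0<..<\<tau>} - S) t *\<^sub>R ?D t))) \<in> borel_measurable lborel"
      by (subst measurable_cong_sets[OF sets_lborel refl])
  qed
  also have "\<dots> \<le> (\<integral>\<^sup>+ t. conformal_speed u S ?D \<gamma> t \<partial>lborel)"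
  proof (intro nn_integral_mono)
    fix t
    show "ennreal \<delta> * ennreal (norm (indicator ({0<..<\<tau>} - S) t *\<^sub>R ?D t)) \<le> conformal_speed u S ?D \<gamma> t"
      using near[of t] \<tau>(1) d(1)
      by (auto simp: conformal_speed_def indicator_def ennreal_mult[symmetric] intro!: ennreal_leI mult_right_mono)
  qed
  finally show ?thesis unfolding riem_length_conformal_metric[OF S] .
qed

text \<open>The distance before its conversion to a real number; lengths of concatenated curves add up here
  without any question of finiteness.\<close>

definition conformal_edist :: "(real^'n::finite \<Rightarrow> real) \<Rightarrow> real^'n \<Rightarrow> real^'n \<Rightarrow> ennreal"
  where "conformal_edist u x y =
    (INF \<gamma>\<in>{\<gamma>. valid_path \<gamma> \<and> pathstart \<gamma> = x \<and> pathfinish \<gamma> = y}. riem_length (conformal_metric u) \<gamma>)"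

lemma riem_dist_conformal_edist: "riem_dist (conformal_metric u) x y = enn2real (conformal_edist u x y)"
  by (simp add: riem_dist_def conformal_edist_def)

lemma conformal_edist_le:
  assumes "valid_path \<gamma>" "pathstart \<gamma> = x" "pathfinish \<gamma> = y"
  shows "conformal_edist u x y \<le> riem_length (conformal_metric u) \<gamma>"
  unfolding conformal_edist_def using assms by (intro INF_lower) simp

lemma conformal_edist_finite:
  assumes "continuous_on UNIV u" shows "conformal_edist u x y < \<infinity>"
  by (rule le_less_trans[OF conformal_edist_le[OF valid_path_linepath pathstart_linepath pathfinish_linepath]
    riem_length_linepath_finite[OF assms]])

lemma conformal_edist_commute_le:
  assumes "continuous_on UNIV u" shows "conformal_edist u x y \<le> conformal_edist u y x"
  unfolding conformal_edist_def[of u y x]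
proof (rule INF_greatest)
  fix \<gamma> assume g: "\<gamma> \<in> {\<gamma>. valid_path \<gamma> \<and> pathstart \<gamma> = y \<and> pathfinish \<gamma> = x}"
  then have "conformal_edist u x y \<le> riem_length (conformal_metric u) (reversepath \<gamma>)"
    by (intro conformal_edist_le) auto
  then show "conformal_edist u x y \<le> riem_length (conformal_metric u) \<gamma>"
    using riem_length_reversepath[OF assms] g by simp
qed

lemma conformal_edist_triangle:
  assumes u: "continuous_on UNIV u"
  shows "conformal_edist u x z \<le> conformal_edist u x y + conformal_edist u y z"
proof (rule ennreal_le_epsilon)
  fix e :: real assume e: "0 < e"
  have fin: "conformal_edist u x y \<noteq> \<infinity>" "conformal_edist u y z \<noteq> \<infinity>"
    using conformal_edist_finite[OF u] by (auto simp: less_top)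
  have near: "\<exists>\<gamma>. valid_path \<gamma> \<and> pathstart \<gamma> = a \<and> pathfinish \<gamma> = b \<and>
      riem_length (conformal_metric u) \<gamma> < conformal_edist u a b + ennreal (e / 2)"
    if "conformal_edist u a b \<noteq> \<infinity>" for a b
  proof -
    have "conformal_edist u a b < conformal_edist u a b + ennreal (e / 2)"
      using that e by (simp add: ennreal_add_left_cancel_less less_top)
    then show ?thesis unfolding conformal_edist_def[of u a b] INF_less_iff by blast
  qed
  obtain \<gamma> where g: "valid_path \<gamma>" "pathstart \<gamma> = x" "pathfinish \<gamma> = y"
    "riem_length (conformal_metric u) \<gamma> < conformal_edist u x y + ennreal (e / 2)" using near[OF fin(1)] by blast
  obtain \<eta> where h: "valid_path \<eta>" "pathstart \<eta> = y" "pathfinish \<eta> = z"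
    "riem_length (conformal_metric u) \<eta> < conformal_edist u y z + ennreal (e / 2)" using near[OF fin(2)] by blast
  have "conformal_edist u x z \<le> riem_length (conformal_metric u) (\<gamma> +++ \<eta>)"
    using g h by (intro conformal_edist_le valid_path_join) auto
  also have "\<dots> = riem_length (conformal_metric u) \<gamma> + riem_length (conformal_metric u) \<eta>"
    using g h by (intro riem_length_join[OF u]) auto
  also have "\<dots> \<le> (conformal_edist u x y + ennreal (e / 2)) + (conformal_edist u y z + ennreal (e / 2))"
    using g(4) h(4) by (intro add_mono) auto
  also have "\<dots> = conformal_edist u x y + conformal_edist u y z + (ennreal (e / 2) + ennreal (e / 2))"
    by (simp add: ac_simps)
  also have "ennreal (e / 2) + ennreal (e / 2) = ennreal e" using e by (simp flip: ennreal_plus)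
  finally show "conformal_edist u x z \<le> conformal_edist u x y + conformal_edist u y z + ennreal e" .
qed

text \<open>Locally the distance dominates the Euclidean one, and leaving a unit ball costs a fixed length.
  This separates points and shows that sequences tending to infinity do not converge.\<close>

lemma conformal_edist_lower_bound:
  fixes u :: "real^'n::finite \<Rightarrow> real"
  assumes u: "continuous_on UNIV u"
  shows "\<exists>\<delta>>0. \<forall>x. ennreal (\<delta> * min 1 (norm (x - y))) \<le> conformal_edist u y x"
proof -
  have "\<exists>x0\<in>cball y 1. \<forall>x\<in>cball y 1. u x0 \<le> u x"
    by (intro continuous_attains_inf continuous_on_subset[OF u]) auto
  then obtain x0 where x0: "\<And>x. x \<in> cball y 1 \<Longrightarrow> u x0 \<le> u x" by blast
  have b: "ennreal (exp (u x0) * r) \<le> conformal_edist u y x" if "0 \<le> r" "r \<le> 1" "r \<le> norm (x - y)" for x r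
    unfolding conformal_edist_def
  proof (rule INF_greatest)
    fix \<gamma> assume g: "\<gamma> \<in> {\<gamma>. valid_path \<gamma> \<and> pathstart \<gamma> = y \<and> pathfinish \<gamma> = x}"
    show "ennreal (exp (u x0) * r) \<le> riem_length (conformal_metric u) \<gamma>"
      by (rule riem_length_lower_bound[of _ y]) (use g that in \<open>auto intro!: x0 simp: dist_norm norm_minus_commute\<close>)
  qed
  then show ?thesis by (intro exI[of _ "exp (u x0)"]) simp
qed

lemma Metric_space_conformal_metric:
  fixes u :: "real^'n::finite \<Rightarrow> real"
  assumes u: "continuous_on UNIV u"
  shows "Metric_space UNIV (riem_dist (conformal_metric u))"
proof
  fix x y z
  note fin = conformal_edist_finite[OF u]
  show "0 \<le> riem_dist (conformal_metric u) x y" by (simp add: riem_dist_conformal_edist)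
  show "riem_dist (conformal_metric u) x y = riem_dist (conformal_metric u) y x"
    unfolding riem_dist_conformal_edist
    by (intro arg_cong[of _ _ enn2real] antisym conformal_edist_commute_le[OF u])
  show "riem_dist (conformal_metric u) x z \<le> riem_dist (conformal_metric u) x y + riem_dist (conformal_metric u) y z"
  proof -
    have "conformal_edist u x y + conformal_edist u y z < top" using fin[of x y] fin[of y z] by simp
    then have "enn2real (conformal_edist u x z) \<le> enn2real (conformal_edist u x y + conformal_edist u y z)"
      by (rule enn2real_mono[OF conformal_edist_triangle[OF u]])
    then show ?thesis unfolding riem_dist_conformal_edist
      using fin[of x y] fin[of y z] by (simp add: enn2real_plus)
  qed
  show "(riem_dist (conformal_metric u) x y = 0) = (x = y)"
  proof
    assume "x = y"
    have "conformal_edist u y y \<le> riem_length (conformal_metric u) (linepath y y)"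
      by (rule conformal_edist_le) auto
    also have "\<dots> = 0" unfolding riem_length_linepath by simp
    finally show "riem_dist (conformal_metric u) x y = 0" using \<open>x = y\<close> by (simp add: riem_dist_conformal_edist)
  next
    assume 0: "riem_dist (conformal_metric u) x y = 0"
    then have e0: "conformal_edist u x y = 0"
      using fin[of x y] unfolding riem_dist_conformal_edist by (auto simp: enn2real_eq_0_iff less_top)
    show "x = y"
    proof (rule ccontr)
      assume "x \<noteq> y"
      obtain \<delta> where d: "\<delta> > 0" "\<And>z. ennreal (\<delta> * min 1 (norm (z - x))) \<le> conformal_edist u x z"
        using conformal_edist_lower_bound[OF u, of x] by blast
      from d(2)[of y] have "ennreal (\<delta> * min 1 (norm (y - x))) \<le> 0" using e0 by simp
      moreover have "\<delta> * min 1 (norm (y - x)) > 0" using d(1) \<open>x \<noteq> y\<close> by simp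
      ultimately show False by (simp add: ennreal_eq_0_iff)
    qed
  qed
qed

text \<open>If the ray had finite length, the points \<open>z, 2 z, 3 z, \<dots>\<close> would form a Cauchy sequence, the
  distances being bounded by the tails of a finite measure \<open>\<nu>\<close>; but they leave every unit ball,
  so they have no limit.\<close>

lemma complete_imp_ray_length_infinite:
  fixes u :: "real^'n::finite \<Rightarrow> real"
  assumes u: "continuous_on UNIV u" and comp: "complete_metric (conformal_metric u)" and z: "z \<noteq> 0"
  shows "(\<integral>\<^sup>+ r. ennreal (indicator {1..} r * exp (u (r *\<^sub>R z))) \<partial>lborel) = \<infinity>"
proof (rule ccontr)
  interpret Metric_space UNIV "riem_dist (conformal_metric u)"
    by (rule Metric_space_conformal_metric[OF u])
  define h where "h r = ennreal (indicator {1..} r * exp (u (r *\<^sub>R z)))" for r :: real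
  define \<nu> where "\<nu> = density lborel h"
  assume "(\<integral>\<^sup>+ r. ennreal (indicator {1..} r * exp (u (r *\<^sub>R z))) \<partial>lborel) \<noteq> \<infinity>"
  then have fin: "(\<integral>\<^sup>+ r. h r \<partial>lborel) \<noteq> \<infinity>" unfolding h_def .
  have cu: "continuous_on UNIV (\<lambda>r. exp (u (r *\<^sub>R z)))"
    by (intro continuous_on_exp continuous_on_compose2[OF u] continuous_intros) auto
  have mh: "h \<in> borel_measurable lborel" unfolding h_def
    using borel_measurable_continuous_onI[OF cu] by measurable
  interpret nu: finite_measure \<nu>
    by (rule finite_measureI) (use fin mh in \<open>simp add: \<nu>_def emeasure_density\<close>)
  have sets_nu: "sets \<nu> = sets borel" by (simp add: \<nu>_def)
  define x where "x k = real (Suc k) *\<^sub>R z" for k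
  have len: "conformal_edist u (x j) (x k) \<le> ennreal (norm z) * emeasure \<nu> {real (Suc j)..}" if "j \<le> k" for j k
  proof (cases "j = k")
    case True
    then have "riem_dist (conformal_metric u) (x j) (x k) = 0" by simp
    then have "conformal_edist u (x j) (x k) = 0" 
      using conformal_edist_finite[OF u, of "x j" "x k"] unfolding riem_dist_conformal_edist by (auto simp: enn2real_eq_0_iff less_top)
    then show ?thesis by simp
  next
    case False
    then have jk: "j < k" using that by simp
    define c where "c = real k - real j"
    have c: "c > 0" using jk by (simp add: c_def)
    have lp: "linepath (x j) (x k) t = (real (Suc j) + c * t) *\<^sub>R z" for t
      by (simp add: linepath_def x_def c_def algebra_simps)
    have nd: "norm (x k - x j) = c * norm z"
      using c by (simp add: x_def c_def scaleR_left_diff_distrib[symmetric])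
    let ?g = "\<lambda>r. ennreal (norm z) * (h r * indicator {real (Suc j)..} r)"
    have mg: "?g \<in> borel_measurable borel" using mh by measurable
    have "conformal_edist u (x j) (x k) \<le> riem_length (conformal_metric u) (linepath (x j) (x k))"
      by (rule conformal_edist_le) auto
    also have "\<dots> = (\<integral>\<^sup>+ t. indicator {0..1} t * ennreal (exp (u ((real (Suc j) + c * t) *\<^sub>R z)) * (c * norm z)) \<partial>lborel)"
      unfolding riem_length_linepath lp nd ..
    also have "\<dots> \<le> (\<integral>\<^sup>+ t. ennreal \<bar>c\<bar> * ?g (real (Suc j) + c * t) \<partial>lborel)"
    proof (intro nn_integral_mono)
      fix t
      show "indicator {0..1} t * ennreal (exp (u ((real (Suc j) + c * t) *\<^sub>R z)) * (c * norm z))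
        \<le> ennreal \<bar>c\<bar> * ?g (real (Suc j) + c * t)"
      proof (cases "t \<in> {0..1}")
        case True
        then have "0 \<le> c * t" using c by simp
        then show ?thesis using c True by (simp add: h_def ennreal_mult[symmetric] mult_ac)
      qed simp
    qed
    also have "\<dots> = ennreal \<bar>c\<bar> * (\<integral>\<^sup>+ t. ?g (real (Suc j) + c * t) \<partial>lborel)"
      by (rule nn_integral_cmult) (use mg in measurable)
    also have "\<dots> = (\<integral>\<^sup>+ r. ?g r \<partial>lborel)"
      by (rule nn_integral_real_affine[symmetric]) (use mg c in auto)
    also have "\<dots> = ennreal (norm z) * (\<integral>\<^sup>+ r. h r * indicator {real (Suc j)..} r \<partial>lborel)"
      by (rule nn_integral_cmult) (use mh in measurable)
    also have "\<dots> = ennreal (norm z) * emeasure \<nu> {real (Suc j)..}"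
      unfolding \<nu>_def by (subst emeasure_density[OF mh]) auto
    finally show ?thesis .
  qed
  have tail: "(\<lambda>j. measure \<nu> {real (Suc j)..}) \<longlonglongrightarrow> measure \<nu> (\<Inter>j. {real (Suc j)..})"
    by (rule nu.finite_Lim_measure_decseq) (auto simp: sets_nu decseq_def)
  have "(\<Inter>j. {real (Suc j)..}) = {}"
  proof -
    have "\<exists>j. \<not> real (Suc j) \<le> r" for r
    proof -
      obtain j where "r < real j" using reals_Archimedean2 by blast
      then have "\<not> real (Suc j) \<le> r" by simp
      then show ?thesis ..
    qed
    then show ?thesis by auto
  qed
  then have tail0: "(\<lambda>j. norm z * measure \<nu> {real (Suc j)..}) \<longlonglongrightarrow> 0"
    using tendsto_mult_left[OF tail, of "norm z"] by simp
  have dist: "riem_dist (conformal_metric u) (x j) (x k) \<le> norm z * measure \<nu> {real (Suc j)..}" if "j \<le> k" for j k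
  proof -
    have "riem_dist (conformal_metric u) (x j) (x k) \<le> enn2real (ennreal (norm z) * emeasure \<nu> {real (Suc j)..})"
      unfolding riem_dist_conformal_edist
      by (rule enn2real_mono[OF len[OF that]]) (simp add: ennreal_mult_eq_top_iff nu.emeasure_finite less_top[symmetric])
    then show ?thesis by (simp add: enn2real_mult measure_def)
  qed
  have "MCauchy x"
    unfolding MCauchy_def
  proof (intro conjI allI impI)
    fix e :: real assume "e > 0"
    then obtain N where N: "\<And>j. N \<le> j \<Longrightarrow> norm z * measure \<nu> {real (Suc j)..} < e"
      using order_tendstoD(2)[OF tail0] by (auto simp: eventually_sequentially)
    have "riem_dist (conformal_metric u) (x j) (x k) < e" if "N \<le> j" "N \<le> k" for j k
      using dist[of j k] dist[of k j] N[OF that(1)] N[OF that(2)] commute[of "x j" "x k"]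
      by (cases "j \<le> k") auto
    then show "\<exists>N. \<forall>n n'. N \<le> n \<longrightarrow> N \<le> n' \<longrightarrow> riem_dist (conformal_metric u) (x n) (x n') < e" by blast
  qed auto
  then obtain y where y: "limitin mtopology x y sequentially"
    using comp unfolding complete_metric_def mcomplete_def by blast
  obtain \<delta> where d: "\<delta> > 0" "\<And>x. ennreal (\<delta> * min 1 (norm (x - y))) \<le> conformal_edist u y x"
    using conformal_edist_lower_bound[OF u, of y] by blast
  have "eventually (\<lambda>k. riem_dist (conformal_metric u) (x k) y < \<delta>) sequentially"
    using y d(1) unfolding limitin_metric by (auto elim: eventually_mono)
  moreover have "eventually (\<lambda>k. (1 + norm y) / norm z < real k) sequentially"
    by (rule eventually_gt_at_top[THEN eventually_compose_filterlim, OF filterlim_real_sequentially])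
  ultimately have "eventually (\<lambda>k. False) sequentially"
  proof eventually_elim
    case (elim k)
    have "1 + norm y \<le> norm (x k)"
    proof -
      have "1 + norm y < real k * norm z" using elim(2) z by (simp add: pos_divide_less_eq)
      also have "\<dots> \<le> norm (x k)" by (simp add: x_def mult_right_mono)
      finally show ?thesis by simp
    qed
    then have "1 \<le> norm (x k - y)" using norm_triangle_ineq2[of "x k" y] by linarith
    then have "\<delta> \<le> riem_dist (conformal_metric u) y (x k)"
      unfolding riem_dist_conformal_edist using d(1) d(2)[of "x k"] conformal_edist_finite[OF u, of y "x k"]
      using enn2real_mono[of "ennreal \<delta>" "conformal_edist u y (x k)"] \<open>1 \<le> norm (x k - y)\<close> by simp
    then show False using elim(1) commute[of y "x k"] by simp
  qed
  then show False by simp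
qed

section \<open>Growth of the conformal factor and the total curvature\<close>

lemma radial_cutoff_bounded:
  obtains B where "B \<ge> 0" "\<And>x :: real^'n::finite. \<bar>radial_cutoff q x\<bar> \<le> B * indicator (cball 0 1) x"
proof -
  have "\<exists>s\<in>{0..1}. \<forall>t\<in>{0..1::real}. \<bar>poly q t\<bar> \<le> \<bar>poly q s\<bar>"
    by (intro continuous_attains_sup continuous_intros) auto
  then obtain B where B: "\<And>t. t \<in> {0..1} \<Longrightarrow> \<bar>poly q t\<bar> \<le> B" by blast
  have "0 \<le> B" using B[of 0] by simp
  moreover have "\<bar>radial_cutoff q x\<bar> \<le> B * indicator (cball 0 1) x" for x :: "real^'n"
  proof (cases "x \<bullet> x < 1")
    case True
    then have "norm x \<le> 1" by (simp add: norm_eq_sqrt_inner)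
    then show ?thesis using True B[of "x \<bullet> x"] by (simp add: radial_cutoff_def)
  qed (use \<open>0 \<le> B\<close> in \<open>simp add: radial_cutoff_def\<close>)
  ultimately show ?thesis by (rule that)
qed

lemma smooth_const: "smooth (\<lambda>x. c)"
  by (simp add: smooth_def Ck_const)

text \<open>Here \<open>l R\<close> is the size of \<open>u\<close> at scale \<open>R\<close> that \<open>log_superharmonic_scale_bound\<close> provides.  Given
  these numbers, the argument is linear in \<open>u\<close> up to the point where completeness comes in.\<close>

locale scale_bounded =
  fixes u :: "real^'n::finite \<Rightarrow> real" and m :: nat and C :: real and l :: "real \<Rightarrow> real"
  assumes n: "CARD('n) = 2 * m" and m: "2 \<le> m" and u: "smooth u"
    and l_le: "0 < R \<Longrightarrow> l R \<le> C"
    and l_lower: "0 < R \<Longrightarrow> norm z \<le> 1 \<Longrightarrow> l R \<le> u (R *\<^sub>R z)"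
    and exp_mean: "0 < R \<Longrightarrow>
      (\<integral>z. indicator (cball 0 1) z * exp ((real m - 1) * (u (R *\<^sub>R z) - l R)) \<partial>lborel) \<le> C"
begin

lemma u_continuous: "continuous_on UNIV u"
  by (rule has_gradient_continuous[OF smooth_has_gradient[OF u]])

lemma u_dilate_continuous: "continuous_on UNIV (\<lambda>z. u (R *\<^sub>R z))"
  by (intro continuous_on_compose2[OF u_continuous] continuous_intros) auto

lemma exp_mono_exponent:
  assumes "0 \<le> t" shows "t \<le> exp ((real m - 1) * t)" "exp t \<le> exp ((real m - 1) * t)"
proof -
  have "1 * t \<le> (real m - 1) * t" using m assms by (intro mult_right_mono) auto
  then show 1: "exp t \<le> exp ((real m - 1) * t)" by simp
  show "t \<le> exp ((real m - 1) * t)" using exp_ge_add_one_self[of t] 1 by linarith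
qed

text \<open>On the unit ball the dilate \<open>u (R z)\<close> is \<open>l R\<close> up to an error that is bounded in \<open>L\<^sup>1\<close>, because
  \<open>u (R z) - l R\<close> is nonnegative and bounded by its own exponential.\<close>

lemma integral_cutoff_close:
  assumes q: "poly q 1 = 0"
  obtains B where "\<And>R. 0 < R \<Longrightarrow> \<bar>(\<integral>z. u (R *\<^sub>R z) * radial_cutoff q z \<partial>lborel)
      - l R * (integral\<^sup>L lborel (radial_cutoff q :: real^'n \<Rightarrow> real))\<bar> \<le> B"
proof -
  let ?q = "radial_cutoff q :: real^'n \<Rightarrow> real"
  obtain B where B: "B \<ge> 0" "\<And>x :: real^'n. \<bar>?q x\<bar> \<le> B * indicator (cball 0 1) x"
    by (rule radial_cutoff_bounded[of q]) auto
  have cq: "continuous_on UNIV ?q" by (rule radial_cutoff_continuous[OF q])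
  have "\<bar>(\<integral>z. u (R *\<^sub>R z) * ?q z \<partial>lborel) - l R * integral\<^sup>L lborel ?q\<bar> \<le> B * C" if R: "0 < R" for R
  proof -
    let ?e = "\<lambda>z. indicator (cball 0 1) z * exp ((real m - 1) * (u (R *\<^sub>R z) - l R))"
    have i1: "integrable lborel (\<lambda>z. u (R *\<^sub>R z) * ?q z)"
      by (rule compact_support_integral(1)[OF continuous_on_mult[OF u_dilate_continuous cq], of 1])
        (simp add: radial_cutoff_zero)
    have i2: "integrable lborel ?q"
      by (rule compact_support_integral(1)[OF cq radial_cutoff_zero])
    have i3: "integrable lborel ?e"
      by (rule integrable_cball_continuous) (intro continuous_intros u_dilate_continuous)
    have "(\<integral>z. u (R *\<^sub>R z) * ?q z \<partial>lborel) - l R * integral\<^sup>L lborel ?q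
      = (\<integral>z. (u (R *\<^sub>R z) - l R) * ?q z \<partial>lborel)"
      using i1 i2 by (simp add: left_diff_distrib)
    also have "\<bar>\<dots>\<bar> \<le> (\<integral>z. B * ?e z \<partial>lborel)"
    proof (rule integral_abs_bound[THEN order_trans], rule integral_mono)
      show "integrable lborel (\<lambda>z. \<bar>(u (R *\<^sub>R z) - l R) * ?q z\<bar>)"
        using i1 i2 by (intro integrable_abs) (simp add: left_diff_distrib)
      show "integrable lborel (\<lambda>z. B * ?e z)" using i3 by simp
      fix z :: "real^'n"
      show "\<bar>(u (R *\<^sub>R z) - l R) * ?q z\<bar> \<le> B * ?e z"
      proof (cases "norm z \<le> 1")
        case True
        then have "0 \<le> u (R *\<^sub>R z) - l R" using l_lower[OF R] by simp
        then have "\<bar>u (R *\<^sub>R z) - l R\<bar> * \<bar>?q z\<bar> \<le> exp ((real m - 1) * (u (R *\<^sub>R z) - l R)) * B"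
          using exp_mono_exponent(1)[of "u (R *\<^sub>R z) - l R"] B(2)[of z] True by (intro mult_mono) auto
        then show ?thesis using True by (simp add: abs_mult mult.commute)
      next
        case False
        then show ?thesis using B(2)[of z] by simp
      qed
    qed
    also have "\<dots> \<le> B * C" using exp_mean[OF R] B(1) by (simp add: mult_left_mono)
    finally show ?thesis .
  qed
  then show ?thesis by (rule that)
qed

text \<open>The exponent is the least that allows \<open>m\<close> Laplacians to be moved onto the test function.\<close>

definition cutoff_poly :: "real poly" where "cutoff_poly = [:1, - 1:] ^ (2 * m + 1)"

lemma cutoff_poly_0: "poly cutoff_poly 0 = 1"
  and cutoff_poly_bounds: "0 \<le> t \<Longrightarrow> t \<le> 1 \<Longrightarrow> 0 \<le> poly cutoff_poly t \<and> poly cutoff_poly t \<le> 1"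
  and cutoff_poly_antimono: "0 \<le> s \<Longrightarrow> s \<le> t \<Longrightarrow> t \<le> 1 \<Longrightarrow> poly cutoff_poly t \<le> poly cutoff_poly s"
  unfolding cutoff_poly_def poly_power
  by (simp_all add: power_le_one power_mono del: power_Suc)

definition scaled_cutoff :: "real \<Rightarrow> real^'n \<Rightarrow> real"
  where "scaled_cutoff R x = radial_cutoff cutoff_poly ((1 / R) *\<^sub>R x)"

lemma scaled_cutoff_continuous: "continuous_on UNIV (scaled_cutoff R)"
proof -
  have "continuous_on UNIV (radial_cutoff cutoff_poly :: real^'n \<Rightarrow> real)"
    by (rule radial_cutoff_continuous) (simp add: cutoff_poly_def poly_power)
  then show ?thesis unfolding scaled_cutoff_def[abs_def]
    by (rule continuous_on_compose2) (auto intro!: continuous_intros)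
qed

lemma scaled_cutoff_bounds: "0 \<le> scaled_cutoff R x" "scaled_cutoff R x \<le> 1"
  using cutoff_poly_bounds[of "((1 / R) *\<^sub>R x) \<bullet> ((1 / R) *\<^sub>R x)"] by (auto simp: scaled_cutoff_def radial_cutoff_def)

lemma scaled_cutoff_mono:
  assumes "0 < R" "R \<le> R'" shows "scaled_cutoff R x \<le> scaled_cutoff R' x"
proof (cases "((1 / R) *\<^sub>R x) \<bullet> ((1 / R) *\<^sub>R x) < 1")
  case True
  have "((1 / R') *\<^sub>R x) \<bullet> ((1 / R') *\<^sub>R x) \<le> ((1 / R) *\<^sub>R x) \<bullet> ((1 / R) *\<^sub>R x)"
    unfolding dot_square_norm using assms by (intro power_mono) (auto simp: frac_le)
  then show ?thesis using True unfolding scaled_cutoff_def radial_cutoff_def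
    by (auto intro!: cutoff_poly_antimono)
next
  case False
  then have "scaled_cutoff R x = 0" by (simp add: scaled_cutoff_def radial_cutoff_def)
  then show ?thesis using scaled_cutoff_bounds by simp
qed

lemma scaled_cutoff_tendsto: "((\<lambda>R. scaled_cutoff R x) \<longlongrightarrow> 1) at_top"
proof -
  have "continuous_on UNIV (radial_cutoff cutoff_poly :: real^'n \<Rightarrow> real)"
    by (rule radial_cutoff_continuous) (simp add: cutoff_poly_def poly_power)
  then have "isCont (radial_cutoff cutoff_poly :: real^'n \<Rightarrow> real) 0"
    by (simp add: continuous_on_eq_continuous_at)
  moreover have "((\<lambda>R. (1 / R) *\<^sub>R x) \<longlongrightarrow> 0 *\<^sub>R x) at_top"
    by (intro tendsto_intros tendsto_divide_0[OF tendsto_const] filterlim_at_top_imp_at_infinity filterlim_ident)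
  ultimately have "((\<lambda>R. radial_cutoff cutoff_poly ((1 / R) *\<^sub>R x)) \<longlongrightarrow> radial_cutoff cutoff_poly (0::real^'n)) at_top"
    unfolding scaleR_zero_left by (rule isCont_tendsto_compose)
  then show ?thesis unfolding scaled_cutoff_def[abs_def] by (simp add: radial_cutoff_def cutoff_poly_0)
qed

text \<open>The density \<open>f\<close> of the total curvature with respect to Lebesgue measure.\<close>

definition curv_density :: "real^'n \<Rightarrow> real" where "curv_density = polylaplacian m u"

lemma curv_density_continuous: "continuous_on UNIV curv_density"
  unfolding curv_density_def by (rule has_gradient_continuous[OF smooth_has_gradient[OF smooth_polylaplacian[OF u]]])

text \<open>The integral of \<open>f(x) \<phi>(x / R)\<close>.\<close>

definition cut_total :: "real \<Rightarrow> real" where "cut_total R = (\<integral>x. curv_density x * scaled_cutoff R x \<partial>lborel)"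

lemma scaled_cutoff_product_integrable:
  assumes g: "continuous_on UNIV g" and R: "0 < R" shows "integrable lborel (\<lambda>x. g x * scaled_cutoff R x)"
proof (rule compact_support_integral(1)[OF continuous_on_mult[OF g scaled_cutoff_continuous], of R])
  fix x :: "real^'n" assume "norm x > R"
  then have "norm ((1 / R) *\<^sub>R x) > 1" using R by (simp add: field_simps)
  then show "g x * scaled_cutoff R x = 0" by (simp add: scaled_cutoff_def radial_cutoff_zero)
qed

abbreviation nL :: "real poly \<Rightarrow> real poly" where "nL \<equiv> radial_neg_laplacian (real m)"

lemma half_card: "real CARD('n) / 2 = real m" using n by simp

lemma cut_total_eq:
  assumes R: "0 < R"
  shows "cut_total R = (\<integral>z. u (R *\<^sub>R z) * radial_cutoff ((nL ^^ m) cutoff_poly) z \<partial>lborel)"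
proof -
  have "cut_total R = \<bar>R\<bar> ^ DIM(real^'n) * (\<integral>z. curv_density (0 + R *\<^sub>R z) * scaled_cutoff R (0 + R *\<^sub>R z) \<partial>lborel)"
    unfolding cut_total_def
    by (rule lborel_integral_affine[of R "\<lambda>x. curv_density x * scaled_cutoff R x" 0])
      (use R in \<open>auto intro!: borel_measurable_continuous_onI continuous_on_mult[OF curv_density_continuous scaled_cutoff_continuous]\<close>)
  also have "\<dots> = (\<integral>z. polylaplacian m (\<lambda>x. u (R *\<^sub>R x)) z * radial_cutoff cutoff_poly z \<partial>lborel)"
    unfolding polylaplacian_dilate[OF u] using R n by (simp add: scaled_cutoff_def curv_density_def mult.assoc)
  also have "\<dots> = (\<integral>z. u (R *\<^sub>R z) * radial_cutoff ((nL ^^ m) cutoff_poly) z \<partial>lborel)"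
    unfolding half_card[symmetric]
    by (rule polylaplacian_radial_green[OF smooth_dilate[OF u]]) (simp add: cutoff_poly_def)
  finally show ?thesis .
qed

text \<open>The integral of \<open>(- \<Delta>)\<^sup>m \<phi>\<close> is zero, as Green's identity against a constant shows; so \<open>u (R z)\<close> may
  be replaced by \<open>u (R z) - l R\<close>.\<close>

lemma cut_total_bounded: obtains B where "\<And>R. 0 < R \<Longrightarrow> \<bar>cut_total R\<bar> \<le> B"
proof -
  let ?q = "(nL ^^ m) cutoff_poly"
  have "[:1, - 1:] ^ Suc 0 dvd ?q"
    by (rule dvd_radial_neg_laplacian_pow) (simp add: cutoff_poly_def)
  then have q: "poly ?q 1 = 0" by (rule dvd_poly_1)
  have "(\<integral>x. polylaplacian m (\<lambda>x. 1) x * radial_cutoff cutoff_poly (x :: real^'n) \<partial>lborel)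
      = (\<integral>x. 1 * radial_cutoff ?q (x :: real^'n) \<partial>lborel)"
    unfolding half_card[symmetric]
    by (rule polylaplacian_radial_green[OF smooth_const]) (simp add: cutoff_poly_def)
  moreover have "polylaplacian m (\<lambda>x :: real^'n. 1) = (\<lambda>x. 0)"
    using polylaplacian_dilate[OF smooth_const[of 1], of m 0] m by (simp add: zero_power)
  ultimately have "integral\<^sup>L lborel (radial_cutoff ?q :: real^'n \<Rightarrow> real) = 0" by simp
  moreover obtain B where "\<And>R. 0 < R \<Longrightarrow> \<bar>(\<integral>z. u (R *\<^sub>R z) * radial_cutoff ?q z \<partial>lborel)
      - l R * (integral\<^sup>L lborel (radial_cutoff ?q :: real^'n \<Rightarrow> real))\<bar> \<le> B"
    by (rule integral_cutoff_close[OF q]) blast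
  ultimately have "\<bar>cut_total R\<bar> \<le> B" if "0 < R" for R using cut_total_eq[OF that] that by fastforce
  then show ?thesis by (rule that)
qed

text \<open>Monotone convergence for the positive part, whose truncated integrals are bounded by those of
  \<open>f\<close> plus the integral of the negative part.\<close>

lemma curv_density_integrable:
  assumes neg: "integrable lborel (\<lambda>x. max (- curv_density x) 0)"
  shows "integrable lborel curv_density"
proof -
  obtain B where B: "\<And>R. 0 < R \<Longrightarrow> \<bar>cut_total R\<bar> \<le> B" by (rule cut_total_bounded) blast
  define K where "K = B + (\<integral>x. max (- curv_density x) 0 \<partial>lborel)"
  define g where "g k x = max (curv_density x) 0 * scaled_cutoff (real (Suc k)) x" for k x
  have cpos: "continuous_on UNIV (\<lambda>x. max (curv_density x) 0)" and cneg: "continuous_on UNIV (\<lambda>x. max (- curv_density x) 0)"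
    by (intro continuous_intros curv_density_continuous)+
  have gint: "integrable lborel (g k)" for k
    unfolding g_def[abs_def] by (rule scaled_cutoff_product_integrable[OF cpos]) simp
  have gK: "integral\<^sup>L lborel (g k) \<le> K" for k
  proof -
    have i1: "integrable lborel (\<lambda>x. curv_density x * scaled_cutoff (real (Suc k)) x)"
      and i2: "integrable lborel (\<lambda>x. max (- curv_density x) 0 * scaled_cutoff (real (Suc k)) x)"
      by (rule scaled_cutoff_product_integrable; simp add: curv_density_continuous cneg)+
    have "g k = (\<lambda>x. curv_density x * scaled_cutoff (real (Suc k)) x + max (- curv_density x) 0 * scaled_cutoff (real (Suc k)) x)"
      unfolding g_def by (rule ext) (simp add: max_def algebra_simps)
    then have "integral\<^sup>L lborel (g k) = cut_total (real (Suc k)) + (\<integral>x. max (- curv_density x) 0 * scaled_cutoff (real (Suc k)) x \<partial>lborel)"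
      using i1 i2 by (simp add: cut_total_def)
    moreover have "(\<integral>x. max (- curv_density x) 0 * scaled_cutoff (real (Suc k)) x \<partial>lborel) \<le> (\<integral>x. max (- curv_density x) 0 \<partial>lborel)"
      by (rule integral_mono[OF i2 neg]) (simp add: scaled_cutoff_bounds mult_left_le)
    ultimately show ?thesis using B[of "real (Suc k)"] unfolding K_def by simp
  qed
  have g0: "0 \<le> g k x" for k x unfolding g_def by (simp add: scaled_cutoff_bounds)
  have "(\<lambda>k. \<integral>\<^sup>+ x. ennreal (g k x) \<partial>lborel) \<longlonglongrightarrow> (\<integral>\<^sup>+ x. ennreal (max (curv_density x) 0) \<partial>lborel)"
  proof (rule nn_integral_LIMSEQ)
    show "incseq (\<lambda>k x. ennreal (g k x))"
      unfolding g_def by (auto simp: incseq_def le_fun_def intro!: ennreal_leI mult_left_mono scaled_cutoff_mono)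
    show "(\<lambda>x. ennreal (g k x)) \<in> borel_measurable lborel" for k
      using borel_measurable_integrable[OF gint[of k]] by measurable
    fix x
    have "(\<lambda>k. scaled_cutoff (real (Suc k)) x) \<longlonglongrightarrow> 1"
      by (rule filterlim_compose[OF scaled_cutoff_tendsto]) (rule filterlim_compose[OF filterlim_real_sequentially filterlim_Suc])
    from tendsto_mult_left[OF this, of "max (curv_density x) 0"]
    show "(\<lambda>k. ennreal (g k x)) \<longlonglongrightarrow> ennreal (max (curv_density x) 0)"
      unfolding g_def by (intro tendsto_ennrealI) simp
  qed
  moreover have "(\<integral>\<^sup>+ x. ennreal (g k x) \<partial>lborel) \<le> ennreal K" for k
    using gK[of k] g0 by (subst nn_integral_eq_integral[OF gint]) (auto intro!: ennreal_leI)
  ultimately have "(\<integral>\<^sup>+ x. ennreal (max (curv_density x) 0) \<partial>lborel) \<le> ennreal K"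
    by (intro LIMSEQ_le_const2) auto
  then have "(\<integral>\<^sup>+ x. ennreal (norm (max (curv_density x) 0)) \<partial>lborel) < \<infinity>"
    by (simp add: le_less_trans)
  then have "integrable lborel (\<lambda>x. max (curv_density x) 0)"
    using borel_measurable_continuous_onI[OF cpos] by (intro integrableI_bounded) auto
  from Bochner_Integration.integrable_diff[OF this neg]
  have "integrable lborel (\<lambda>x. max (curv_density x) 0 - max (- curv_density x) 0)" .
  moreover have "(\<lambda>x. max (curv_density x) 0 - max (- curv_density x) 0) = curv_density" by (auto simp: max_def)
  ultimately show ?thesis by simp
qed

lemma cut_total_tendsto:
  assumes "integrable lborel curv_density" shows "(cut_total \<longlongrightarrow> integral\<^sup>L lborel curv_density) at_top"
  unfolding cut_total_def[abs_def]
proof (rule integral_dominated_convergence_at_top)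
  show "integrable lborel (\<lambda>x. norm (curv_density x))" using assms by simp
  show "AE x in lborel. ((\<lambda>R. curv_density x * scaled_cutoff R x) \<longlongrightarrow> curv_density x) at_top"
    using tendsto_mult_left[OF scaled_cutoff_tendsto] by (intro AE_I2) fastforce
  show "\<forall>\<^sub>F R in at_top. AE x in lborel. norm (curv_density x * scaled_cutoff R x) \<le> norm (curv_density x)"
    by (intro always_eventually allI AE_I2) (simp add: abs_mult scaled_cutoff_bounds mult_left_le)
  show "(\<lambda>x. curv_density x * scaled_cutoff R x) \<in> borel_measurable lborel" for R
    using borel_measurable_continuous_onI[OF continuous_on_mult[OF curv_density_continuous scaled_cutoff_continuous]] by simp
qed (use borel_measurable_continuous_onI[OF curv_density_continuous] in simp)

text \<open>The function \<open>\<rho>\<close> for which \<open>\<rho>(z) z\<close> is the gradient of \<open>(- \<Delta>)\<^bsup>m - 1\<^esup> \<phi>\<close>.\<close>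

definition radial_kernel :: "real poly" where "radial_kernel = smult 2 (pderiv ((nL ^^ (m - 1)) cutoff_poly))"

text \<open>The mean \<open>U(R)\<close> of \<open>u (R z)\<close> with the signed weight \<open>\<rho>\<close>; it picks out the logarithmic growth of \<open>u\<close>.\<close>

definition kernel_mean :: "real \<Rightarrow> real" where "kernel_mean R = (\<integral>z. u (R *\<^sub>R z) * radial_cutoff radial_kernel z \<partial>lborel)"

lemma radial_kernel_vanishes:
  "poly ((nL ^^ (m - 1)) cutoff_poly) 1 = 0" "poly (pderiv ((nL ^^ (m - 1)) cutoff_poly)) 1 = 0"
  "poly (pderiv (pderiv ((nL ^^ (m - 1)) cutoff_poly))) 1 = 0"
proof -
  have "[:1, - 1:] ^ 3 dvd (nL ^^ (m - 1)) cutoff_poly"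
  proof (rule dvd_radial_neg_laplacian_pow)
    have "3 + 2 * (m - 1) = 2 * m + 1" using m by simp
    then show "[:1, - 1:] ^ (3 + 2 * (m - 1)) dvd cutoff_poly" unfolding cutoff_poly_def by (simp only: dvd_refl)
  qed
  note v = dvd_vanishes[OF this]
  show "poly ((nL ^^ (m - 1)) cutoff_poly) 1 = 0" "poly (pderiv ((nL ^^ (m - 1)) cutoff_poly)) 1 = 0"
    "poly (pderiv (pderiv ((nL ^^ (m - 1)) cutoff_poly))) 1 = 0" by (fact v)+
qed

lemma radial_kernel_continuous: "continuous_on UNIV (radial_cutoff radial_kernel)"
  by (rule radial_cutoff_continuous) (use radial_kernel_vanishes in \<open>simp add: radial_kernel_def\<close>)

text \<open>Euler's operator \<open>R d/dR\<close> turns \<open>u (R z)\<close> into \<open>z \<cdot> \<nabla>\<close> of it, and \<open>\<rho>(z) z\<close> is a gradient; so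
  Green's identity produces the remaining Laplacian and hence the curvature integral.\<close>

lemma kernel_mean_DERIV:
  assumes R: "0 < R" shows "(kernel_mean has_real_derivative cut_total R / R) (at R)"
proof -
  let ?p = "(nL ^^ (m - 1)) cutoff_poly"
  let ?v = "\<lambda>i. partial_deriv i u"
  have g: "has_gradient u ?v" by (rule smooth_has_gradient[OF u])
  have D: "(kernel_mean has_real_derivative (\<integral>z. (\<Sum>i\<in>UNIV. z $ i * ?v i (R *\<^sub>R z)) * radial_cutoff radial_kernel z \<partial>lborel)) (at R)"
    using dilation_integral_DERIV[OF g radial_kernel_continuous radial_cutoff_zero, of 0 R] unfolding kernel_mean_def[abs_def] by simp
  have "has_gradient (\<lambda>z. u (R *\<^sub>R z)) (\<lambda>i z. R * ?v i (R *\<^sub>R z))"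
    using has_gradient_dilate[OF g, of 0 R] by simp
  from radial_green_second[OF this radial_kernel_vanishes(2,3), unfolded half_card, folded radial_kernel_def]
  have "(\<integral>z. (\<Sum>i\<in>UNIV. z $ i * (R * ?v i (R *\<^sub>R z))) * radial_cutoff radial_kernel z \<partial>lborel)
     = (\<integral>z. u (R *\<^sub>R z) * radial_cutoff (nL ?p) z \<partial>lborel)" .
  also have "nL ?p = (nL ^^ m) cutoff_poly" using m by (cases m) simp_all
  also have "(\<integral>z. u (R *\<^sub>R z) * radial_cutoff \<dots> z \<partial>lborel) = cut_total R" by (rule cut_total_eq[OF R, symmetric])
  also have "(\<integral>z. (\<Sum>i\<in>UNIV. z $ i * (R * ?v i (R *\<^sub>R z))) * radial_cutoff radial_kernel z \<partial>lborel)
    = (\<integral>z. R * ((\<Sum>i\<in>UNIV. z $ i * ?v i (R *\<^sub>R z)) * radial_cutoff radial_kernel z) \<partial>lborel)"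
    by (rule Bochner_Integration.integral_cong) (simp_all add: sum_distrib_left sum_distrib_right mult_ac)
  also have "\<dots> = R * (\<integral>z. (\<Sum>i\<in>UNIV. z $ i * ?v i (R *\<^sub>R z)) * radial_cutoff radial_kernel z \<partial>lborel)" by simp
  finally have "(\<integral>z. (\<Sum>i\<in>UNIV. z $ i * ?v i (R *\<^sub>R z)) * radial_cutoff radial_kernel z \<partial>lborel) = cut_total R / R"
    using R by (simp add: eq_divide_eq mult.commute)
  then show ?thesis using D by simp
qed

text \<open>The mass \<open>c\<close> of \<open>(- \<Delta>)\<^sup>m log (1 / \<bar>x\<bar>)\<close>, up to sign the mass of \<open>\<rho>\<close>.\<close>

definition crit_mass :: real where "crit_mass = fact (CARD('n) - 1) * unit_sphere_volume TYPE('n) / 2"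

lemma crit_mass_pos: "crit_mass > 0"
  unfolding crit_mass_def unit_sphere_volume_eq by (auto intro!: divide_pos_pos mult_pos_pos Gamma_real_pos simp: add_pos_pos)

lemma kernel_mean_close: obtains B where "\<And>R. 0 < R \<Longrightarrow> \<bar>kernel_mean R + crit_mass * l R\<bar> \<le> B"
proof -
  have q: "poly radial_kernel 1 = 0" using radial_kernel_vanishes by (simp add: radial_kernel_def)
  have mass: "integral\<^sup>L lborel (radial_cutoff radial_kernel :: real^'n \<Rightarrow> real) = - crit_mass"
    unfolding radial_kernel_def crit_mass_def by (rule radial_kernel_mass[OF n m _ cutoff_poly_0]) (simp add: cutoff_poly_def)
  obtain B where "\<And>R. 0 < R \<Longrightarrow> \<bar>kernel_mean R - l R * (- crit_mass)\<bar> \<le> B"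
    unfolding kernel_mean_def mass[symmetric] by (rule integral_cutoff_close[OF q]) blast
  then have "\<bar>kernel_mean R + crit_mass * l R\<bar> \<le> B" if "0 < R" for R using that by (fastforce simp: mult.commute)
  then show ?thesis by (rule that)
qed

lemma kernel_mean_le:
  assumes "R1 > 0" "R1 \<le> R" and "\<And>r. R1 \<le> r \<Longrightarrow> cut_total r \<le> a" shows "kernel_mean R \<le> kernel_mean R1 + a * (ln R - ln R1)"
proof -
  have "(\<lambda>r. kernel_mean r - a * ln r) R \<le> (\<lambda>r. kernel_mean r - a * ln r) R1"
  proof (rule DERIV_nonpos_imp_nonincreasing[OF assms(2)])
    fix r assume r: "R1 \<le> r" "r \<le> R"
    have "((\<lambda>r. kernel_mean r - a * ln r) has_real_derivative cut_total r / r - a * (1 / r)) (at r)"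
      using r assms(1) by (intro DERIV_diff DERIV_cmult kernel_mean_DERIV DERIV_ln_divide) auto
    moreover have "cut_total r / r - a * (1 / r) \<le> 0" using assms(3)[OF r(1)] r(1) assms(1) by (simp add: divide_right_mono)
    ultimately show "\<exists>y. ((\<lambda>r. kernel_mean r - a * ln r) has_real_derivative y) (at r) \<and> y \<le> 0" by blast
  qed
  then show ?thesis by (simp add: algebra_simps)
qed

lemma kernel_mean_ge:
  assumes "R1 > 0" "R1 \<le> R" and "\<And>r. R1 \<le> r \<Longrightarrow> a \<le> cut_total r" shows "kernel_mean R1 + a * (ln R - ln R1) \<le> kernel_mean R"
proof -
  have "(\<lambda>r. kernel_mean r - a * ln r) R1 \<le> (\<lambda>r. kernel_mean r - a * ln r) R"
  proof (rule DERIV_nonneg_imp_nondecreasing[OF assms(2)])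
    fix r assume r: "R1 \<le> r" "r \<le> R"
    have "((\<lambda>r. kernel_mean r - a * ln r) has_real_derivative cut_total r / r - a * (1 / r)) (at r)"
      using r assms(1) by (intro DERIV_diff DERIV_cmult kernel_mean_DERIV DERIV_ln_divide) auto
    moreover have "cut_total r / r - a * (1 / r) \<ge> 0" using assms(3)[OF r(1)] r(1) assms(1) by (simp add: divide_right_mono)
    ultimately show "\<exists>y. ((\<lambda>r. kernel_mean r - a * ln r) has_real_derivative y) (at r) \<and> y \<ge> 0" by blast
  qed
  then show ?thesis by (simp add: algebra_simps)
qed

text \<open>If \<open>F < 0\<close>, then the mean \<open>U(R)\<close> is at most \<open>(F / 2) log R\<close> up to a constant and so tends to minus
  infinity, while \<open>U(R) = - c l R + O(1)\<close> is bounded below because \<open>l\<close> is bounded above.\<close>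

lemma total_nonneg:
  assumes "integrable lborel curv_density" shows "0 \<le> integral\<^sup>L lborel curv_density"
proof (rule ccontr)
  let ?F = "integral\<^sup>L lborel curv_density"
  assume "\<not> 0 \<le> ?F"
  then have F: "?F < ?F / 2" "?F / 2 < 0" by auto
  obtain R0 where R0: "\<And>r. R0 \<le> r \<Longrightarrow> cut_total r < ?F / 2"
    using order_tendstoD(2)[OF cut_total_tendsto[OF assms] F(1)] by (auto simp: eventually_at_top_linorder)
  define R1 where "R1 = max 1 R0"
  have R1: "R1 > 0" "\<And>r. R1 \<le> r \<Longrightarrow> cut_total r \<le> ?F / 2" using R0 by (auto simp: R1_def less_imp_le)
  obtain B where B: "\<And>R. 0 < R \<Longrightarrow> \<bar>kernel_mean R + crit_mass * l R\<bar> \<le> B" by (rule kernel_mean_close) blast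
  have lower: "- crit_mass * C - B \<le> kernel_mean R" if "0 < R" for R
  proof -
    have "crit_mass * l R \<le> crit_mass * C" using l_le[OF that] crit_mass_pos by (intro mult_left_mono) auto
    then show ?thesis using B[OF that] by linarith
  qed
  have "eventually (\<lambda>R. ln R > ln R1 + (- crit_mass * C - B - kernel_mean R1) / (?F / 2)) at_top"
    using ln_at_top by (simp add: filterlim_at_top_dense)
  then have "eventually (\<lambda>R. ln R > ln R1 + (- crit_mass * C - B - kernel_mean R1) / (?F / 2) \<and> R \<ge> R1) at_top"
    using eventually_ge_at_top by (rule eventually_conj)
  then obtain R where R: "ln R > ln R1 + (- crit_mass * C - B - kernel_mean R1) / (?F / 2)" "R \<ge> R1"
    by (auto simp: eventually_at_top_linorder)
  have "(?F / 2) * (ln R - ln R1) < (?F / 2) * ((- crit_mass * C - B - kernel_mean R1) / (?F / 2))"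
    using R(1) F(2) by (intro mult_strict_left_mono_neg) auto
  also have "\<dots> = - crit_mass * C - B - kernel_mean R1" using F(2) by simp
  finally have "kernel_mean R1 + (?F / 2) * (ln R - ln R1) < - crit_mass * C - B" by linarith
  then show False using kernel_mean_le[OF R1(1) R(2) R1(2)] lower[of R] R1(1) R(2) by linarith
qed

text \<open>As \<open>m - 1 \<ge> 1\<close>, the exponential moment of order \<open>m - 1\<close> controls that of order one.\<close>

lemma exp_average:
  assumes R: "0 < R"
  shows "(\<integral>\<^sup>+ z. ennreal (indicator (cball 0 1) z * exp (u (R *\<^sub>R z))) \<partial>lborel) \<le> ennreal (exp (l R) * C)"
proof -
  have i: "integrable lborel (\<lambda>z. indicator (cball 0 1) z * exp (u (R *\<^sub>R z)))"
    by (rule integrable_cball_continuous) (intro continuous_intros u_dilate_continuous)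
  have i': "integrable lborel (\<lambda>z. indicator (cball 0 1) z * exp ((real m - 1) * (u (R *\<^sub>R z) - l R)))"
    by (rule integrable_cball_continuous) (intro continuous_intros u_dilate_continuous)
  have "(\<integral>z. indicator (cball 0 1) z * exp (u (R *\<^sub>R z)) \<partial>lborel)
    \<le> (\<integral>z. exp (l R) * (indicator (cball 0 1) z * exp ((real m - 1) * (u (R *\<^sub>R z) - l R))) \<partial>lborel)"
  proof (rule integral_mono[OF i integrable_mult_right[OF i']])
    fix z :: "real^'n"
    show "indicator (cball 0 1) z * exp (u (R *\<^sub>R z)) \<le> exp (l R) * (indicator (cball 0 1) z * exp ((real m - 1) * (u (R *\<^sub>R z) - l R)))"
    proof (cases "norm z \<le> 1")
      case True
      have "exp (u (R *\<^sub>R z)) = exp (l R) * exp (u (R *\<^sub>R z) - l R)" by (simp flip: exp_add)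
      also have "\<dots> \<le> exp (l R) * exp ((real m - 1) * (u (R *\<^sub>R z) - l R))"
        using l_lower[OF R True] by (intro mult_left_mono exp_mono_exponent(2)) auto
      finally show ?thesis using True by simp
    qed simp
  qed
  also have "\<dots> \<le> exp (l R) * C" using exp_mean[OF R] by simp
  finally show ?thesis by (subst nn_integral_eq_integral[OF i]) (auto intro: ennreal_leI)
qed

text \<open>If \<open>F > c\<close>, then \<open>l R \<le> A - s log R\<close> for large \<open>R\<close> with \<open>s > 1\<close>, so the integral over the unit
  ball of the lengths of the rays \<open>r \<mapsto> r z\<close>, \<open>r \<ge> 1\<close>, is finite, and almost every ray has finite
  length.\<close>

lemma total_le:
  assumes int: "integrable lborel curv_density" and comp: "complete_metric (conformal_metric u)"
  shows "integral\<^sup>L lborel curv_density \<le> crit_mass"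
proof (rule ccontr)
  let ?F = "integral\<^sup>L lborel curv_density"
  assume "\<not> ?F \<le> crit_mass"
  then have F: "(?F + crit_mass) / 2 < ?F" "crit_mass < (?F + crit_mass) / 2" by auto
  \<comment> \<open>a value strictly between the two, so that the decay exponent \<open>s\<close> exceeds one\<close>
  define a where "a = (?F + crit_mass) / 2"
  define s where "s = a / crit_mass"
  have s: "s > 1" using F(2) crit_mass_pos by (simp add: s_def a_def)
  obtain R0 where R0: "\<And>r. R0 \<le> r \<Longrightarrow> a < cut_total r"
    using order_tendstoD(1)[OF cut_total_tendsto[OF int] F(1)] by (auto simp: eventually_at_top_linorder a_def)
  define R1 where "R1 = max 1 R0"
  have R1: "R1 \<ge> 1" "\<And>r. R1 \<le> r \<Longrightarrow> a \<le> cut_total r" using R0 by (auto simp: R1_def less_imp_le)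
  obtain B where B: "\<And>R. 0 < R \<Longrightarrow> \<bar>kernel_mean R + crit_mass * l R\<bar> \<le> B" by (rule kernel_mean_close) blast
  define A where "A = (B - kernel_mean R1 + a * ln R1) / crit_mass"
  have lR: "exp (l R) \<le> exp A * R powr (- s)" if "R1 \<le> R" for R
  proof -
    have "crit_mass * l R \<le> B - kernel_mean R" using B[of R] that R1(1) by linarith
    also have "\<dots> \<le> B - kernel_mean R1 + a * ln R1 - a * ln R"
      using kernel_mean_ge[OF _ that R1(2)] R1(1) by (simp add: algebra_simps)
    also have "\<dots> = crit_mass * (A - s * ln R)" using crit_mass_pos by (simp add: A_def s_def field_simps)
    finally have "l R \<le> A - s * ln R" using crit_mass_pos by simp
    then have "exp (l R) \<le> exp (A - s * ln R)" by simp
    also have "\<dots> = exp A * R powr (- s)" using that R1(1) by (simp add: powr_def exp_diff exp_minus divide_inverse)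
    finally show ?thesis .
  qed
  have C0: "C \<ge> 0"
    by (rule order_trans[OF Bochner_Integration.integral_nonneg exp_mean[of 1]]) auto
  define H where "H z r = ennreal (indicator (cball 0 1) z * (indicator {1..} r * exp (u (r *\<^sub>R z))))" for z :: "real^'n" and r :: real
  have mH: "(\<lambda>(z, r). H z r) \<in> borel_measurable (lborel \<Otimes>\<^sub>M lborel)"
  proof -
    have "continuous_on UNIV (\<lambda>x :: (real^'n) \<times> real. exp (u (snd x *\<^sub>R fst x)))"
      by (intro continuous_on_exp continuous_on_compose2[OF u_continuous] continuous_intros) auto
    then have "continuous_on (cball 0 1 \<times> {1..}) (\<lambda>x :: (real^'n) \<times> real. exp (u (snd x *\<^sub>R fst x)))"
      by (rule continuous_on_subset) simp
    moreover have "cball (0::real^'n) 1 \<times> {1::real..} \<in> sets borel" by (intro borel_closed closed_Times) auto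
    ultimately have "(\<lambda>x :: (real^'n) \<times> real. indicator (cball 0 1 \<times> {1..}) x *\<^sub>R exp (u (snd x *\<^sub>R fst x))) \<in> borel_measurable borel"
      by (intro borel_measurable_continuous_on_indicator)
    from measurable_compose[OF this measurable_ennreal]
    have "(\<lambda>x :: (real^'n) \<times> real. ennreal (indicator (cball 0 1 \<times> {1..}) x *\<^sub>R exp (u (snd x *\<^sub>R fst x))))
      \<in> borel_measurable (lborel \<Otimes>\<^sub>M lborel)" by (simp add: lborel_prod)
    moreover have "(\<lambda>(z, r). H z r) = (\<lambda>x. ennreal (indicator (cball 0 1 \<times> {1..}) x *\<^sub>R exp (u (snd x *\<^sub>R fst x))))"
      by (auto simp: H_def indicator_def)
    ultimately show ?thesis by simp
  qed
  have bound: "(\<integral>\<^sup>+ z. H z r \<partial>lborel) \<le> ennreal (exp C * C) * indicator {1..R1} r + ennreal (exp A * C) * (ennreal (r powr (- s)) * indicator {R1..} r)" for r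
  proof -
    consider "r < 1" | "1 \<le> r" "r \<le> R1" | "R1 \<le> r" by linarith
    then show ?thesis
    proof cases
      case 1 then show ?thesis by (simp add: H_def)
    next
      case 2
      have "(\<integral>\<^sup>+ z. H z r \<partial>lborel) \<le> ennreal (exp (l r) * C)" unfolding H_def using 2 exp_average[of r] by simp
      also have "\<dots> \<le> ennreal (exp C * C)" using l_le[of r] 2 C0 by (intro ennreal_leI mult_right_mono) auto
      finally show ?thesis using 2 by (simp add: add_increasing2)
    next
      case 3
      have "(\<integral>\<^sup>+ z. H z r \<partial>lborel) \<le> ennreal (exp (l r) * C)" unfolding H_def using 3 R1(1) exp_average[of r] by simp
      also have "\<dots> \<le> ennreal ((exp A * r powr (- s)) * C)" using lR[OF 3] C0 by (intro ennreal_leI mult_right_mono) auto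
      also have "\<dots> = ennreal (exp A * C) * ennreal (r powr (- s))" using C0 by (simp add: ennreal_mult[symmetric] mult_ac)
      finally show ?thesis using 3 by (simp add: add_increasing)
    qed
  qed
  have tail: "(\<integral>\<^sup>+ r. ennreal (r powr (- s)) * indicator {R1..} r \<partial>lborel) = ennreal (0 - R1 powr (1 - s) / (1 - s))"
  proof (rule nn_integral_FTC_atLeast)
    show "((\<lambda>r. r powr (1 - s) / (1 - s)) has_real_derivative r powr (- s)) (at r)" if "R1 \<le> r" for r
      using DERIV_cdivide[OF has_real_derivative_powr[of r "1 - s"], of "1 - s"] that R1(1) s by simp
    have "((\<lambda>r. r powr (1 - s)) \<longlongrightarrow> 0) at_top" using s by (intro tendsto_neg_powr filterlim_ident) auto
    from tendsto_divide[OF this tendsto_const[of "1 - s"]] show "((\<lambda>r. r powr (1 - s) / (1 - s)) \<longlongrightarrow> 0) at_top"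
      using s by simp
  qed auto
  have "(\<integral>\<^sup>+ z. (\<integral>\<^sup>+ r. H z r \<partial>lborel) \<partial>lborel) = (\<integral>\<^sup>+ r. (\<integral>\<^sup>+ z. H z r \<partial>lborel) \<partial>lborel)"
    using lborel_pair.Fubini'[OF mH] by simp
  also have "\<dots> \<le> (\<integral>\<^sup>+ r. ennreal (exp C * C) * indicator {1..R1} r + ennreal (exp A * C) * (ennreal (r powr (- s)) * indicator {R1..} r) \<partial>lborel)"
    by (intro nn_integral_mono bound)
  also have "\<dots> = ennreal (exp C * C) * ennreal (R1 - 1) + ennreal (exp A * C) * (\<integral>\<^sup>+ r. ennreal (r powr (- s)) * indicator {R1..} r \<partial>lborel)"
    using R1(1) by (simp add: nn_integral_add nn_integral_cmult nn_integral_cmult_indicator)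
  also have "\<dots> < \<infinity>" unfolding tail by (simp add: ennreal_mult_less_top)
  finally have "(\<integral>\<^sup>+ z. (\<integral>\<^sup>+ r. H z r \<partial>lborel) \<partial>lborel) \<noteq> \<infinity>" by simp
  moreover have "(\<lambda>z. \<integral>\<^sup>+ r. H z r \<partial>lborel) \<in> borel_measurable lborel"
    using lborel.borel_measurable_nn_integral[OF mH] by simp
  ultimately have "AE z in lborel. (\<integral>\<^sup>+ r. H z r \<partial>lborel) \<noteq> \<infinity>"
    by (intro nn_integral_PInf_AE)
  moreover have "AE z in lborel. z \<noteq> (0::real^'n)" by (rule AE_lborel_singleton)
  ultimately have "AE z in lborel. z \<notin> cball (0::real^'n) 1"
  proof eventually_elim
    case (elim z)
    show ?case
    proof
      assume "z \<in> cball 0 1"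
      then have "H z r = ennreal (indicator {1..} r * exp (u (r *\<^sub>R z)))" for r by (simp add: H_def)
      then show False using elim complete_imp_ray_length_infinite[OF u_continuous comp, of z] by simp
    qed
  qed
  then have "cball (0::real^'n) 1 \<in> null_sets lborel" by (subst (asm) AE_iff_null) (auto simp: cball_def)
  then have "measure lborel (cball (0::real^'n) 1) = 0" by (simp add: measure_eq_0_null_sets)
  then show False using content_cball_pos[of 1 "0::real^'n"] by simp
qed

end

section \<open>The bounds on the total Q-curvature\<close>

theorem theorem1p1:
  fixes u :: "real^'n::finite \<Rightarrow> real"
  assumes "4 \<le> CARD('n)" and "even CARD('n)"
    and "smooth u"
    and "complete_metric (conformal_metric u)"
    and "\<exists>K. compact K \<and> (\<forall>x. x \<notin> K \<longrightarrow> 0 \<le> scalar_curvature (conformal_metric u) x)"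
    and "integrable (conformal_volume u) (\<lambda>x. max (- Q_curvature u x) 0)"
  shows "integrable (conformal_volume u) (Q_curvature u)
    \<and> 0 \<le> (LINT x|conformal_volume u. Q_curvature u x)
    \<and> (LINT x|conformal_volume u. Q_curvature u x)
        \<le> fact (CARD('n) - 1) * unit_sphere_volume TYPE('n) / 2"
proof -
  define m where "m = CARD('n) div 2"
  have n: "CARD('n) = 2 * m" and m: "2 \<le> m" using assms(1,2) by (auto simp: m_def)
  note u = assms(3)
  obtain K where K: "compact K" "\<And>x. x \<notin> K \<Longrightarrow> 0 \<le> scalar_curvature (conformal_metric u) x" using assms(5) by blast
  obtain R0 where R0: "\<And>x. x \<in> K \<Longrightarrow> norm x \<le> R0"
    using compact_imp_bounded[OF K(1)] unfolding bounded_iff by blast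
  have sup: "laplacian u x + (real m - 1) * (\<Sum>i\<in>UNIV. (partial_deriv i u x)\<^sup>2) \<le> 0" if "norm x > R0" for x
  proof -
    let ?S = "laplacian u x + (real m - 1) * (\<Sum>i\<in>UNIV. (partial_deriv i u x)\<^sup>2)"
    have "0 \<le> scalar_curvature (conformal_metric u) x" using that R0 by (intro K(2)) force
    also have "\<dots> = - (exp (- 2 * u x) * (2 * (2 * real m - 1))) * ?S"
      unfolding scalar_curvature_conformal_metric[OF u] n by (simp add: algebra_simps)
    finally have "(exp (- 2 * u x) * (2 * (2 * real m - 1))) * ?S \<le> 0" by simp
    moreover have "exp (- 2 * u x) * (2 * (2 * real m - 1)) > 0" using m by simp
    ultimately show ?thesis by (metis mult_pos_pos not_le)
  qed
  obtain C l where Cl: "\<And>R. 0 < R \<Longrightarrow> l R \<le> C"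
    "\<And>R z. 0 < R \<Longrightarrow> norm z \<le> 1 \<Longrightarrow> l R \<le> u (R *\<^sub>R z)"
    "\<And>R. 0 < R \<Longrightarrow> (\<integral>z. indicator (cball 0 1) z * exp ((real m - 1) * (u (R *\<^sub>R z) - l R)) \<partial>lborel) \<le> C"
    by (rule log_superharmonic_scale_bound[OF n m u sup]) auto
  interpret scale_bounded u m C l
    by unfold_locales (use n m u Cl in auto)
  have Qf: "Q_curvature u x = curv_density x / exp (real CARD('n) * u x)" for x
    unfolding Q_curvature_def curv_density_def polylaplacian_def unfolding m_def ..
  have cQ: "continuous_on UNIV (Q_curvature u)" unfolding Qf[abs_def]
    by (intro continuous_intros curv_density_continuous u_continuous) auto
  have mQ: "Q_curvature u \<in> borel_measurable lborel"
    using borel_measurable_continuous_onI[OF cQ] by simp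
  have me: "(\<lambda>x. exp (real CARD('n) * u x)) \<in> borel_measurable lborel"
    using borel_measurable_continuous_onI[OF continuous_on_exp[OF continuous_on_mult_left[OF u_continuous]]] by simp
  have "integrable lborel (\<lambda>x. exp (real CARD('n) * u x) *\<^sub>R max (- Q_curvature u x) 0)"
    using assms(6) unfolding conformal_volume_def
    by (subst (asm) integrable_density) (use mQ me in \<open>auto intro!: borel_measurable_max\<close>)
  moreover have "exp (real CARD('n) * u x) *\<^sub>R max (- Q_curvature u x) 0 = max (- curv_density x) 0" for x
    unfolding Qf by (auto simp: max_def divide_less_0_iff field_simps)
  ultimately have "integrable lborel (\<lambda>x. max (- curv_density x) 0)" by (simp only:)
  then have int: "integrable lborel curv_density" by (rule curv_density_integrable)
  have eQ: "(\<lambda>x. exp (real CARD('n) * u x) *\<^sub>R Q_curvature u x) = curv_density"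
    unfolding Qf by auto
  have 1: "integrable (conformal_volume u) (Q_curvature u)"
    unfolding conformal_volume_def by (subst integrable_density) (use mQ me int eQ in auto)
  have 2: "(LINT x|conformal_volume u. Q_curvature u x) = integral\<^sup>L lborel curv_density"
    unfolding conformal_volume_def by (subst integral_density) (use mQ me eQ in auto)
  show ?thesis
    unfolding 2 using 1 total_nonneg[OF int] total_le[OF int assms(4)] unfolding crit_mass_def by blast
qed

end
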